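(* Let $A=kQ_A/I_A$ be a finite dimensional monomial algebra and let $B=kQ_B/I_B$ be the algebra obtained from $A$ by gluing a source arrow $\alpha:e_1\to e_2$ and a sink arrow $\beta:e_{n-1}\to e_n$ from the same block of $A$. Let $I=\langle\gamma^*\|\gamma^*\rangle$ be the one-dimensional Lie ideal of $\mathrm{HH}^1(B)$ spanned by the class of $\gamma^*\|\gamma^*$. If $\mathrm{char}(k)=0$, then $I$ is contained in the center of $\mathrm{HH}^{1}(B)$ and there is a Lie algebra isomorphism $$\mathrm{HH}^{1}(B)\simeq\mathrm{HH}^{1}(A)\times k.$$
   Context: Let $k$ be a field. Paths are composed from right to left: $p=a_r\cdots a_1$ has $s(p)=s(a_1)$, $t(p)=t(a_r)$; vertices are identified with trivial paths and with the corresponding idempotents. A finite dimensional monomial algebra is a finite dimensional algebra $A=kQ_A/I_A$, where $Q_A$ is a finite quiver (vertex set $(Q_A)_0$, arrow set $(Q_A)_1$) and $I_A$ is an admissible ideal generated by a set $Z_A$ of paths of length $\ge 2$ which is minimal (no proper subpath of an element of $Z_A$ lies in $Z_A$). $\mathcal{B}_A$ is the set of paths of $Q_A$ (including trivial ones) containing no element of $Z_A$ as a subpath; it gives a $k$-basis of $A$. Blocks of $A$ correspond to connected components of $Q_A$. Gluing two arrows. $Q_A$ has vertices $e_1,\dots,e_n$ ($n\ge 4$) and arrows $\alpha,\beta,\gamma_1,\dots,\gamma_m$ ($m\ge 0$) with $\alpha:e_1\to e_2$, $\beta:e_{n-1}\to e_n$, and $e_1,e_2,e_{n-1},e_n$ pairwise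 different. The algebra $B$ obtained by gluing $\alpha$ and $\beta$ is the subalgebra of $A$ generated by $f_1:=e_1+e_{n-1}$, $f_2:=e_2+e_n$, $f_i:=e_i$ ($3\le i\le n-2$), $\gamma^*:=\alpha+\beta$, $\gamma_j^*:=\gamma_j$ ($1\le j\le m$). Then $B\simeq kQ_B/I_B$, where $Q_B$ is obtained from $Q_A$ by identifying $\alpha$ with $\beta$ (so $e_1$ with $e_{n-1}$ and $e_2$ with $e_n$). Write $a\mapsto a^*$ for the induced map on arrows ($\alpha^*=\beta^*=\gamma^*$) and $p\mapsto p^*$ for the induced map on paths. $I_B$ is the ideal generated by the images of the paths in $Z_A$ together with $Z_{new}=\{\lambda^*\eta^*,\xi^*\mu^*,\xi^*\gamma^*\eta^*\mid t(\eta)=e_1,t(\mu)=e_2\,(\mu\ne\alpha),s(\lambda)=e_{n-1}\,(\lambda\neq\beta),s(\xi)=e_n\}\cup\{\lambda^*\eta^*,\xi^*\mu^*,\xi^*\gamma^*\eta^*\mid t(\eta)=e_{n-1},t(\mu)=e_n\,(\mu\neq\beta),s(\lambda)=e_1\,(\lambda\neq\alpha),s(\xi)=e_2\}$ ($\eta,\mu,\lambda,\xi\in(Q_A)_1$). Thus $B$ is monomial; $Z_B$, $\mathcal{B}_B$ are defined as for $A$. Source/sink arrows. $\alpha$ is a source arrow if $s(\alpha)$ is a source vertex and, except $\alpha$, no arrow starts at $s(\alpha)$ and no arrow ends at $t(\alpha)$. $\beta$ is a sink arrow if $t(\beta)$ is a sink vertex and, except $\beta$, no arrow starts at $s(\beta)$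 and no arrow ends at $t(\beta)$. Complex. Paths $\epsilon,\gamma$ are parallel ($\epsilon\|\gamma$) if they have the same start and the same end. For sets $X,Y$ of paths, $k(X\|Y)$ is the vector space with basis the pairs $\epsilon\|\gamma$ of parallel paths, $\epsilon\in X,\gamma\in Y$. For a monomial algebra with data $(Q,Z,\mathcal{B})$ consider $k(Q_0\|\mathcal{B})\xrightarrow{\delta^0}k(Q_1\|\mathcal{B})\xrightarrow{\delta^1}k(Z\|\mathcal{B})$, where $\delta^0(e\|\gamma)=\sum_{s(a)=e,\,a\gamma\in\mathcal{B}}a\|a\gamma-\sum_{t(a)=e,\,\gamma a\in\mathcal{B}}a\|\gamma a$ and $\delta^1(a\|\gamma)=\sum_{r\in Z}r\|r^{a\|\gamma}$, with $r^{a\|\gamma}$ the sum of all paths in $\mathcal{B}$ obtained by replacing one appearance of $a$ in $r$ by $\gamma$ (one summand for each appearance). Then $\mathrm{HH}^1=\mathrm{Ker}(\delta^1)/\mathrm{Im}(\delta^0)$, with Lie bracket induced by $[a\|\gamma,b\|\epsilon]=b\|\epsilon^{a\|\gamma}-a\|\gamma^{b\|\epsilon}$. In the product $\mathrm{HH}^1(A)\times k$, $k$ is the one-dimensional (abelian) Lie algebra. *)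

theory Defs
  imports
    "Graph_Theory.Digraph_Component"
    "HOL-Library.Poly_Mapping"
    "HOL-Computational_Algebra.Computational_Algebra"
begin

section \<open>Quivers, paths and monomial algebras\<close>

text \<open>
  Quivers are the directed multigraphs of the library. The path $a_r \cdots a_1$ starting at $v$
  is the pair \<open>(v, [a\<^sub>1, \<dots>, a\<^sub>r])\<close>, so arrows are listed in the order in which they are traversed
  and the product $qp$ ($p$ first) concatenates the list of $p$ with that of $q$.
  The trivial path at $v$ is \<open>(v, [])\<close>.
\<close>

type_synonym ('v, 'a) quiver = "('v, 'a) pre_digraph"
type_synonym ('v, 'a) qpath = "'v \<times> 'a list"

definition path_end :: "('v, 'a) quiver \<Rightarrow> ('v, 'a) qpath \<Rightarrow> 'v" where
  "path_end Q p = pre_digraph.awlast Q (fst p) (snd p)"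

definition paths :: "('v, 'a) quiver \<Rightarrow> ('v, 'a) qpath set" where
  "paths Q = {p. pre_digraph.awalk Q (fst p) (snd p) (path_end Q p)}"

definition path_length :: "('v, 'a) qpath \<Rightarrow> nat" where
  "path_length p = length (snd p)"

definition trivial_path :: "'v \<Rightarrow> ('v, 'a) qpath" where
  "trivial_path v = (v, [])"

definition arrow_path :: "('v, 'a) quiver \<Rightarrow> 'a \<Rightarrow> ('v, 'a) qpath" where
  "arrow_path Q a = (tail Q a, [a])"

definition subpath :: "('v, 'a) quiver \<Rightarrow> ('v, 'a) qpath \<Rightarrow> ('v, 'a) qpath \<Rightarrow> bool" where
  "subpath Q q p \<longleftrightarrow>
     (\<exists>xs ys. snd p = xs @ snd q @ ys \<and> path_end Q (fst p, xs) = fst q)"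

text \<open>The path basis $\mathcal B$ of $kQ/\langle Z\rangle$.\<close>

definition path_basis :: "('v, 'a) quiver \<Rightarrow> ('v, 'a) qpath set \<Rightarrow> ('v, 'a) qpath set" where
  "path_basis Q Z = {p \<in> paths Q. \<not> (\<exists>z\<in>Z. subpath Q z p)}"

text \<open>
  The data $(Q, Z)$ of a finite dimensional monomial algebra $kQ/I$, $I = \langle Z\rangle$.
  Since a path lies in $I$ iff it contains a subpath from $Z$, the axiom \<open>admissible\<close> says
  $J^N \subseteq I$ for the arrow ideal $J$, while \<open>length_ge_2\<close> says $I \subseteq J^2$.
  The axiom \<open>finite_dimensional\<close> is implied by the others.
\<close>

locale monomial_algebra = fin_digraph Q
  for Q :: "('v, 'a) quiver" and Z :: "('v, 'a) qpath set" +
  assumes relations_paths: "Z \<subseteq> paths Q"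
    and length_ge_2: "z \<in> Z \<Longrightarrow> 2 \<le> path_length z"
    and minimal: "z \<in> Z \<Longrightarrow> z' \<in> Z \<Longrightarrow> subpath Q z' z \<Longrightarrow> z' = z"
    and admissible: "\<exists>N. \<forall>p\<in>paths Q. N \<le> path_length p \<longrightarrow> (\<exists>z\<in>Z. subpath Q z p)"
    and finite_dimensional: "finite (path_basis Q Z)"

text \<open>Blocks are the connected components of the underlying undirected graph.\<close>

definition same_block :: "('v, 'a) quiver \<Rightarrow> 'a \<Rightarrow> 'a \<Rightarrow> bool" where
  "same_block Q a b \<longleftrightarrow> tail Q a \<rightarrow>\<^sup>*\<^bsub>with_proj (mk_symmetric Q)\<^esub> tail Q b"

definition source_arrow :: "('v, 'a) quiver \<Rightarrow> 'a \<Rightarrow> bool" where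
  "source_arrow Q a \<longleftrightarrow> a \<in> arcs Q
     \<and> (\<forall>b\<in>arcs Q. head Q b \<noteq> tail Q a)
     \<and> (\<forall>b\<in>arcs Q. b \<noteq> a \<longrightarrow> tail Q b \<noteq> tail Q a \<and> head Q b \<noteq> head Q a)"

definition sink_arrow :: "('v, 'a) quiver \<Rightarrow> 'a \<Rightarrow> bool" where
  "sink_arrow Q b \<longleftrightarrow> b \<in> arcs Q
     \<and> (\<forall>a\<in>arcs Q. tail Q a \<noteq> head Q b)
     \<and> (\<forall>a\<in>arcs Q. a \<noteq> b \<longrightarrow> tail Q a \<noteq> tail Q b \<and> head Q a \<noteq> head Q b)"


section \<open>Gluing two arrows\<close>

text \<open>
  In the glued quiver \<open>\<alpha>\<close> represents the identified arrow $\gamma^*$, and \<open>tail Q \<alpha>\<close>, \<open>head Q \<alpha>\<close>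
  represent $f_1$, $f_2$. The definitions are meant for \<open>\<alpha>\<close>, \<open>\<beta>\<close> with four different end points.
\<close>

definition star_vertex :: "('v, 'a) quiver \<Rightarrow> 'a \<Rightarrow> 'a \<Rightarrow> 'v \<Rightarrow> 'v" where
  "star_vertex Q \<alpha> \<beta> v =
     (if v = tail Q \<beta> then tail Q \<alpha> else if v = head Q \<beta> then head Q \<alpha> else v)"

definition star_arrow :: "'a \<Rightarrow> 'a \<Rightarrow> 'a \<Rightarrow> 'a" where
  "star_arrow \<alpha> \<beta> a = (if a = \<beta> then \<alpha> else a)"

definition star_path :: "('v, 'a) quiver \<Rightarrow> 'a \<Rightarrow> 'a \<Rightarrow> ('v, 'a) qpath \<Rightarrow> ('v, 'a) qpath" where
  "star_path Q \<alpha> \<beta> p = (star_vertex Q \<alpha> \<beta> (fst p), map (star_arrow \<alpha> \<beta>) (snd p))"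

definition glue_quiver :: "('v, 'a) quiver \<Rightarrow> 'a \<Rightarrow> 'a \<Rightarrow> ('v, 'a) quiver" where
  "glue_quiver Q \<alpha> \<beta> =
     \<lparr> verts = star_vertex Q \<alpha> \<beta> ` verts Q,
       arcs = star_arrow \<alpha> \<beta> ` arcs Q,
       tail = star_vertex Q \<alpha> \<beta> \<circ> tail Q,
       head = star_vertex Q \<alpha> \<beta> \<circ> head Q \<rparr>"

text \<open>
  \<open>star_word Q \<alpha> \<beta> [a\<^sub>1, \<dots>, a\<^sub>r]\<close> is the path $a_r^* \cdots a_1^*$ of the glued quiver (for $r \ge 1$); the
  $a_i$ need not be composable in \<open>Q\<close>.
\<close>

definition star_word :: "('v, 'a) quiver \<Rightarrow> 'a \<Rightarrow> 'a \<Rightarrow> 'a list \<Rightarrow> ('v, 'a) qpath" where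
  "star_word Q \<alpha> \<beta> as = star_path Q \<alpha> \<beta> (tail Q (hd as), as)"

text \<open>
  One of the two sets of new relations: $\lambda^*\eta^*$, $\xi^*\mu^*$ and $\xi^*\gamma^*\eta^*$,
  where $\eta$, $\mu$ end at the source and target of \<open>a\<close>, and $\lambda$, $\xi$ start at the source
  and target of \<open>b\<close>. The other set exchanges the roles of \<open>a\<close> and \<open>b\<close>.
\<close>

definition new_relations_half ::
  "('v, 'a) quiver \<Rightarrow> 'a \<Rightarrow> 'a \<Rightarrow> 'a \<Rightarrow> 'a \<Rightarrow> ('v, 'a) qpath set" where
  "new_relations_half Q \<alpha> \<beta> a b =
     {star_word Q \<alpha> \<beta> [\<eta>, l] | \<eta> l. \<eta> \<in> arcs Q \<and> l \<in> arcs Q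
        \<and> head Q \<eta> = tail Q a \<and> tail Q l = tail Q b \<and> l \<noteq> b}
   \<union> {star_word Q \<alpha> \<beta> [\<mu>, \<xi>] | \<mu> \<xi>. \<mu> \<in> arcs Q \<and> \<xi> \<in> arcs Q
        \<and> head Q \<mu> = head Q a \<and> \<mu> \<noteq> a \<and> tail Q \<xi> = head Q b}
   \<union> {star_word Q \<alpha> \<beta> [\<eta>, \<alpha>, \<xi>] | \<eta> \<xi>. \<eta> \<in> arcs Q \<and> \<xi> \<in> arcs Q
        \<and> head Q \<eta> = tail Q a \<and> tail Q \<xi> = head Q b}"

definition new_relations :: "('v, 'a) quiver \<Rightarrow> 'a \<Rightarrow> 'a \<Rightarrow> ('v, 'a) qpath set" where
  "new_relations Q \<alpha> \<beta> = new_relations_half Q \<alpha> \<beta> \<alpha> \<beta> \<union> new_relations_half Q \<alpha> \<beta> \<beta> \<alpha>"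

text \<open>
  The images of the elements of $Z_A$ together with $Z_{new}$ generate $I_B$, but need not form a minimal set
  of paths; $Z_B$ consists of those among them having no proper subpath among them.
\<close>

definition minimal_relations ::
  "('v, 'a) quiver \<Rightarrow> ('v, 'a) qpath set \<Rightarrow> ('v, 'a) qpath set" where
  "minimal_relations Q G = {z \<in> G. \<forall>z'\<in>G. subpath Q z' z \<longrightarrow> z' = z}"

definition glue_relations ::
  "('v, 'a) quiver \<Rightarrow> ('v, 'a) qpath set \<Rightarrow> 'a \<Rightarrow> 'a \<Rightarrow> ('v, 'a) qpath set" where
  "glue_relations Q Z \<alpha> \<beta> =
     minimal_relations (glue_quiver Q \<alpha> \<beta>) (star_path Q \<alpha> \<beta> ` Z \<union> new_relations Q \<alpha> \<beta>)"


section \<open>The cochain complex\<close>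

text \<open>
  A parallel pair $\epsilon\|\gamma$ is the pair \<open>(\<epsilon>, \<gamma>)\<close>; $k(X\|Y)$ is realised inside the free vector
  space on all pairs of paths.
\<close>

type_synonym ('v, 'a, 'k) cochain = "('v, 'a) qpath \<times> ('v, 'a) qpath \<Rightarrow>\<^sub>0 'k"

definition parallel_pairs ::
  "('v, 'a) quiver \<Rightarrow> ('v, 'a) qpath set \<Rightarrow> ('v, 'a) qpath set
     \<Rightarrow> (('v, 'a) qpath \<times> ('v, 'a) qpath) set" where
  "parallel_pairs Q X Y =
     {(\<epsilon>, \<gamma>). \<epsilon> \<in> X \<and> \<gamma> \<in> Y \<and> fst \<epsilon> = fst \<gamma> \<and> path_end Q \<epsilon> = path_end Q \<gamma>}"

definition cochains ::
  "('v, 'a) quiver \<Rightarrow> ('v, 'a) qpath set \<Rightarrow> ('v, 'a) qpath set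
     \<Rightarrow> ('v, 'a, 'k::field) cochain set" where
  "cochains Q X Y = {f. Poly_Mapping.keys f \<subseteq> parallel_pairs Q X Y}"

abbreviation basis_elt ::
  "('v, 'a) qpath \<Rightarrow> ('v, 'a) qpath \<Rightarrow> ('v, 'a, 'k::field) cochain" where
  "basis_elt \<epsilon> \<gamma> \<equiv> Poly_Mapping.single (\<epsilon>, \<gamma>) 1"

definition scale_cochain :: "'k::field \<Rightarrow> ('b \<Rightarrow>\<^sub>0 'k) \<Rightarrow> ('b \<Rightarrow>\<^sub>0 'k)" where
  "scale_cochain c f = Poly_Mapping.map ((*) c) f"

definition linear_extension ::
  "('b \<Rightarrow> ('c \<Rightarrow>\<^sub>0 'k::field)) \<Rightarrow> ('b \<Rightarrow>\<^sub>0 'k) \<Rightarrow> ('c \<Rightarrow>\<^sub>0 'k)" where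
  "linear_extension F f =
     (\<Sum>x\<in>Poly_Mapping.keys f. scale_cochain (Poly_Mapping.lookup f x) (F x))"

definition trivial_paths :: "('v, 'a) quiver \<Rightarrow> ('v, 'a) qpath set" where
  "trivial_paths Q = trivial_path ` verts Q"

definition arrow_paths :: "('v, 'a) quiver \<Rightarrow> ('v, 'a) qpath set" where
  "arrow_paths Q = arrow_path Q ` arcs Q"

text \<open>
  \<open>replace_at r i \<gamma>\<close> replaces the arrow at position \<open>i\<close> of the path \<open>r\<close> by the (parallel) path \<open>\<gamma>\<close>;
  \<open>subst_sum Q Z x r a \<gamma>\<close> is $x\|r^{a\|\gamma}$.
\<close>

definition replace_at :: "('v, 'a) qpath \<Rightarrow> nat \<Rightarrow> ('v, 'a) qpath \<Rightarrow> ('v, 'a) qpath" where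
  "replace_at r i \<gamma> = (fst r, take i (snd r) @ snd \<gamma> @ drop (Suc i) (snd r))"

definition subst_sum ::
  "('v, 'a) quiver \<Rightarrow> ('v, 'a) qpath set \<Rightarrow> ('v, 'a) qpath \<Rightarrow> ('v, 'a) qpath
     \<Rightarrow> 'a \<Rightarrow> ('v, 'a) qpath \<Rightarrow> ('v, 'a, 'k::field) cochain" where
  "subst_sum Q Z x r a \<gamma> =
     (\<Sum>i | i < path_length r \<and> snd r ! i = a \<and> replace_at r i \<gamma> \<in> path_basis Q Z.
        basis_elt x (replace_at r i \<gamma>))"

definition delta0 ::
  "('v, 'a) quiver \<Rightarrow> ('v, 'a) qpath set
     \<Rightarrow> ('v, 'a, 'k::field) cochain \<Rightarrow> ('v, 'a, 'k) cochain" where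
  "delta0 Q Z = linear_extension (\<lambda>((e, _), (_, g)).
     (\<Sum>a | a \<in> arcs Q \<and> tail Q a = e \<and> (e, g @ [a]) \<in> path_basis Q Z.
        basis_elt (arrow_path Q a) (e, g @ [a]))
   - (\<Sum>a | a \<in> arcs Q \<and> head Q a = e \<and> (tail Q a, a # g) \<in> path_basis Q Z.
        basis_elt (arrow_path Q a) (tail Q a, a # g)))"

definition delta1 ::
  "('v, 'a) quiver \<Rightarrow> ('v, 'a) qpath set
     \<Rightarrow> ('v, 'a, 'k::field) cochain \<Rightarrow> ('v, 'a, 'k) cochain" where
  "delta1 Q Z = linear_extension (\<lambda>(x, \<gamma>). \<Sum>r\<in>Z. subst_sum Q Z r r (hd (snd x)) \<gamma>)"

definition cochain_bracket ::
  "('v, 'a) quiver \<Rightarrow> ('v, 'a) qpath set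
     \<Rightarrow> ('v, 'a, 'k::field) cochain \<Rightarrow> ('v, 'a, 'k) cochain \<Rightarrow> ('v, 'a, 'k) cochain" where
  "cochain_bracket Q Z f g =
     linear_extension (\<lambda>(x, \<gamma>). linear_extension (\<lambda>(y, \<epsilon>).
         subst_sum Q Z y \<epsilon> (hd (snd x)) \<gamma> - subst_sum Q Z x \<gamma> (hd (snd y)) \<epsilon>) g) f"

definition cocycles1 ::
  "('v, 'a) quiver \<Rightarrow> ('v, 'a) qpath set \<Rightarrow> ('v, 'a, 'k::field) cochain set" where
  "cocycles1 Q Z = {f \<in> cochains Q (arrow_paths Q) (path_basis Q Z). delta1 Q Z f = 0}"

definition coboundaries1 ::
  "('v, 'a) quiver \<Rightarrow> ('v, 'a) qpath set \<Rightarrow> ('v, 'a, 'k::field) cochain set" where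
  "coboundaries1 Q Z = delta0 Q Z ` cochains Q (trivial_paths Q) (path_basis Q Z)"


section \<open>Lie algebras\<close>

record ('k, 'g) lie_struct =
  lcarrier :: "'g set"
  lzero :: 'g
  ladd :: "'g \<Rightarrow> 'g \<Rightarrow> 'g"
  lscale :: "'k \<Rightarrow> 'g \<Rightarrow> 'g"
  lbracket :: "'g \<Rightarrow> 'g \<Rightarrow> 'g"

definition lie_iso ::
  "('g \<Rightarrow> 'h) \<Rightarrow> ('k, 'g) lie_struct \<Rightarrow> ('k, 'h) lie_struct \<Rightarrow> bool" where
  "lie_iso \<Phi> L M \<longleftrightarrow> bij_betw \<Phi> (lcarrier L) (lcarrier M)
     \<and> (\<forall>x\<in>lcarrier L. \<forall>y\<in>lcarrier L. \<Phi> (ladd L x y) = ladd M (\<Phi> x) (\<Phi> y))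
     \<and> (\<forall>c. \<forall>x\<in>lcarrier L. \<Phi> (lscale L c x) = lscale M c (\<Phi> x))
     \<and> (\<forall>x\<in>lcarrier L. \<forall>y\<in>lcarrier L. \<Phi> (lbracket L x y) = lbracket M (\<Phi> x) (\<Phi> y))"

definition lie_isomorphic ::
  "('k, 'g) lie_struct \<Rightarrow> ('k, 'h) lie_struct \<Rightarrow> bool" (infix \<open>\<simeq>\<^sub>L\<close> 50) where
  "L \<simeq>\<^sub>L M \<longleftrightarrow> (\<exists>\<Phi>. lie_iso \<Phi> L M)"

definition lie_center :: "('k, 'g) lie_struct \<Rightarrow> 'g set" where
  "lie_center L = {x \<in> lcarrier L. \<forall>y\<in>lcarrier L. lbracket L x y = lzero L}"

definition lie_ideal :: "('k, 'g) lie_struct \<Rightarrow> 'g set \<Rightarrow> bool" where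
  "lie_ideal L I \<longleftrightarrow> I \<subseteq> lcarrier L \<and> lzero L \<in> I
     \<and> (\<forall>x\<in>I. \<forall>y\<in>I. ladd L x y \<in> I)
     \<and> (\<forall>c. \<forall>x\<in>I. lscale L c x \<in> I)
     \<and> (\<forall>x\<in>lcarrier L. \<forall>y\<in>I. lbracket L x y \<in> I)"

definition lie_line :: "('k, 'g) lie_struct \<Rightarrow> 'g \<Rightarrow> 'g set" where
  "lie_line L x = range (\<lambda>c. lscale L c x)"

definition lie_prod ::
  "('k, 'g) lie_struct \<Rightarrow> ('k, 'h) lie_struct \<Rightarrow> ('k, 'g \<times> 'h) lie_struct" (infixr \<open>\<times>\<^sub>L\<close> 80) where
  "L \<times>\<^sub>L M =
     \<lparr> lcarrier = lcarrier L \<times> lcarrier M,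
       lzero = (lzero L, lzero M),
       ladd = (\<lambda>(x, y) (x', y'). (ladd L x x', ladd M y y')),
       lscale = (\<lambda>c (x, y). (lscale L c x, lscale M c y)),
       lbracket = (\<lambda>(x, y) (x', y'). (lbracket L x x', lbracket M y y')) \<rparr>"

text \<open>The field, as a one-dimensional abelian Lie algebra.\<close>

definition lie_field :: "('k::field, 'k) lie_struct" where
  "lie_field =
     \<lparr> lcarrier = UNIV, lzero = 0, ladd = (+), lscale = (*), lbracket = (\<lambda>_ _. 0) \<rparr>"

text \<open>
  $\mathrm{HH}^1$ is the set of cosets of the coboundaries in the cocycles. The operations collect the
  results for all representatives, and hence yield a coset whenever they are compatible with
  passing to the quotient.
\<close>

definition coset :: "('b \<Rightarrow>\<^sub>0 'k::field) set \<Rightarrow> ('b \<Rightarrow>\<^sub>0 'k) \<Rightarrow> ('b \<Rightarrow>\<^sub>0 'k) set" where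
  "coset J f = (\<lambda>j. f + j) ` J"

abbreviation HH1_class ::
  "('v, 'a) quiver \<Rightarrow> ('v, 'a) qpath set
     \<Rightarrow> ('v, 'a, 'k::field) cochain \<Rightarrow> ('v, 'a, 'k) cochain set" where
  "HH1_class Q Z \<equiv> coset (coboundaries1 Q Z)"

definition HH1 ::
  "('v, 'a) quiver \<Rightarrow> ('v, 'a) qpath set
     \<Rightarrow> ('k::field, ('v, 'a, 'k) cochain set) lie_struct" where
  "HH1 Q Z =
     \<lparr> lcarrier = HH1_class Q Z ` cocycles1 Q Z,
       lzero = coboundaries1 Q Z,
       ladd = (\<lambda>X Y. \<Union>f\<in>X. \<Union>g\<in>Y. HH1_class Q Z (f + g)),
       lscale = (\<lambda>c X. \<Union>f\<in>X. HH1_class Q Z (scale_cochain c f)),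
       lbracket = (\<lambda>X Y. \<Union>f\<in>X. \<Union>g\<in>Y. HH1_class Q Z (cochain_bracket Q Z f g)) \<rparr>"

end

theory Submission
  imports Defs
begin

text \<open>
  The arrow $\gamma^*$ is the only one of $Q_B$ starting at $f_1$ and the only one ending at $f_2$,
  and the new relations $\xi^*\gamma^*\eta^*$ forbid it in the interior of a path. So a nonzero
  path of $B$ lifts to $A$, and a pair $a\|p$ with $a \neq \gamma^*$ is the same thing for $A$ and
  for $B$. The remaining pairs are $\alpha\|\alpha$ and $\beta\|\beta$ for $A$, which are coboundaries,
  and $\gamma^*\|\gamma^*$ and $\gamma^*\|\gamma^* q \gamma^*$ for $B$, of which the latter are
  coboundaries. Hence dropping the pairs at $\gamma^*$ is a homomorphism of Lie algebras from the
  complex of $B$ to that of $A$ whose kernel in cohomology is the line of $\gamma^*\|\gamma^*$, which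
  is central.

  It remains to split off this line. As \<open>\<alpha>\<close> and \<open>\<beta>\<close> lie in one block, $Q_B$ carries a circulation
  with value 1 on $\gamma^*$; averaging it over parallel arrows is possible in characteristic 0. The
  functional $f \mapsto \sum_a w_a f(a\|a)$ then vanishes on coboundaries because $w$ is a circulation
  and on brackets because $w$ is constant on parallel arrows (characteristic 0 also excludes
  pairs $a\|e$ with a loop $a$ from the support of a cocycle).
\<close>

section \<open>Finitely supported functions\<close>

text \<open>Cochains in degree 1 are handled as derivations: \<open>path_deriv\<close> lets one act
  on paths, and \<open>inner_cochain\<close> is the inner derivation of a cycle. Two identities
  carry the theory of each single algebra: an inner derivation applied to a path telescopes, and the
  bracket of a cocycle f with the inner derivation of g is the inner derivation of f(g).

  The obstacle in comparing A with B is degree 0, where the complexes do not match: e_1 and e_n give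
  coboundaries of their own in A, while in B paths of A from e_2 to e_{n-1} close up to cycles
  through the glued arrow. Both kinds disappear when the pairs at glued arrows are dropped, so it is
  the projected spaces of coboundaries that are compared, generator by generator.

  The conditions on w come from the brackets that reach the diagonal. For parallel arrows
  [a||b, b||a] = b||b - a||a, which forces w_a = w_b. For a loop a at e with aa nonzero,
  [a||e, a||aa] = 2 a||a, so pairs a||e have to be kept out of the cocycles. Spreading a flow over n
  parallel arrows divides by n, and a relation a^m excludes a||e because m is invertible.\<close>

lemma lookup_scale_cochain [simp]:
  "Poly_Mapping.lookup (scale_cochain c f) x = c * Poly_Mapping.lookup f x"
  unfolding scale_cochain_def by (transfer) (auto simp: when_def)

interpretation cochain: vector_space "scale_cochain :: 'k::field \<Rightarrow> ('b \<Rightarrow>\<^sub>0 'k) \<Rightarrow> _"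
  by unfold_locales (auto intro!: poly_mapping_eqI simp: lookup_add algebra_simps)

text \<open>Cancellation can shrink the support of a sum, so additivity is obtained by summing over
  a common finite superset of the supports.\<close>

lemma linear_extension_superset:
  assumes "finite S" "Poly_Mapping.keys f \<subseteq> S"
  shows "linear_extension F f = (\<Sum>x\<in>S. scale_cochain (Poly_Mapping.lookup f x) (F x))"
  unfolding linear_extension_def
  by (rule sum.mono_neutral_left) (use assms in \<open>auto simp: in_keys_iff\<close>)

lemma linear_extension_single [simp]:
  "linear_extension F (Poly_Mapping.single x c) = scale_cochain c (F x)"
  by (subst linear_extension_superset[of "{x}"]) (auto simp: lookup_single)

lemma linear_extension_0 [simp]: "linear_extension F 0 = 0"
  by (simp add: linear_extension_def)

lemma linear_extension_add:
  "linear_extension F (f + g) = linear_extension F f + linear_extension F g"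
proof -
  let ?S = "Poly_Mapping.keys f \<union> Poly_Mapping.keys g"
  have "Poly_Mapping.keys (f + g) \<subseteq> ?S" by (rule Poly_Mapping.keys_add)
  then show ?thesis
    by (simp add: linear_extension_superset[of ?S] lookup_add cochain.scale_left_distrib
        sum.distrib)
qed

lemma linear_extension_scale:
  "linear_extension F (scale_cochain c f) = scale_cochain c (linear_extension F f)"
proof -
  have "Poly_Mapping.keys (scale_cochain c f) \<subseteq> Poly_Mapping.keys f"
    by (auto simp: in_keys_iff)
  then show ?thesis
    by (simp add: linear_extension_superset[of "Poly_Mapping.keys f"] cochain.scale_sum_right)
qed

lemma linear_linear_extension:
  "Vector_Spaces.linear scale_cochain scale_cochain (linear_extension F)"
  by unfold_locales (simp_all add: linear_extension_add linear_extension_scale)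

lemmas linear_extension_diff =
  Vector_Spaces.linear.axioms(3)[OF linear_linear_extension, THEN module_hom.diff]
lemmas linear_extension_uminus =
  Vector_Spaces.linear.axioms(3)[OF linear_linear_extension, THEN module_hom.neg]
lemmas linear_extension_sum =
  Vector_Spaces.linear.axioms(3)[OF linear_linear_extension, THEN module_hom.sum]

lemma linear_extension_cong:
  "(\<And>x. x \<in> Poly_Mapping.keys f \<Longrightarrow> F x = G x) \<Longrightarrow> linear_extension F f = linear_extension G f"
  unfolding linear_extension_def by (auto intro: sum.cong)

lemma linear_extension_linear_extension:
  "linear_extension G (linear_extension F f) = linear_extension (\<lambda>x. linear_extension G (F x)) f"
  by (simp add: linear_extension_def[of F] linear_extension_def[of "\<lambda>x. linear_extension G (F x)"]
      linear_extension_sum linear_extension_scale)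

lemma linear_extension_fun_add:
  "linear_extension (\<lambda>x. F x + G x) f = linear_extension F f + linear_extension G f"
  by (simp add: linear_extension_def cochain.scale_right_distrib sum.distrib)

lemma linear_extension_fun_diff:
  "linear_extension (\<lambda>x. F x - G x) f = linear_extension F f - linear_extension G f"
  by (simp add: linear_extension_def cochain.scale_right_diff_distrib sum_subtractf)

lemma linear_extension_fun_0 [simp]: "linear_extension (\<lambda>x. 0) f = 0"
  by (simp add: linear_extension_def)

lemma linear_extension_fun_sum:
  "linear_extension (\<lambda>x. \<Sum>i\<in>A. F i x) f = (\<Sum>i\<in>A. linear_extension (F i) f)"
  by (simp add: linear_extension_def cochain.scale_sum_right sum.swap[of _ A])

lemma linear_extension_swap:
  "linear_extension (\<lambda>x. linear_extension (\<lambda>y. H x y) g) f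
     = linear_extension (\<lambda>y. linear_extension (\<lambda>x. H x y) f) g"
  by (simp add: linear_extension_def cochain.scale_sum_right sum.swap[of _ "Poly_Mapping.keys f"]
      mult.commute)

text \<open>The means by which later membership claims are reduced to single basis pairs.\<close>

lemma linear_extension_in_subspace:
  assumes "cochain.subspace S" "\<And>x. x \<in> Poly_Mapping.keys f \<Longrightarrow> F x \<in> S"
  shows "linear_extension F f \<in> S"
  unfolding linear_extension_def
  using assms by (auto intro!: cochain.subspace_sum cochain.subspace_scale)

lemma lookup_linear_extension:
  "Poly_Mapping.lookup (linear_extension F f) y
     = (\<Sum>x\<in>Poly_Mapping.keys f. Poly_Mapping.lookup f x * Poly_Mapping.lookup (F x) y)"
  by (simp add: linear_extension_def lookup_sum)

lemma linear_extension_id: "linear_extension (\<lambda>x. Poly_Mapping.single x 1) f = f"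
  by (rule poly_mapping_eqI)
    (simp add: lookup_linear_extension lookup_single when_def if_distrib[of "(*) _"] in_keys_iff
      cong: if_cong)

text \<open>Distinct basis elements of the support go to distinct basis elements, so nothing
  cancels. This transports the vanishing of a coboundary component from B back to A.\<close>

lemma linear_extension_inj_eq_0:
  assumes inj: "inj_on F (Poly_Mapping.keys h)"
    and 0: "linear_extension (\<lambda>x. Poly_Mapping.single (F x) 1) h = 0"
  shows "h = 0"
proof (rule poly_mapping_eqI)
  fix x
  show "Poly_Mapping.lookup h x = Poly_Mapping.lookup 0 x"
  proof (cases "x \<in> Poly_Mapping.keys h")
    case True
    have "0 = Poly_Mapping.lookup (linear_extension (\<lambda>x. Poly_Mapping.single (F x) 1) h) (F x)"
      by (simp add: 0)
    also have "\<dots> = (\<Sum>y\<in>Poly_Mapping.keys h. if y = x then Poly_Mapping.lookup h y else 0)"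
      unfolding lookup_linear_extension
      by (rule sum.cong) (use inj True in \<open>auto simp: lookup_single when_def inj_on_def\<close>)
    also have "\<dots> = Poly_Mapping.lookup h x" using True by simp
    finally show ?thesis by simp
  qed (simp add: in_keys_iff)
qed

lemma subspace_supported:
  "cochain.subspace {f :: 'b \<Rightarrow>\<^sub>0 'k::field. Poly_Mapping.keys f \<subseteq> S}"
  unfolding cochain.subspace_def
  by (auto simp: in_keys_iff lookup_add) (metis add_0 in_keys_iff subsetD)

section \<open>Paths\<close>

lemma path_end_Nil [simp]: "path_end Q (v, []) = v"
  by (simp add: path_end_def pre_digraph.awalk_verts.simps)

lemma path_end_Cons [simp]: "path_end Q (v, a # w) = path_end Q (head Q a, w)"
  by (simp add: path_end_def pre_digraph.awalk_verts.simps pre_digraph.awalk_verts_non_Nil)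

lemma path_end_append [simp]:
  "path_end Q (v, xs @ ys) = path_end Q (path_end Q (v, xs), ys)"
  by (induction xs arbitrary: v) auto

lemma (in wf_digraph) paths_Nil [simp]: "(v, []) \<in> paths G \<longleftrightarrow> v \<in> verts G"
  by (simp add: paths_def awalk_Nil_iff)

lemma (in wf_digraph) paths_Cons [simp]:
  "(v, a # w) \<in> paths G \<longleftrightarrow> a \<in> arcs G \<and> tail G a = v \<and> (head G a, w) \<in> paths G"
  by (auto simp: paths_def awalk_Cons_iff)

lemma (in wf_digraph) paths_append [simp]:
  "(v, xs @ ys) \<in> paths G \<longleftrightarrow> (v, xs) \<in> paths G \<and> (path_end G (v, xs), ys) \<in> paths G"
proof (induction xs arbitrary: v)
  case Nil
  then show ?case by (cases ys) auto
qed auto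

lemma (in wf_digraph) paths_set: "(v, w) \<in> paths G \<Longrightarrow> set w \<subseteq> arcs G"
  by (induction w arbitrary: v) auto

lemma (in wf_digraph) path_start_in_verts: "(v, w) \<in> paths G \<Longrightarrow> v \<in> verts G"
  by (cases w) auto

lemma (in wf_digraph) path_end_in_verts: "(v, w) \<in> paths G \<Longrightarrow> path_end G (v, w) \<in> verts G"
  by (induction w arbitrary: v) auto

lemma (in wf_digraph) paths_tail_nth:
  "(v, w) \<in> paths G \<Longrightarrow> i < length w \<Longrightarrow> tail G (w ! i) = path_end G (v, take i w)"
  by (induction w arbitrary: v i) (auto simp: take_Cons' nth_Cons')

lemma subpath_trans: "subpath Q p q \<Longrightarrow> subpath Q q r \<Longrightarrow> subpath Q p r"
  unfolding subpath_def
proof (elim exE conjE)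
  fix xs ys xs' ys'
  assume "snd q = xs @ snd p @ ys" "path_end Q (fst q, xs) = fst p"
    "snd r = xs' @ snd q @ ys'" "path_end Q (fst r, xs') = fst q"
  then show "\<exists>xs ys. snd r = xs @ snd p @ ys \<and> path_end Q (fst r, xs) = fst p"
    by (intro exI[of _ "xs' @ xs"] exI[of _ "ys @ ys'"]) auto
qed

lemma subpath_refl: "subpath Q p p"
  unfolding subpath_def by (intro exI[of _ "[]"]) auto

text \<open>Factors of a nonzero path are nonzero: a relation inside the factor is also inside the
  whole path.\<close>

lemma (in wf_digraph) path_basis_infix:
  assumes "(v, xs @ w @ ys) \<in> path_basis G Z"
  shows "(path_end G (v, xs), w) \<in> path_basis G Z"
proof -
  have "subpath G (path_end G (v, xs), w) (v, xs @ w @ ys)"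
    unfolding subpath_def by (intro exI[of _ xs] exI[of _ ys]) auto
  then show ?thesis
    using assms by (auto simp: path_basis_def dest: subpath_trans)
qed

lemma (in wf_digraph) path_basis_prefix:
  "(v, w @ ys) \<in> path_basis G Z \<Longrightarrow> (v, w) \<in> path_basis G Z"
  using path_basis_infix[of v "[]" w ys] by simp

lemma (in wf_digraph) path_basis_suffix:
  "(v, xs @ w) \<in> path_basis G Z \<Longrightarrow> (path_end G (v, xs), w) \<in> path_basis G Z"
  using path_basis_infix[of v xs w "[]"] by simp


section \<open>The first Hochschild cohomology of a quiver with monomial relations\<close>

text \<open>The residue class of the path \<open>p\<close>, carrying the label \<open>x\<close>:
  paths in the ideal become 0. It replaces the side conditions on the path basis in the index sets
  of the complex.\<close>

definition basis_proj ::
  "('v, 'a) quiver \<Rightarrow> ('v, 'a) qpath set \<Rightarrow> ('v, 'a) qpath \<Rightarrow> ('v, 'a) qpath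
     \<Rightarrow> ('v, 'a, 'k::field) cochain" where
  "basis_proj Q Z x p = (if p \<in> path_basis Q Z then basis_elt x p else 0)"

text \<open>The derivation \<open>f\<close> applied to the path \<open>r\<close>. The label
  \<open>x\<close> is free: a relation gives a component of \<open>delta1\<close>, an arrow gives
  half of a bracket, a trivial path gives a cochain of degree 0.\<close>

definition path_deriv ::
  "('v, 'a) quiver \<Rightarrow> ('v, 'a) qpath set \<Rightarrow> ('v, 'a, 'k::field) cochain \<Rightarrow> ('v, 'a) qpath
     \<Rightarrow> ('v, 'a) qpath \<Rightarrow> ('v, 'a, 'k) cochain" where
  "path_deriv Q Z f x r = linear_extension (\<lambda>(y, \<gamma>). subst_sum Q Z x r (hd (snd y)) \<gamma>) f"

text \<open>This is the value of \<open>delta0\<close> at e||g, the commutator with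
  \<open>g\<close>. It is defined for arbitrary lists \<open>g\<close>, so that it can also be
  evaluated at cycles in the ideal.\<close>

definition inner_cochain ::
  "('v, 'a) quiver \<Rightarrow> ('v, 'a) qpath set \<Rightarrow> 'v \<Rightarrow> 'a list \<Rightarrow> ('v, 'a, 'k::field) cochain" where
  "inner_cochain Q Z e g =
     (\<Sum>a | a \<in> arcs Q \<and> tail Q a = e. basis_proj Q Z (arrow_path Q a) (e, g @ [a]))
   - (\<Sum>a | a \<in> arcs Q \<and> head Q a = e. basis_proj Q Z (arrow_path Q a) (tail Q a, a # g))"

lemma subst_sum_eq:
  "subst_sum Q Z x r a \<gamma>
     = (\<Sum>i | i < path_length r \<and> snd r ! i = a. basis_proj Q Z x (replace_at r i \<gamma>))"
  unfolding subst_sum_def basis_proj_def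
  by (subst sum.inter_filter[symmetric]) (auto intro: sum.cong)

lemma path_deriv_eq:
  "path_deriv Q Z f x r = linear_extension (\<lambda>(y, \<gamma>). 
     \<Sum>i | i < path_length r \<and> snd r ! i = hd (snd y). basis_proj Q Z x (replace_at r i \<gamma>)) f"
  unfolding path_deriv_def subst_sum_eq ..

lemma path_deriv_add: "path_deriv Q Z (f + g) x r = path_deriv Q Z f x r + path_deriv Q Z g x r"
  by (simp add: path_deriv_def linear_extension_add)

lemma path_deriv_scale:
  "path_deriv Q Z (scale_cochain c f) x r = scale_cochain c (path_deriv Q Z f x r)"
  by (simp add: path_deriv_def linear_extension_scale)

lemma keys_path_deriv: "Poly_Mapping.keys (path_deriv Q Z f x r) \<subseteq> {x} \<times> path_basis Q Z"
proof -
  have "path_deriv Q Z f x r \<in> {h. Poly_Mapping.keys h \<subseteq> {x} \<times> path_basis Q Z}"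
    unfolding path_deriv_eq
    by (rule linear_extension_in_subspace[OF subspace_supported])
      (auto simp: basis_proj_def split: if_split_asm
        intro!: cochain.subspace_sum[OF subspace_supported, simplified])
  then show ?thesis by simp
qed

text \<open>Displays the bracket as a commutator of derivations: \<open>f\<close> applied to the
  values of \<open>g\<close>, minus \<open>g\<close> applied to the values of
  \<open>f\<close>.\<close>

lemma cochain_bracket_eq:
  "cochain_bracket Q Z f g
     = linear_extension (\<lambda>(y, \<epsilon>). path_deriv Q Z f y \<epsilon>) g
       - linear_extension (\<lambda>(x, \<gamma>). path_deriv Q Z g x \<gamma>) f"
  unfolding cochain_bracket_def path_deriv_def
  by (simp add: case_prod_unfold linear_extension_fun_diff
      linear_extension_swap[of _ f g])

lemma cochain_bracket_add_left:
  "cochain_bracket Q Z (f + f') g = cochain_bracket Q Z f g + cochain_bracket Q Z f' g"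
  by (simp add: cochain_bracket_def linear_extension_add)

lemma cochain_bracket_scale_left:
  "cochain_bracket Q Z (scale_cochain c f) g = scale_cochain c (cochain_bracket Q Z f g)"
  by (simp add: cochain_bracket_def linear_extension_scale)

lemma cochain_bracket_swap: "cochain_bracket Q Z g f = - cochain_bracket Q Z f g"
  by (simp add: cochain_bracket_eq)

lemma cochain_bracket_add_right:
  "cochain_bracket Q Z f (g + g') = cochain_bracket Q Z f g + cochain_bracket Q Z f g'"
  by (simp add: cochain_bracket_eq path_deriv_add linear_extension_add linear_extension_fun_add
      case_prod_unfold)

lemma cochain_bracket_scale_right:
  "cochain_bracket Q Z f (scale_cochain c g) = scale_cochain c (cochain_bracket Q Z f g)"
  using cochain_bracket_scale_left[of Q Z c g f]
  by (simp add: cochain_bracket_swap[of Q Z _ f])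

lemma delta1_eq:
  "delta1 Q Z f = (\<Sum>r\<in>Z. path_deriv Q Z f r r)"
  unfolding delta1_def path_deriv_def
  by (simp add: case_prod_unfold linear_extension_fun_sum)

text \<open>What is established both for \<open>(Q, Z)\<close> and for the glued data. The complex,
  its bracket and the quotient are treated at this level, so that every result can be used for A and
  for B.\<close>

locale quiver_relations = fin_digraph Q
  for Q :: "('v, 'a) quiver" and Z :: "('v, 'a) qpath set" +
  assumes finite_relations: "finite Z"
    and relations_in_paths: "Z \<subseteq> paths Q"
    and relation_length: "z \<in> Z \<Longrightarrow> 2 \<le> length (snd z)"
begin

text \<open>\<open>subpath\<close> also compares start vertices. A relation contains an arrow, whose
  source fixes the start, so an occurrence of the list of arrows is already enough.\<close>

lemma not_basis_infix:
  assumes "z \<in> Z"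
  shows "(v, xs @ snd z @ ys) \<notin> path_basis Q Z"
proof
  assume basis: "(v, xs @ snd z @ ys) \<in> path_basis Q Z"
  obtain a w where z: "snd z = a # w"
    using relation_length[OF assms] by (cases "snd z") auto
  have "(fst z, a # w) \<in> paths Q"
    using assms relations_in_paths z by (metis prod.collapse subsetD)
  moreover have "(v, xs @ (a # w) @ ys) \<in> paths Q"
    using basis z by (auto simp: path_basis_def)
  ultimately have "subpath Q z (v, xs @ snd z @ ys)"
    unfolding subpath_def using z by (intro exI[of _ xs] exI[of _ ys]) auto
  then show False
    using assms basis by (auto simp: path_basis_def)
qed

lemma not_basis_relationE:
  assumes "p \<in> paths Q" "p \<notin> path_basis Q Z"
  obtains z xs ys where "z \<in> Z" "snd p = xs @ snd z @ ys"
  using assms by (auto simp: path_basis_def subpath_def)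

lemma arrow_in_basis: "a \<in> arcs Q \<Longrightarrow> (tail Q a, [a]) \<in> path_basis Q Z"
proof (rule ccontr)
  assume a: "a \<in> arcs Q" and "(tail Q a, [a]) \<notin> path_basis Q Z"
  then obtain z xs ys where z: "z \<in> Z" "[a] = xs @ snd z @ ys"
    by (elim not_basis_relationE[rotated]) auto
  have "length [a] \<ge> length (snd z)"
    unfolding z(2) by simp
  with relation_length[OF z(1)] show False by simp
qed

lemma trivial_in_basis: "v \<in> verts Q \<Longrightarrow> (v, []) \<in> path_basis Q Z"
proof (rule ccontr)
  assume "v \<in> verts Q" and "(v, []) \<notin> path_basis Q Z"
  then obtain z xs ys where z: "z \<in> Z" "[] = xs @ snd z @ ys"
    by (elim not_basis_relationE[rotated]) auto
  with relation_length[OF z(1)] show False by simp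
qed

text \<open>Components at different relations carry different labels and cannot cancel, so the
  cocycle condition can be tested relation by relation.\<close>

lemma delta1_eq_0_iff: "delta1 Q Z f = 0 \<longleftrightarrow> (\<forall>r\<in>Z. path_deriv Q Z f r r = 0)"
proof
  assume 0: "delta1 Q Z f = 0"
  show "\<forall>r\<in>Z. path_deriv Q Z f r r = 0"
  proof (intro ballI poly_mapping_eqI)
    fix r and xp :: "('v, 'a) qpath \<times> ('v, 'a) qpath" assume r: "r \<in> Z"
    obtain x p where xp: "xp = (x, p)" by (cases xp)
    have other: "Poly_Mapping.lookup (path_deriv Q Z f r r) (x, p) = 0" if "x \<noteq> r"
      using that keys_path_deriv[of Q Z f r r] by (auto simp: in_keys_iff)
    have "Poly_Mapping.lookup (delta1 Q Z f) (r, p)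
        = (\<Sum>r'\<in>Z. if r' = r then Poly_Mapping.lookup (path_deriv Q Z f r r) (r, p) else 0)"
      unfolding delta1_eq lookup_sum
      using keys_path_deriv[of Q Z f] by (intro sum.cong) (force simp: in_keys_iff)+
    then have "Poly_Mapping.lookup (path_deriv Q Z f r r) (r, p) = 0"
      using 0 r finite_relations by simp
    then show "Poly_Mapping.lookup (path_deriv Q Z f r r) xp = Poly_Mapping.lookup 0 xp"
      using other xp by (cases "x = r") auto
  qed
qed (simp add: delta1_eq)

lemma cocycles1_iff:
  "f \<in> cocycles1 Q Z \<longleftrightarrow>
     f \<in> cochains Q (arrow_paths Q) (path_basis Q Z) \<and> (\<forall>r\<in>Z. path_deriv Q Z f r r = 0)"
  by (auto simp: cocycles1_def delta1_eq_0_iff)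

lemma subspace_cochains: "cochain.subspace (cochains Q X Y)"
  unfolding cochains_def by (rule subspace_supported)

lemma subspace_cocycles1: "cochain.subspace (cocycles1 Q Z)"
  using subspace_cochains[of "arrow_paths Q" "path_basis Q Z"]
  by (auto simp: cochain.subspace_def cocycles1_iff path_deriv_add path_deriv_scale)
     (simp add: path_deriv_def)

lemma delta0_eq:
  fixes h :: "('v, 'a, 'k::field) cochain"
  shows "delta0 Q Z h = linear_extension (\<lambda>((e, _), (_, g)). inner_cochain Q Z e g) h"
proof -
  have "(\<Sum>a | a \<in> arcs Q \<and> tail Q a = e \<and> (e, g @ [a]) \<in> path_basis Q Z.
        basis_elt (arrow_path Q a) (e, g @ [a]) :: ('v, 'a, 'k) cochain)
     = (\<Sum>a | a \<in> arcs Q \<and> tail Q a = e. basis_proj Q Z (arrow_path Q a) (e, g @ [a]))"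
    for e g unfolding basis_proj_def
    by (rule sum.mono_neutral_cong_left) auto
  moreover have "(\<Sum>a | a \<in> arcs Q \<and> head Q a = e \<and> (tail Q a, a # g) \<in> path_basis Q Z.
        basis_elt (arrow_path Q a) (tail Q a, a # g) :: ('v, 'a, 'k) cochain)
     = (\<Sum>a | a \<in> arcs Q \<and> head Q a = e. basis_proj Q Z (arrow_path Q a) (tail Q a, a # g))"
    for e g unfolding basis_proj_def
    by (rule sum.mono_neutral_cong_left) auto
  ultimately show ?thesis
    unfolding delta0_def inner_cochain_def by simp
qed

lemma subspace_coboundaries1: "cochain.subspace (coboundaries1 Q Z)"
proof -
  let ?C = "cochains Q (trivial_paths Q) (path_basis Q Z)"
  have "delta0 Q Z f + delta0 Q Z g \<in> delta0 Q Z ` ?C" if "f \<in> ?C" "g \<in> ?C" for f g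
    using that cochain.subspace_add[OF subspace_cochains, of f _ _ g]
    by (auto intro!: image_eqI[of _ _ "f + g"] simp: delta0_eq linear_extension_add)
  moreover have "scale_cochain c (delta0 Q Z f) \<in> delta0 Q Z ` ?C" if "f \<in> ?C" for f c
    using that cochain.subspace_scale[OF subspace_cochains, of f _ _ c]
    by (auto intro!: image_eqI[of _ _ "scale_cochain c f"] simp: delta0_eq linear_extension_scale)
  moreover have "0 \<in> delta0 Q Z ` ?C"
    using cochain.subspace_0[OF subspace_cochains]
    by (auto intro!: image_eqI[of _ _ 0] simp: delta0_eq)
  ultimately show ?thesis
    unfolding cochain.subspace_def coboundaries1_def by auto
qed

lemma keys_cochains1:
  assumes "f \<in> cochains Q (arrow_paths Q) Y" "(x, p) \<in> Poly_Mapping.keys f"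
  obtains b where "b \<in> arcs Q" "x = (tail Q b, [b])" "p \<in> Y" "fst p = tail Q b"
    "path_end Q p = head Q b"
  using assms by (auto simp: cochains_def parallel_pairs_def arrow_paths_def arrow_path_def)

lemma replace_at_infix:
  assumes "snd p = xs @ snd z @ ys" "j < length (snd z)"
  shows "replace_at p (length xs + j) \<gamma> = (fst p, xs @ snd (replace_at z j \<gamma>) @ ys)"
  using assms by (simp add: replace_at_def)

text \<open>
  A cocycle acts as a derivation preserving the ideal of relations: the summands outside of the
  relation inside \<open>p\<close> vanish, and the others are the component of \<open>\<delta>\<^sup>1 f\<close> at that relation,
  multiplied by paths from both sides.
\<close>

lemma path_deriv_nonbasis:
  assumes f: "f \<in> cocycles1 Q Z" and p: "p \<in> paths Q" "p \<notin> path_basis Q Z"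
  shows "path_deriv Q Z f x p = 0"
proof -
  obtain z xs ys where z: "z \<in> Z" "snd p = xs @ snd z @ ys"
    using p by (rule not_basis_relationE)
  let ?n = "length xs" and ?m = "length (snd z)"
  let ?M = "linear_extension (\<lambda>(_, q). basis_proj Q Z x (fst p, xs @ snd q @ ys))
    :: ('v, 'a, 'b) cochain \<Rightarrow> _"
  have end_xs: "path_end Q (fst p, xs) = fst z"
  proof -
    have "(fst p, xs @ snd z @ ys) \<in> paths Q" using p(1) z(2) by (metis prod.collapse)
    moreover have "(fst z, snd z) \<in> paths Q" using z(1) relations_in_paths by auto
    ultimately show ?thesis
      using relation_length[OF z(1)] by (cases "snd z") auto
  qed
  \<comment> \<open>Multiplication by \<open>xs\<close> and \<open>ys\<close> respects residue
    classes: if \<open>w\<close> is zero in the algebra, so is the product.\<close>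
  have M: "?M (basis_proj Q Z z (fst z, w)) = basis_proj Q Z x (fst p, xs @ w @ ys)" for w
    using path_basis_infix[of "fst p" xs w ys Z] end_xs by (auto simp: basis_proj_def)
  have step: "(\<Sum>i | i < path_length p \<and> snd p ! i = b. basis_proj Q Z x (replace_at p i \<gamma>))
     = ?M (\<Sum>i | i < path_length z \<and> snd z ! i = b. basis_proj Q Z z (replace_at z i \<gamma>))"
    for b \<gamma>
  proof -
    let ?g = "\<lambda>i. basis_proj Q Z x (replace_at p i \<gamma>) :: ('v, 'a, 'b) cochain"
    have "(\<Sum>i | i < path_length p \<and> snd p ! i = b. ?g i)
      = (\<Sum>i \<in> (\<lambda>j. ?n + j) ` {j. j < path_length z \<and> snd z ! j = b}. ?g i)"
    proof (rule sum.mono_neutral_right)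
      show "(\<lambda>j. ?n + j) ` {j. j < path_length z \<and> snd z ! j = b}
          \<subseteq> {i. i < path_length p \<and> snd p ! i = b}"
        using z(2) by (auto simp: path_length_def nth_append)
      show "\<forall>i \<in> {i. i < path_length p \<and> snd p ! i = b}
          - (\<lambda>j. ?n + j) ` {j. j < path_length z \<and> snd z ! j = b}. ?g i = 0"
      proof
        fix i assume i: "i \<in> {i. i < path_length p \<and> snd p ! i = b}
          - (\<lambda>j. ?n + j) ` {j. j < path_length z \<and> snd z ! j = b}"
        have "i < ?n \<or> ?n + ?m \<le> i"
        proof (rule ccontr)
          assume "\<not> (i < ?n \<or> ?n + ?m \<le> i)"
          then obtain j where "i = ?n + j" "j < ?m" by (metis add_less_cancel_left le_Suc_ex not_le)
          with i z(2) show False by (auto simp: path_length_def nth_append)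
        qed
        then have "\<exists>us vs. replace_at p i \<gamma> = (fst p, us @ snd z @ vs)"
        proof
          assume "i < ?n"
          then have "replace_at p i \<gamma> = (fst p, (take i xs @ snd \<gamma> @ drop (Suc i) xs) @ snd z @ ys)"
            using z(2) by (simp add: replace_at_def)
          then show ?thesis by blast
        next
          assume "?n + ?m \<le> i"
          then have "replace_at p i \<gamma> = (fst p, xs @ snd z
              @ (take (i - ?n - ?m) ys @ snd \<gamma> @ drop (Suc i - ?n - ?m) ys))"
            using z(2) by (simp add: replace_at_def)
          then show ?thesis by blast
        qed
        then show "?g i = 0"
          using not_basis_infix[OF z(1)] by (auto simp: basis_proj_def)
      qed
    qed (simp add: path_length_def)
    also have "\<dots> = (\<Sum>j | j < path_length z \<and> snd z ! j = b. ?g (?n + j))"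
      by (subst sum.reindex) auto
    also have "\<dots> = (\<Sum>j | j < path_length z \<and> snd z ! j = b.
        ?M (basis_proj Q Z z (replace_at z j \<gamma>)))"
    proof (rule sum.cong[OF refl])
      fix j assume "j \<in> {j. j < path_length z \<and> snd z ! j = b}"
      then show "?g (?n + j) = ?M (basis_proj Q Z z (replace_at z j \<gamma>))"
        using replace_at_infix[OF z(2), of j \<gamma>] M[of "snd (replace_at z j \<gamma>)"]
        by (simp add: replace_at_def path_length_def)
    qed
    finally show ?thesis by (simp add: linear_extension_sum)
  qed
  have "path_deriv Q Z f x p = ?M (path_deriv Q Z f z z)"
    unfolding path_deriv_eq linear_extension_linear_extension
    by (rule linear_extension_cong) (auto simp: step)
  also have "path_deriv Q Z f z z = 0"
    using f z(1) by (simp add: cocycles1_iff)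
  finally show ?thesis by simp
qed

end

section \<open>Inner derivations and brackets with coboundaries\<close>

lemma sum_fibres:
  fixes h :: "nat \<Rightarrow> 'c \<Rightarrow> 'b::comm_monoid_add"
  assumes "finite A"
  shows "(\<Sum>a\<in>A. \<Sum>i | i < n \<and> f i = a. h i a)
    = (\<Sum>i<n. if f i \<in> A then h i (f i) else 0)"
proof -
  have "(\<Sum>i | i < n \<and> f i = a. h i a) = (\<Sum>i<n. if f i = a then h i a else 0)" for a
    using sum.inter_filter[of "{..<n}" "\<lambda>i. h i a" "\<lambda>i. f i = a", OF finite_lessThan] by simp
  then have "(\<Sum>a\<in>A. \<Sum>i | i < n \<and> f i = a. h i a) = (\<Sum>a\<in>A. \<Sum>i<n. if f i = a then h i a else 0)"
    by simp
  also have "\<dots> = (\<Sum>i<n. \<Sum>a\<in>A. if f i = a then h i a else 0)"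
    by (rule sum.swap)
  also have "\<dots> = (\<Sum>i<n. if f i \<in> A then h i (f i) else 0)"
    using assms by (simp add: sum.delta)
  finally show ?thesis .
qed

context quiver_relations
begin

text \<open>If \<open>q\<close> is zero in the algebra, the left side is 0 by definition, and so is
  every summand on the right, because each replaced path has \<open>q\<close> as a factor.\<close>

lemma path_deriv_basis_proj:
  assumes "p \<in> paths Q" "a \<in> arcs Q" "fst q = tail Q a"
  shows "path_deriv Q Z (basis_proj Q Z (arrow_path Q a) q) x p
    = (\<Sum>i | i < path_length p \<and> snd p ! i = a. basis_proj Q Z x (replace_at p i q))"
proof (cases "q \<in> path_basis Q Z")
  case True
  then show ?thesis
    by (simp add: basis_proj_def path_deriv_eq arrow_path_def)
next
  case False
  have "replace_at p i q \<notin> path_basis Q Z" if "i < path_length p" "snd p ! i = a" for i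
  proof
    assume "replace_at p i q \<in> path_basis Q Z"
    then have "(path_end Q (fst p, take i (snd p)), snd q) \<in> path_basis Q Z"
      unfolding replace_at_def by (rule path_basis_infix)
    moreover have "path_end Q (fst p, take i (snd p)) = fst q"
      using that assms paths_tail_nth[of "fst p" "snd p" i] by (simp add: path_length_def)
    ultimately show False using False by simp
  qed
  with False show ?thesis
    by (auto simp: basis_proj_def path_deriv_eq intro!: sum.neutral[symmetric])
qed

lemma path_deriv_diff: "path_deriv Q Z (f - g) x p = path_deriv Q Z f x p - path_deriv Q Z g x p"
  by (simp add: path_deriv_def linear_extension_diff)

lemma path_deriv_sum: "path_deriv Q Z (\<Sum>i\<in>I. F i) x p = (\<Sum>i\<in>I. path_deriv Q Z (F i) x p)"
  by (simp add: path_deriv_def linear_extension_sum)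

text \<open>Inserting the cycle before an arrow cancels against inserting it after the preceding one.\<close>

lemma path_deriv_inner_cochain:
  assumes p: "p \<in> paths Q"
  shows "path_deriv Q Z (inner_cochain Q Z e g :: ('v, 'a, 'k::field) cochain) x p
    = (if fst p = e then basis_proj Q Z x (fst p, g @ snd p) else 0)
      - (if path_end Q p = e then basis_proj Q Z x (fst p, snd p @ g) else 0)"
proof -
  let ?n = "path_length p"
  \<comment> \<open>\<open>ins i\<close> inserts \<open>g\<close> at the vertex reached after
    \<open>i\<close> arrows. Replacing arrow number \<open>i\<close> by \<open>g\<close> followed by
    that arrow gives \<open>ins i\<close>; with \<open>g\<close> after the arrow it gives
    \<open>ins (Suc i)\<close>. Only \<open>ins 0\<close> and \<open>ins ?n\<close> survive the
    difference.\<close>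
  define ins where "ins i = (if path_end Q (fst p, take i (snd p)) = e
      then basis_proj Q Z x (fst p, take i (snd p) @ g @ drop i (snd p)) else 0
        :: ('v, 'a, 'k) cochain)" for i
  have arc: "snd p ! i \<in> arcs Q" if "i < ?n" for i
    using that p paths_set[of "fst p" "snd p"] by (auto simp: path_length_def)
  have tl: "tail Q (snd p ! i) = path_end Q (fst p, take i (snd p))" if "i < ?n" for i
    using that p paths_tail_nth[of "fst p" "snd p" i] by (simp add: path_length_def)
  have hd: "head Q (snd p ! i) = path_end Q (fst p, take (Suc i) (snd p))" if "i < ?n" for i
    using that by (simp add: path_length_def take_Suc_conv_app_nth)
  have before: "(\<Sum>a | a \<in> arcs Q \<and> tail Q a = e.
      path_deriv Q Z (basis_proj Q Z (arrow_path Q a) (e, g @ [a])) x p) = (\<Sum>i<?n. ins i)"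
  proof -
    have "(\<Sum>a | a \<in> arcs Q \<and> tail Q a = e.
        path_deriv Q Z (basis_proj Q Z (arrow_path Q a) (e, g @ [a])) x p)
      = (\<Sum>a | a \<in> arcs Q \<and> tail Q a = e. \<Sum>i | i < ?n \<and> snd p ! i = a.
          basis_proj Q Z x (replace_at p i (e, g @ [a])))"
      by (rule sum.cong) (use p in \<open>auto simp: path_deriv_basis_proj\<close>)
    also have "\<dots> = (\<Sum>i<?n. if snd p ! i \<in> {a. a \<in> arcs Q \<and> tail Q a = e}
        then basis_proj Q Z x (replace_at p i (e, g @ [snd p ! i])) else 0)"
      by (rule sum_fibres) simp
    also have "\<dots> = (\<Sum>i<?n. ins i)"
      by (rule sum.cong) (auto simp: ins_def arc tl replace_at_def path_length_def Cons_nth_drop_Suc)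
    finally show ?thesis .
  qed
  have after: "(\<Sum>a | a \<in> arcs Q \<and> head Q a = e.
      path_deriv Q Z (basis_proj Q Z (arrow_path Q a) (tail Q a, a # g)) x p)
     = (\<Sum>i<?n. ins (Suc i))"
  proof -
    have "(\<Sum>a | a \<in> arcs Q \<and> head Q a = e.
        path_deriv Q Z (basis_proj Q Z (arrow_path Q a) (tail Q a, a # g)) x p)
      = (\<Sum>a | a \<in> arcs Q \<and> head Q a = e. \<Sum>i | i < ?n \<and> snd p ! i = a.
          basis_proj Q Z x (replace_at p i (tail Q a, a # g)))"
      by (rule sum.cong) (use p in \<open>auto simp: path_deriv_basis_proj\<close>)
    also have "\<dots> = (\<Sum>i<?n. if snd p ! i \<in> {a. a \<in> arcs Q \<and> head Q a = e}
        then basis_proj Q Z x (replace_at p i (tail Q (snd p ! i), snd p ! i # g)) else 0)"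
      by (rule sum_fibres) simp
    also have "\<dots> = (\<Sum>i<?n. ins (Suc i))"
    proof (rule sum.cong[OF refl])
      fix i assume "i \<in> {..<?n}"
      then have i: "i < ?n" by simp
      have eq: "take i (snd p) @ snd p ! i # g @ drop (Suc i) (snd p)
          = take (Suc i) (snd p) @ g @ drop (Suc i) (snd p)"
        using i by (simp add: path_length_def take_Suc_conv_app_nth)
      then show "(if snd p ! i \<in> {a. a \<in> arcs Q \<and> head Q a = e}
          then basis_proj Q Z x (replace_at p i (tail Q (snd p ! i), snd p ! i # g)) else 0)
        = ins (Suc i)"
        unfolding ins_def using arc[OF i] hd[OF i] by (simp add: replace_at_def eq)
    qed
    finally show ?thesis .
  qed
  have "path_deriv Q Z (inner_cochain Q Z e g :: ('v, 'a, 'k) cochain) x p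
      = (\<Sum>i<?n. ins i - ins (Suc i))"
    by (simp add: inner_cochain_def path_deriv_diff path_deriv_sum before after sum_subtractf)
  also have "\<dots> = ins 0 - ins ?n"
    by (rule sum_lessThan_telescope')
  finally show ?thesis
    by (auto simp: ins_def path_length_def)
qed

lemma inner_cochain_nonbasis:
  assumes "(e, w) \<notin> path_basis Q Z"
  shows "inner_cochain Q Z e w = 0"
proof -
  have "(e, w @ [a]) \<notin> path_basis Q Z" for a
    using assms path_basis_prefix by blast
  moreover have "(tail Q a, a # w) \<notin> path_basis Q Z" if "head Q a = e" for a
    using assms path_basis_suffix[of "tail Q a" "[a]" w Z] that by auto
  ultimately show ?thesis by (simp add: inner_cochain_def basis_proj_def)
qed

text \<open>A cocycle kills the paths of the ideal, so discarding such a \<open>q\<close> before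
  applying \<open>f\<close> loses nothing.\<close>

lemma linear_extension_basis_proj_path_deriv:
  assumes "f \<in> cocycles1 Q Z" "q \<in> paths Q"
  shows "linear_extension (\<lambda>(y, \<epsilon>). path_deriv Q Z f y \<epsilon>) (basis_proj Q Z y q) = path_deriv Q Z f y q"
  using path_deriv_nonbasis[OF assms, of y] by (simp add: basis_proj_def)

text \<open>The classical identity [D, ad g] = ad D(g). By the Leibniz rule \<open>f\<close> applied
  to the products of \<open>g\<close> with an arrow \<open>a\<close> gives terms in f(g) and terms
  in f(a); the latter are exactly the inner derivation applied to f(a), and the bracket subtracts
  them. The label \<open>(e, [])\<close> makes f(g) a cochain of degree 0.\<close>

lemma cochain_bracket_inner_cochain:
  fixes f :: "('v, 'a, 'k::field) cochain"
  assumes f: "f \<in> cocycles1 Q Z" and g: "(e, g) \<in> paths Q" "path_end Q (e, g) = e"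
  shows "cochain_bracket Q Z f (inner_cochain Q Z e g)
    = linear_extension (\<lambda>((e, _), (_, w)). inner_cochain Q Z e w) (path_deriv Q Z f (e, []) (e, g))"
proof -
  let ?w = "\<lambda>i \<gamma>. snd (replace_at (e, g) i \<gamma>)"
  let ?I = "\<lambda>b. {i. i < length g \<and> g ! i = b}"
  let ?bp = "\<lambda>x p. basis_proj Q Z x p :: ('v, 'a, 'k) cochain"
  \<comment> \<open>The Leibniz rule for \<open>g\<close> followed by \<open>a\<close>: the replaced
    occurrence lies in \<open>g\<close>, or it is the final \<open>a\<close>. \<open>S_Cons\<close>
    is the mirror image.\<close>
  have S_snoc: "(\<Sum>i | i < path_length (e, g @ [a]) \<and> snd (e, g @ [a]) ! i = b.
      ?bp x (replace_at (e, g @ [a]) i \<gamma>))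
    = (\<Sum>i\<in>?I b. ?bp x (e, ?w i \<gamma> @ [a])) + (if a = b then ?bp x (e, g @ snd \<gamma>) else 0)"
    for x a b \<gamma>
  proof -
    have "{i. i < path_length (e, g @ [a]) \<and> snd (e, g @ [a]) ! i = b}
        = ?I b \<union> (if a = b then {length g} else {})"
      by (auto simp: path_length_def nth_append less_Suc_eq)
    moreover have "(\<Sum>i\<in>?I b. ?bp x (replace_at (e, g @ [a]) i \<gamma>))
        = (\<Sum>i\<in>?I b. ?bp x (e, ?w i \<gamma> @ [a]))"
      by (rule sum.cong) (auto simp: replace_at_def)
    moreover have "?bp x (replace_at (e, g @ [a]) (length g) \<gamma>) = ?bp x (e, g @ snd \<gamma>)"
      by (simp add: replace_at_def)
    moreover have "length g \<notin> ?I b" by simp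
    ultimately show ?thesis
      by (cases "a = b") simp_all
  qed
  have S_Cons: "(\<Sum>i | i < path_length (t, a # g) \<and> snd (t, a # g) ! i = b.
      ?bp x (replace_at (t, a # g) i \<gamma>))
    = (if a = b then ?bp x (t, snd \<gamma> @ g) else 0) + (\<Sum>i\<in>?I b. ?bp x (t, a # ?w i \<gamma>))"
    for x t a b \<gamma>
  proof -
    have "{i. i < path_length (t, a # g) \<and> snd (t, a # g) ! i = b}
        = (if a = b then {0} else {}) \<union> Suc ` ?I b"
      by (auto simp: path_length_def nth_Cons' image_iff less_Suc_eq_0_disj)
    moreover have "(\<Sum>i\<in>Suc ` ?I b. ?bp x (replace_at (t, a # g) i \<gamma>))
        = (\<Sum>i\<in>?I b. ?bp x (t, a # ?w i \<gamma>))"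
      by (subst sum.reindex) (auto simp: replace_at_def)
    moreover have "0 \<notin> Suc ` ?I b" by simp
    moreover have "?bp x (replace_at (t, a # g) 0 \<gamma>) = ?bp x (t, snd \<gamma> @ g)"
      by (simp add: replace_at_def)
    ultimately show ?thesis
      by (cases "a = b") simp_all
  qed
  have lhs1: "linear_extension (\<lambda>(y, \<epsilon>). path_deriv Q Z f y \<epsilon>) (inner_cochain Q Z e g)
    = linear_extension (\<lambda>(y, \<gamma>).
        (\<Sum>a | a \<in> arcs Q \<and> tail Q a = e. (\<Sum>i\<in>?I (hd (snd y)). ?bp (arrow_path Q a) (e, ?w i \<gamma> @ [a]))
          + (if a = hd (snd y) then ?bp (arrow_path Q a) (e, g @ snd \<gamma>) else 0))
      - (\<Sum>a | a \<in> arcs Q \<and> head Q a = e.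
          (if a = hd (snd y) then ?bp (arrow_path Q a) (tail Q a, snd \<gamma> @ g) else 0)
          + (\<Sum>i\<in>?I (hd (snd y)). ?bp (arrow_path Q a) (tail Q a, a # ?w i \<gamma>)))) f"
    (is "_ = ?L1")
  proof -
    have "linear_extension (\<lambda>(y, \<epsilon>). path_deriv Q Z f y \<epsilon>) (inner_cochain Q Z e g)
      = (\<Sum>a | a \<in> arcs Q \<and> tail Q a = e. path_deriv Q Z f (arrow_path Q a) (e, g @ [a]))
      - (\<Sum>a | a \<in> arcs Q \<and> head Q a = e. path_deriv Q Z f (arrow_path Q a) (tail Q a, a # g))"
      unfolding inner_cochain_def linear_extension_diff linear_extension_sum
      by (intro arg_cong2[of _ _ _ _ "(-)"] sum.cong refl linear_extension_basis_proj_path_deriv)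
        (use f g in auto)
    then show ?thesis
      unfolding path_deriv_eq S_snoc S_Cons
      by (simp add: case_prod_unfold linear_extension_fun_diff linear_extension_fun_sum)
  qed
  have lhs2: "linear_extension (\<lambda>(x, \<gamma>). path_deriv Q Z (inner_cochain Q Z e g) x \<gamma>) f
    = linear_extension (\<lambda>(x, \<gamma>).
        (if fst \<gamma> = e then ?bp x (fst \<gamma>, g @ snd \<gamma>) else 0)
      - (if path_end Q \<gamma> = e then ?bp x (fst \<gamma>, snd \<gamma> @ g) else 0)) f" (is "_ = ?L2")
  proof (rule linear_extension_cong, clarify)
    fix x \<gamma> assume "(x, \<gamma>) \<in> Poly_Mapping.keys f"
    then have "\<gamma> \<in> paths Q"
      using f by (auto simp: cocycles1_iff path_basis_def elim: keys_cochains1)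
    then show "path_deriv Q Z (inner_cochain Q Z e g) x \<gamma>
      = (if fst \<gamma> = e then ?bp x (fst \<gamma>, g @ snd \<gamma>) else 0)
      - (if path_end Q \<gamma> = e then ?bp x (fst \<gamma>, snd \<gamma> @ g) else 0)"
      by (rule path_deriv_inner_cochain)
  qed
  have rhs: "linear_extension (\<lambda>((e, _), (_, w)). inner_cochain Q Z e w) (path_deriv Q Z f (e, []) (e, g))
    = linear_extension (\<lambda>(y, \<gamma>). \<Sum>i\<in>?I (hd (snd y)). inner_cochain Q Z e (?w i \<gamma>)) f"
  proof -
    have "linear_extension (\<lambda>((e, _), (_, w)). inner_cochain Q Z e w) (?bp (e, []) (replace_at (e, g) i \<gamma>))
      = inner_cochain Q Z e (?w i \<gamma>)" for i \<gamma>
      using inner_cochain_nonbasis[of e "?w i \<gamma>"] by (auto simp: basis_proj_def replace_at_def)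
    then show ?thesis
      by (simp add: path_deriv_eq linear_extension_linear_extension case_prod_unfold
          linear_extension_sum path_length_def)
  qed
  have "linear_extension (\<lambda>(y, \<epsilon>). path_deriv Q Z f y \<epsilon>) (inner_cochain Q Z e g)
    = linear_extension (\<lambda>(y, \<gamma>). (\<Sum>i\<in>?I (hd (snd y)). inner_cochain Q Z e (?w i \<gamma>))
        + ((if fst \<gamma> = e then ?bp y (fst \<gamma>, g @ snd \<gamma>) else 0)
      - (if path_end Q \<gamma> = e then ?bp y (fst \<gamma>, snd \<gamma> @ g) else 0))) f"
    unfolding lhs1
  proof (rule linear_extension_cong, clarify)
    fix x1 x2 \<gamma>1 \<gamma>2 assume key: "((x1, x2), \<gamma>1, \<gamma>2) \<in> Poly_Mapping.keys f"
    obtain b where b: "b \<in> arcs Q" "(x1, x2) = (tail Q b, [b])" "\<gamma>1 = tail Q b"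
      "path_end Q (\<gamma>1, \<gamma>2) = head Q b"
      using f key by (auto simp: cocycles1_iff elim!: keys_cochains1)
    have hd_b: "hd x2 = b" using b(2) by simp
    \<comment> \<open>The pair under consideration has source arrow \<open>b\<close>, so among the
      terms in f(a) only a = b contributes; its incidence with \<open>e\<close> is read off from the
      parallel path.\<close>
    have diag: "(\<Sum>a | a \<in> arcs Q \<and> tail Q a = e. if a = b then ?bp (arrow_path Q a) (e, g @ \<gamma>2) else 0)
        = (if \<gamma>1 = e then ?bp (x1, x2) (\<gamma>1, g @ \<gamma>2) else 0)"
      "(\<Sum>a | a \<in> arcs Q \<and> head Q a = e. if a = b then ?bp (arrow_path Q a) (tail Q a, \<gamma>2 @ g) else 0)
        = (if path_end Q (\<gamma>1, \<gamma>2) = e then ?bp (x1, x2) (\<gamma>1, \<gamma>2 @ g) else 0)"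
      unfolding b(4) using b(1-3) by (simp_all add: sum.delta arrow_path_def)
    have swap: "(\<Sum>i\<in>?I b. inner_cochain Q Z e (?w i (\<gamma>1, \<gamma>2)))
        = (\<Sum>a | a \<in> arcs Q \<and> tail Q a = e. \<Sum>i\<in>?I b. ?bp (arrow_path Q a) (e, ?w i (\<gamma>1, \<gamma>2) @ [a]))
        - (\<Sum>a | a \<in> arcs Q \<and> head Q a = e. \<Sum>i\<in>?I b. ?bp (arrow_path Q a) (tail Q a, a # ?w i (\<gamma>1, \<gamma>2)))"
      unfolding inner_cochain_def sum_subtractf by (intro arg_cong2[of _ _ _ _ "(-)"] sum.swap)
    show "(\<Sum>a | a \<in> arcs Q \<and> tail Q a = e.
          (\<Sum>i\<in>?I (hd (snd (x1, x2))). ?bp (arrow_path Q a) (e, ?w i (\<gamma>1, \<gamma>2) @ [a]))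
          + (if a = hd (snd (x1, x2)) then ?bp (arrow_path Q a) (e, g @ snd (\<gamma>1, \<gamma>2)) else 0))
      - (\<Sum>a | a \<in> arcs Q \<and> head Q a = e.
          (if a = hd (snd (x1, x2)) then ?bp (arrow_path Q a) (tail Q a, snd (\<gamma>1, \<gamma>2) @ g) else 0)
          + (\<Sum>i\<in>?I (hd (snd (x1, x2))). ?bp (arrow_path Q a) (tail Q a, a # ?w i (\<gamma>1, \<gamma>2))))
      = (\<Sum>i\<in>?I (hd (snd (x1, x2))). inner_cochain Q Z e (?w i (\<gamma>1, \<gamma>2)))
        + ((if fst (\<gamma>1, \<gamma>2) = e then ?bp (x1, x2) (fst (\<gamma>1, \<gamma>2), g @ snd (\<gamma>1, \<gamma>2)) else 0)
      - (if path_end Q (\<gamma>1, \<gamma>2) = e then ?bp (x1, x2) (fst (\<gamma>1, \<gamma>2), snd (\<gamma>1, \<gamma>2) @ g) else 0))"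
      unfolding fst_conv snd_conv unfolding hd_b sum.distrib diag swap by simp
  qed
  then show ?thesis
    unfolding cochain_bracket_eq lhs2 rhs by (simp add: case_prod_unfold linear_extension_fun_add)
qed

lemma replace_at_parallel:
  assumes "r \<in> paths Q" "i < path_length r" "\<gamma> \<in> paths Q"
    and "fst \<gamma> = tail Q (snd r ! i)" "path_end Q \<gamma> = head Q (snd r ! i)"
  shows "replace_at r i \<gamma> \<in> paths Q" "path_end Q (replace_at r i \<gamma>) = path_end Q r"
    "fst (replace_at r i \<gamma>) = fst r"
proof -
  have split: "snd r = take i (snd r) @ snd r ! i # drop (Suc i) (snd r)"
    using assms(2) by (simp add: path_length_def id_take_nth_drop)
  have r: "(fst r, take i (snd r) @ snd r ! i # drop (Suc i) (snd r)) \<in> paths Q"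
    "path_end Q r = path_end Q (fst r, take i (snd r) @ snd r ! i # drop (Suc i) (snd r))"
    unfolding split[symmetric] using assms(1) by simp_all
  have \<gamma>: "\<gamma> = (tail Q (snd r ! i), snd \<gamma>)" using assms(4) by (metis prod.collapse)
  have \<gamma>': "(tail Q (snd r ! i), snd \<gamma>) \<in> paths Q"
    "path_end Q (tail Q (snd r ! i), snd \<gamma>) = head Q (snd r ! i)"
    using assms(3,5) \<gamma> by simp_all
  have "path_end Q (fst r, take i (snd r)) = tail Q (snd r ! i)" using r(1) by simp
  then show "replace_at r i \<gamma> \<in> paths Q" "path_end Q (replace_at r i \<gamma>) = path_end Q r"
    using r \<gamma>' by (simp_all add: replace_at_def)
  show "fst (replace_at r i \<gamma>) = fst r" by (simp add: replace_at_def)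
qed

text \<open>Replacing an arrow by a parallel path keeps the end points. So cycles go to cycles, and
  all values at one path share its start vertex.\<close>

lemma keys_path_deriv_parallel:
  fixes f :: "('v, 'a, 'k::field) cochain"
  assumes f: "f \<in> cochains Q (arrow_paths Q) (path_basis Q Z)" and r: "r \<in> paths Q"
  shows "Poly_Mapping.keys (path_deriv Q Z f x r)
    \<subseteq> {x} \<times> {p \<in> path_basis Q Z. fst p = fst r \<and> path_end Q p = path_end Q r}" (is "_ \<subseteq> ?S")
proof -
  have "path_deriv Q Z f x r \<in> {h. Poly_Mapping.keys h \<subseteq> ?S}"
    unfolding path_deriv_eq
  proof (rule linear_extension_in_subspace[OF subspace_supported])
    fix z assume z: "z \<in> Poly_Mapping.keys f"
    obtain y \<gamma> where y: "z = (y, \<gamma>)" by (cases z)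
    with f z obtain b where "y = (tail Q b, [b])" "\<gamma> \<in> paths Q" "fst \<gamma> = tail Q b"
      "path_end Q \<gamma> = head Q b"
      by (auto simp: path_basis_def elim!: keys_cochains1)
    then have "(basis_proj Q Z x (replace_at r i \<gamma>) :: ('v, 'a, 'k) cochain)
        \<in> {h. Poly_Mapping.keys h \<subseteq> ?S}"
      if "i < path_length r" "snd r ! i = hd (snd y)" for i
      using that replace_at_parallel[OF r, of i \<gamma>] by (auto simp: basis_proj_def)
    then show "(case z of (y, \<gamma>) \<Rightarrow> (\<Sum>i | i < path_length r \<and> snd r ! i = hd (snd y).
        basis_proj Q Z x (replace_at r i \<gamma>) :: ('v, 'a, 'k) cochain))
          \<in> {h. Poly_Mapping.keys h \<subseteq> ?S}"
      unfolding y prod.case by (intro cochain.subspace_sum[OF subspace_supported]) auto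
  qed
  then show ?thesis by simp
qed

lemma inner_cochain_in_cochains:
  assumes "path_end Q (e, g) = e"
  shows "inner_cochain Q Z e g \<in> cochains Q (arrow_paths Q) (path_basis Q Z)"
proof -
  have "basis_proj Q Z (arrow_path Q a) (e, g @ [a]) \<in> cochains Q (arrow_paths Q) (path_basis Q Z)"
    if "a \<in> arcs Q" "tail Q a = e" for a
    using that assms by (auto simp: basis_proj_def cochains_def parallel_pairs_def arrow_paths_def
        arrow_path_def)
  moreover have "basis_proj Q Z (arrow_path Q a) (tail Q a, a # g)
      \<in> cochains Q (arrow_paths Q) (path_basis Q Z)"
    if "a \<in> arcs Q" "head Q a = e" for a
    using that assms by (auto simp: basis_proj_def cochains_def parallel_pairs_def arrow_paths_def
        arrow_path_def)
  ultimately show ?thesis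
    unfolding inner_cochain_def
    by (intro cochain.subspace_diff cochain.subspace_sum subspace_cochains) auto
qed

lemma inner_cochain_in_coboundaries1:
  assumes "(e, g) \<in> paths Q" "path_end Q (e, g) = e"
  shows "inner_cochain Q Z e g \<in> coboundaries1 Q Z"
proof (cases "(e, g) \<in> path_basis Q Z")
  case True
  moreover have "e \<in> verts Q" using assms path_end_in_verts by metis
  ultimately have "basis_elt (e, []) (e, g) \<in> cochains Q (trivial_paths Q) (path_basis Q Z)"
    using assms by (auto simp: cochains_def parallel_pairs_def trivial_paths_def trivial_path_def)
  then show ?thesis
    unfolding coboundaries1_def
    by (auto intro!: image_eqI[of _ _ "basis_elt (e, []) (e, g)"] simp: delta0_eq)
next
  case False
  then show ?thesis
    by (simp add: inner_cochain_nonbasis cochain.subspace_0[OF subspace_coboundaries1])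
qed

text \<open>Every statement about all coboundaries is checked on the inner derivations of basis
  cycles.\<close>

lemma coboundaries1_subset:
  assumes "cochain.subspace S"
    and "\<And>e g. (e, g) \<in> path_basis Q Z \<Longrightarrow> path_end Q (e, g) = e \<Longrightarrow> inner_cochain Q Z e g \<in> S"
  shows "coboundaries1 Q Z \<subseteq> S"
  unfolding coboundaries1_def delta0_eq
proof clarify
  fix h :: "('v, 'a, 'b) cochain"
  assume "h \<in> cochains Q (trivial_paths Q) (path_basis Q Z)"
  then show "linear_extension (\<lambda>((e, _), (_, g)). inner_cochain Q Z e g) h \<in> S"
    using assms(2)
    by (intro linear_extension_in_subspace[OF assms(1)])
      (fastforce simp: cochains_def parallel_pairs_def trivial_paths_def trivial_path_def)
qed

text \<open>After telescoping, an inner derivation applied to a relation leaves only the relation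
  multiplied by the cycle on one side, and such paths are not in the basis.\<close>

lemma coboundaries1_subset_cocycles1:
  "(coboundaries1 Q Z :: ('v, 'a, 'k::field) cochain set) \<subseteq> cocycles1 Q Z"
proof (rule coboundaries1_subset[OF subspace_cocycles1])
  fix e g assume "(e, g) \<in> path_basis Q Z" "path_end Q (e, g) = e"
  moreover have "path_deriv Q Z (inner_cochain Q Z e g :: ('v, 'a, 'k::field) cochain) r r = 0"
    if "r \<in> Z" for r
    using that relations_in_paths not_basis_infix[OF that, of _ "[]" g]
      not_basis_infix[OF that, of _ g "[]"]
    by (subst path_deriv_inner_cochain) (auto simp: basis_proj_def)
  ultimately show "(inner_cochain Q Z e g :: ('v, 'a, 'k::field) cochain) \<in> cocycles1 Q Z"
    by (simp add: cocycles1_iff inner_cochain_in_cochains)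
qed

text \<open>On a generator, \<open>cochain_bracket_inner_cochain\<close> expresses the bracket by
  inner derivations of the cycles occurring in f(g).\<close>

lemma cochain_bracket_coboundary_right:
  fixes f :: "('v, 'a, 'k::field) cochain"
  assumes f: "f \<in> cocycles1 Q Z" and j: "j \<in> coboundaries1 Q Z"
  shows "cochain_bracket Q Z f j \<in> coboundaries1 Q Z"
proof -
  let ?S = "{j. cochain_bracket Q Z f j \<in> coboundaries1 Q Z}"
  note sub = subspace_coboundaries1[where 'b = 'k]
  have "cochain.subspace ?S"
    using cochain.subspace_add[OF sub] cochain.subspace_scale[OF sub] cochain.subspace_0[OF sub]
    by (auto simp: cochain.subspace_def cochain_bracket_add_right cochain_bracket_scale_right)
      (simp add: cochain_bracket_eq path_deriv_def case_prod_unfold)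
  moreover have "cochain_bracket Q Z f (inner_cochain Q Z e g) \<in> coboundaries1 Q Z"
    if g: "(e, g) \<in> path_basis Q Z" "path_end Q (e, g) = e" for e g
  proof -
    have path: "(e, g) \<in> paths Q" using g by (simp add: path_basis_def)
    have "f \<in> cochains Q (arrow_paths Q) (path_basis Q Z)" using f by (simp add: cocycles1_iff)
    from keys_path_deriv_parallel[OF this path, of "(e, [])"] show ?thesis
      unfolding cochain_bracket_inner_cochain[OF f path g(2)] g(2)
      by (intro linear_extension_in_subspace[OF sub])
        (auto intro!: inner_cochain_in_coboundaries1 simp: path_basis_def)
  qed
  ultimately have "coboundaries1 Q Z \<subseteq> ?S"
    by (intro coboundaries1_subset) auto
  with j show ?thesis by auto
qed

lemma cochain_bracket_coboundary_left:
  assumes f: "f \<in> cocycles1 Q Z" and j: "j \<in> coboundaries1 Q Z"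
  shows "cochain_bracket Q Z j f \<in> coboundaries1 Q Z"
  using cochain.subspace_neg[OF subspace_coboundaries1 cochain_bracket_coboundary_right[OF f j]]
  by (simp add: cochain_bracket_swap[of Q Z j])

end

section \<open>Cosets, and the operations of HH^1 on representatives\<close>

lemma mem_coset_iff: "h \<in> coset J f \<longleftrightarrow> h - f \<in> J"
  by (auto simp: coset_def image_iff) (metis add_diff_cancel_left' diff_add_cancel add.commute)+

lemma coset_eq_iff:
  assumes J: "cochain.subspace J"
  shows "coset J f = coset J g \<longleftrightarrow> f - g \<in> J"
proof
  show "coset J f = coset J g \<Longrightarrow> f - g \<in> J"
    using cochain.subspace_0[OF J] mem_coset_iff by (metis diff_self)
next
  assume fg: "f - g \<in> J"
  have "h - f \<in> J \<longleftrightarrow> h - g \<in> J" for h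
  proof
    assume "h - f \<in> J"
    with fg cochain.subspace_add[OF J] have "(h - f) + (f - g) \<in> J" by blast
    then show "h - g \<in> J" by simp
  next
    assume "h - g \<in> J"
    with fg cochain.subspace_diff[OF J] have "(h - g) - (f - g) \<in> J" by blast
    then show "h - f \<in> J" by simp
  qed
  then show "coset J f = coset J g" by (auto simp: mem_coset_iff)
qed

lemma coset_0: "coset J 0 = J"
  by (simp add: coset_def)

lemma self_in_coset: "cochain.subspace J \<Longrightarrow> f \<in> coset J f"
  by (simp add: mem_coset_iff cochain.subspace_0)

text \<open>The operations of \<open>HH1\<close> are unions over all representatives; such a union
  is a single coset as soon as every representative yields the same one.\<close>

lemma UN_coset_eq:
  assumes J: "cochain.subspace J" and "\<And>f'. f' \<in> coset J f \<Longrightarrow> F f' - h \<in> J"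
  shows "(\<Union>f'\<in>coset J f. coset J (F f')) = coset J h"
  using assms self_in_coset[OF J, of f] by (auto simp: coset_eq_iff[OF J, symmetric])

context quiver_relations
begin

lemma HH1_ladd:
  fixes f g :: "('v, 'a, 'k::field) cochain"
  shows "ladd (HH1 Q Z) (HH1_class Q Z f) (HH1_class Q Z g) = HH1_class Q Z (f + g)"
proof -
  note J = subspace_coboundaries1[where 'b = 'k]
  have "(\<Union>g'\<in>HH1_class Q Z g. HH1_class Q Z (f' + g')) = HH1_class Q Z (f' + g)" for f'
    by (intro UN_coset_eq[OF J]) (auto simp: mem_coset_iff algebra_simps)
  then have "(\<Union>f'\<in>HH1_class Q Z f. \<Union>g'\<in>HH1_class Q Z g. HH1_class Q Z (f' + g'))
      = (\<Union>f'\<in>HH1_class Q Z f. HH1_class Q Z (f' + g))" by simp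
  also have "\<dots> = HH1_class Q Z (f + g)"
    by (intro UN_coset_eq[OF J]) (auto simp: mem_coset_iff algebra_simps)
  finally show ?thesis by (simp add: HH1_def)
qed

lemma HH1_lscale:
  fixes f :: "('v, 'a, 'k::field) cochain"
  shows "lscale (HH1 Q Z) c (HH1_class Q Z f) = HH1_class Q Z (scale_cochain c f)"
proof -
  note J = subspace_coboundaries1[where 'b = 'k]
  have "(\<Union>f'\<in>HH1_class Q Z f. HH1_class Q Z (scale_cochain c f'))
      = HH1_class Q Z (scale_cochain c f)"
    using cochain.subspace_scale[OF J]
    by (intro UN_coset_eq[OF J])
      (auto simp: mem_coset_iff cochain.scale_right_diff_distrib[symmetric])
  then show ?thesis by (simp add: HH1_def)
qed

text \<open>With f' = f + i and g' = g + j the difference is [f, j] + [i, g'], a sum of two brackets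
  of a cocycle with a coboundary.\<close>

lemma cochain_bracket_cong_coboundaries1:
  fixes f g :: "('v, 'a, 'k::field) cochain"
  assumes "f \<in> cocycles1 Q Z" "g \<in> cocycles1 Q Z"
    and "f' - f \<in> coboundaries1 Q Z" "g' - g \<in> coboundaries1 Q Z"
  shows "cochain_bracket Q Z f' g' - cochain_bracket Q Z f g \<in> coboundaries1 Q Z"
proof -
  define i j where "i = f' - f" and "j = g' - g"
  then have eq: "f' = f + i" "g' = g + j" by simp_all
  have ij: "i \<in> coboundaries1 Q Z" "j \<in> coboundaries1 Q Z" using assms by (simp_all add: i_def j_def)
  have "g' \<in> cocycles1 Q Z"
    using eq(2) ij assms coboundaries1_subset_cocycles1 cochain.subspace_add[OF subspace_cocycles1]
    by blast
  then have "cochain_bracket Q Z f j + cochain_bracket Q Z i g' \<in> coboundaries1 Q Z"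
    using assms(1) ij by (intro cochain.subspace_add[OF subspace_coboundaries1]
        cochain_bracket_coboundary_left cochain_bracket_coboundary_right)
  moreover have "cochain_bracket Q Z f' g' - cochain_bracket Q Z f g
      = cochain_bracket Q Z f j + cochain_bracket Q Z i g'"
    unfolding eq by (simp add: cochain_bracket_add_left cochain_bracket_add_right)
  ultimately show ?thesis by simp
qed

lemma HH1_lbracket:
  fixes f g :: "('v, 'a, 'k::field) cochain"
  assumes "f \<in> cocycles1 Q Z" "g \<in> cocycles1 Q Z"
  shows "lbracket (HH1 Q Z) (HH1_class Q Z f) (HH1_class Q Z g)
    = HH1_class Q Z (cochain_bracket Q Z f g)"
proof -
  note J = subspace_coboundaries1[where 'b = 'k]
  have "HH1_class Q Z (cochain_bracket Q Z f' g') = HH1_class Q Z (cochain_bracket Q Z f g)"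
    if "f' \<in> HH1_class Q Z f" "g' \<in> HH1_class Q Z g" for f' g'
    using cochain_bracket_cong_coboundaries1[OF assms] that
    by (simp add: coset_eq_iff[OF J] mem_coset_iff)
  then have "(\<Union>f'\<in>HH1_class Q Z f. \<Union>g'\<in>HH1_class Q Z g. HH1_class Q Z (cochain_bracket Q Z f' g'))
      = (\<Union>f'\<in>HH1_class Q Z f. \<Union>g'\<in>HH1_class Q Z g. HH1_class Q Z (cochain_bracket Q Z f g))"
    by (intro SUP_cong refl)
  also have "\<dots> = HH1_class Q Z (cochain_bracket Q Z f g)"
    using self_in_coset[OF J, of f] self_in_coset[OF J, of g] by auto
  finally show ?thesis by (simp add: HH1_def)
qed

end

section \<open>Gluing a source arrow and a sink arrow\<close>

text \<open>By minimality a relation without its last arrow is a nonzero path, so each relation is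
  determined by an element of the finite basis and an arrow.\<close>

lemma (in monomial_algebra) finite_relations: "finite Z"
proof (rule finite_subset)
  show "Z \<subseteq> (\<lambda>((v, w), a). (v, w @ [a])) ` (path_basis Q Z \<times> arcs Q)"
  proof
    fix z assume z: "z \<in> Z"
    then have "snd z \<noteq> []" using length_ge_2[OF z] by (auto simp: path_length_def)
    then obtain w a where w: "z = (fst z, w @ [a])" by (metis prod.collapse rev_exhaust)
    have path: "(fst z, w @ [a]) \<in> paths Q" using z w relations_paths by auto
    have "(fst z, w) \<in> path_basis Q Z"
    proof (rule ccontr)
      assume "(fst z, w) \<notin> path_basis Q Z"
      then obtain z' where z': "z' \<in> Z" "subpath Q z' (fst z, w)"
        using path by (auto simp: path_basis_def)
      have "subpath Q (fst z, w) z"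
        using w unfolding subpath_def by (intro exI[of _ "[]"] exI[of _ "[a]"]) (auto, metis snd_conv)
      with z z' have "z' = z" using minimal subpath_trans by blast
      with z'(2) obtain xs ys where "w = xs @ snd z @ ys" by (auto simp: subpath_def)
      moreover have "snd z = w @ [a]" using w by (metis snd_conv)
      ultimately have "length w = length xs + Suc (length w) + length ys" by (metis add.assoc length_append length_append_singleton)
      then show False by simp
    qed
    moreover have "a \<in> arcs Q" using path by simp
    ultimately show "z \<in> (\<lambda>((v, w), a). (v, w @ [a])) ` (path_basis Q Z \<times> arcs Q)"
      using w by (intro image_eqI[of _ _ "((fst z, w), a)"]) auto
  qed
  show "finite ((\<lambda>((v, w), a). (v, w @ [a])) ` (path_basis Q Z \<times> arcs Q))"
    using finite_dimensional by auto
qed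

sublocale monomial_algebra \<subseteq> quiver_relations Q Z
  using finite_relations relations_paths length_ge_2 by unfold_locales (auto simp: path_length_def)

lemma ex_minimal_relation:
  "g \<in> G \<Longrightarrow> \<exists>z\<in>minimal_relations Q G. subpath Q z g"
proof (induction "path_length g" arbitrary: g rule: less_induct)
  case less
  show ?case
  proof (cases "g \<in> minimal_relations Q G")
    case True
    then show ?thesis using subpath_refl by blast
  next
    case False
    with less.prems obtain g' where g': "g' \<in> G" "subpath Q g' g" "g' \<noteq> g"
      by (auto simp: minimal_relations_def)
    then obtain xs ys where xy: "snd g = xs @ snd g' @ ys" "path_end Q (fst g, xs) = fst g'"
      by (auto simp: subpath_def)
    \<comment> \<open>If both were empty, \<open>g\<close> and \<open>g'\<close> would have the same
      arrows and the same start, hence be equal. So a different subpath is strictly shorter and the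
      induction applies.\<close>
    have "xs \<noteq> [] \<or> ys \<noteq> []"
      using xy g'(3) by (auto simp: prod_eq_iff)
    then have "path_length g' < path_length g"
      using xy by (auto simp: path_length_def)
    with less.hyps g' show ?thesis using subpath_trans by blast
  qed
qed

text \<open>The path basis of B may therefore be computed from the explicit generators of its
  ideal.\<close>

lemma path_basis_minimal_relations: "path_basis Q (minimal_relations Q G) = path_basis Q G"
proof -
  have "(\<exists>z\<in>minimal_relations Q G. subpath Q z p) \<longleftrightarrow> (\<exists>z\<in>G. subpath Q z p)" for p
    using ex_minimal_relation[of _ G Q] subpath_trans[of Q]
    by (metis (no_types, lifting) mem_Collect_eq minimal_relations_def)
  then show ?thesis by (simp add: path_basis_def)
qed

locale source_sink_gluing = monomial_algebra Q Z
  for Q :: "('v, 'a) quiver" and Z :: "('v, 'a) qpath set" +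
  fixes \<alpha> \<beta> :: 'a
  assumes source: "source_arrow Q \<alpha>"
    and sink: "sink_arrow Q \<beta>"
    and distinct_ends: "distinct [tail Q \<alpha>, head Q \<alpha>, tail Q \<beta>, head Q \<beta>]"
begin

abbreviation "QB \<equiv> glue_quiver Q \<alpha> \<beta>"
abbreviation "ZB \<equiv> glue_relations Q Z \<alpha> \<beta>"
abbreviation "sv \<equiv> star_vertex Q \<alpha> \<beta>"
abbreviation "sa \<equiv> star_arrow \<alpha> \<beta>"
abbreviation "sp \<equiv> star_path Q \<alpha> \<beta>"

lemma glued_arcs [simp]: "\<alpha> \<in> arcs Q" "\<beta> \<in> arcs Q" "\<alpha> \<noteq> \<beta>" "\<beta> \<noteq> \<alpha>"
  using source sink distinct_ends by (auto simp: source_arrow_def sink_arrow_def)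

lemma ends [simp]:
  "tail Q \<alpha> \<noteq> head Q \<alpha>" "tail Q \<alpha> \<noteq> tail Q \<beta>" "tail Q \<alpha> \<noteq> head Q \<beta>"
  "head Q \<alpha> \<noteq> tail Q \<beta>" "head Q \<alpha> \<noteq> head Q \<beta>" "tail Q \<beta> \<noteq> head Q \<beta>"
  "head Q \<alpha> \<noteq> tail Q \<alpha>" "tail Q \<beta> \<noteq> tail Q \<alpha>" "head Q \<beta> \<noteq> tail Q \<alpha>"
  "tail Q \<beta> \<noteq> head Q \<alpha>" "head Q \<beta> \<noteq> head Q \<alpha>" "head Q \<beta> \<noteq> tail Q \<beta>"
  using distinct_ends by auto

text \<open>The source and sink hypotheses as rewrite rules; they settle the case distinctions at
  the four glued vertices.\<close>

lemma arcs_at_ends [simp]: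
  assumes "a \<in> arcs Q"
  shows "head Q a \<noteq> tail Q \<alpha>" "tail Q a = tail Q \<alpha> \<longleftrightarrow> a = \<alpha>" "head Q a = head Q \<alpha> \<longleftrightarrow> a = \<alpha>"
    "tail Q a \<noteq> head Q \<beta>" "tail Q a = tail Q \<beta> \<longleftrightarrow> a = \<beta>" "head Q a = head Q \<beta> \<longleftrightarrow> a = \<beta>"
  using assms source sink by (auto simp: source_arrow_def sink_arrow_def)

lemmas arcs_at_ends_sym [simp] = arcs_at_ends(1)[THEN not_sym] arcs_at_ends(4)[THEN not_sym]
  arcs_at_ends(2)[THEN trans[OF eq_commute]] arcs_at_ends(3)[THEN trans[OF eq_commute]]
  arcs_at_ends(5)[THEN trans[OF eq_commute]] arcs_at_ends(6)[THEN trans[OF eq_commute]]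

lemma star_arrow_simps [simp]: "sa \<alpha> = \<alpha>" "sa \<beta> = \<alpha>" "sa a = \<alpha> \<longleftrightarrow> a = \<alpha> \<or> a = \<beta>"
  "sa a \<noteq> \<beta>"
  by (auto simp: star_arrow_def)

lemma star_arrow_id [simp]: "a \<noteq> \<beta> \<Longrightarrow> sa a = a"
  by (auto simp: star_arrow_def)

lemma star_vertex_simps [simp]: "sv (tail Q \<alpha>) = tail Q \<alpha>" "sv (head Q \<alpha>) = head Q \<alpha>"
  "sv (tail Q \<beta>) = tail Q \<alpha>" "sv (head Q \<beta>) = head Q \<alpha>"
  "sv v = tail Q \<alpha> \<longleftrightarrow> v = tail Q \<alpha> \<or> v = tail Q \<beta>"
  "sv v = head Q \<alpha> \<longleftrightarrow> v = head Q \<alpha> \<or> v = head Q \<beta>"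
  by (auto simp: star_vertex_def)

lemma star_vertex_id [simp]: "v \<noteq> tail Q \<beta> \<Longrightarrow> v \<noteq> head Q \<beta> \<Longrightarrow> sv v = v"
  by (auto simp: star_vertex_def)

lemma star_vertex_eq_other:
  "sv v = w \<Longrightarrow> w \<noteq> tail Q \<alpha> \<Longrightarrow> w \<noteq> head Q \<alpha> \<Longrightarrow> v = w"
  by (auto simp: star_vertex_def split: if_splits)

lemma glue_quiver_simps [simp]:
  "verts QB = sv ` verts Q" "arcs QB = arcs Q - {\<beta>}"
  "tail QB a = sv (tail Q a)" "head QB a = sv (head Q a)"
proof -
  have "sa ` arcs Q = arcs Q - {\<beta>}"
  proof
    show "arcs Q - {\<beta>} \<subseteq> sa ` arcs Q" by (auto simp: image_iff star_arrow_def)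
  qed (auto simp: star_arrow_def split: if_splits)
  then show "arcs QB = arcs Q - {\<beta>}" by (simp add: glue_quiver_def)
qed (simp_all add: glue_quiver_def)

lemma star_vertex_tail_star_arrow [simp]: "sv (tail Q (sa a)) = sv (tail Q a)"
  by (cases "a = \<beta>") simp_all

lemma star_vertex_head_star_arrow [simp]: "sv (head Q (sa a)) = sv (head Q a)"
  by (cases "a = \<beta>") simp_all

sublocale B: fin_digraph QB
proof
  show "tail QB a \<in> verts QB" if "a \<in> arcs QB" for a
    using that tail_in_verts by (simp del: star_vertex_id)
qed auto

lemma arrow_path_glued: "a \<in> arcs Q \<Longrightarrow> a \<noteq> \<beta> \<Longrightarrow> arrow_path QB a = (tail Q a, [a])"
  by (simp add: arrow_path_def)

lemma path_end_star: "path_end QB (sv v, map sa w) = sv (path_end Q (v, w))"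
  by (induction w arbitrary: v) simp_all

lemma path_end_star_path: "path_end QB (sp p) = sv (path_end Q p)"
  using path_end_star[of "fst p" "snd p"] by (simp add: star_path_def)

lemma star_in_paths: "(v, w) \<in> paths Q \<Longrightarrow> (sv v, map sa w) \<in> paths QB"
proof (induction w arbitrary: v)
  case (Cons a w)
  then have "a \<in> arcs Q" "tail Q a = v" "(sv (head Q a), map sa w) \<in> paths QB" by auto
  then show ?case by (cases "a = \<beta>") auto
qed auto

lemma star_path_in_paths: "p \<in> paths Q \<Longrightarrow> sp p \<in> paths QB"
  using star_in_paths[of "fst p" "snd p"] by (simp add: star_path_def)

section \<open>Lifting paths of the glued quiver\<close>

lemma path_alpha_first: "(v, xs @ \<alpha> # ys) \<in> paths Q \<Longrightarrow> xs = []"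
  by (induction xs rule: rev_induct) (auto dest: arcs_at_ends(1)[of _])

lemma path_beta_last: "(v, xs @ \<beta> # ys) \<in> paths Q \<Longrightarrow> ys = []"
  by (cases ys) (auto dest: arcs_at_ends(4))

lemma path_alpha_start:
  assumes "(v, w) \<in> paths Q" "\<alpha> \<in> set w"
  shows "v = tail Q \<alpha>"
proof -
  obtain xs ys where "w = xs @ \<alpha> # ys" using assms(2) by (meson split_list)
  moreover from this have "xs = []" using assms(1) path_alpha_first by blast
  ultimately show ?thesis using assms(1) by simp
qed

lemma path_beta_end: "(v, w) \<in> paths Q \<Longrightarrow> \<beta> \<in> set w \<Longrightarrow> path_end Q (v, w) = head Q \<beta>"
  by (auto simp del: paths_append dest!: split_list dest: path_beta_last)

text \<open>Only \<alpha> and \<beta> have the same image, and they have different sources, so a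
  path is recovered arrow by arrow from a known start.\<close>

lemma star_path_inj:
  "(v, w) \<in> paths Q \<Longrightarrow> (v, w') \<in> paths Q \<Longrightarrow> map sa w = map sa w' \<Longrightarrow> w = w'"
proof (induction w arbitrary: v w')
  case (Cons a w)
  then obtain b u where w': "w' = b # u" by (cases w') auto
  with Cons.prems have "tail Q a = tail Q b" "sa a = sa b" by auto
  then have "a = b" using ends(2) by (metis star_arrow_def)
  with Cons w' show ?case by auto
qed auto

text \<open>The bound 2 excludes the one ambiguity, \<open>[\<alpha>]\<close> against
  \<open>[\<beta>]\<close>: in a longer path the first arrow is not \<beta>, since nothing follows
  \<beta>. So its image determines it, and with it the start.\<close>

lemma star_path_inj_long:
  assumes w: "(v, w) \<in> paths Q" "(v', w') \<in> paths Q" "map sa w = map sa w'" "2 \<le> length w"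
  shows "v = v'" "w = w'"
proof -
  obtain a b u where a: "w = a # b # u"
    using w(4) by (cases w; cases "tl w") auto
  with w(3) obtain a' b' u' where a': "w' = a' # b' # u'"
    by (cases w'; cases "tl w'") auto
  have "a \<noteq> \<beta>" "a' \<noteq> \<beta>"
    using w(1,2) a a' path_beta_last[of _ "[]"] by auto
  with w(3) a a' have "a = a'" by simp
  with w(1,2) a a' show "v = v'" by auto
  with w star_path_inj show "w = w'" by blast
qed

text \<open>A final glued arrow is lifted to \<beta>. Keeping \<alpha> out of the lift is what
  allows the induction to prepend an arrow, as nothing can precede \<alpha>.\<close>

lemma lift_path_no_alpha:
  assumes "(v, w) \<in> paths QB" "\<And>xs ys. w = xs @ \<alpha> # ys \<Longrightarrow> ys = []" "w \<noteq> []"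
  shows "\<exists>v' w'. (v', w') \<in> paths Q \<and> sv v' = v \<and> map sa w' = w \<and> \<alpha> \<notin> set w'"
  using assms
proof (induction w arbitrary: v)
  case (Cons a w)
  show ?case
  proof (cases "w = []")
    case True
    define a' where "a' = (if a = \<alpha> then \<beta> else a)"
    have "(tail Q a', [a']) \<in> paths Q" "sv (tail Q a') = v" "sa a' = a" "a' \<noteq> \<alpha>"
      using Cons.prems(1) by (auto simp: a'_def star_arrow_def)
    with True show ?thesis by (intro exI[of _ "tail Q a'"] exI[of _ "[a']"]) auto
  next
    case False
    have prems: "(sv (head Q a), w) \<in> paths QB" "\<And>xs ys. w = xs @ \<alpha> # ys \<Longrightarrow> ys = []"
      using Cons.prems(1) Cons.prems(2)[of "a # _"] by auto
    then obtain v' w' where w': "(v', w') \<in> paths Q" "sv v' = sv (head Q a)" "map sa w' = w"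
      "\<alpha> \<notin> set w'"
      using Cons.IH False by blast
    have a: "a \<in> arcs Q" "a \<noteq> \<alpha>" "a \<noteq> \<beta>" "sv (tail Q a) = v"
      using Cons.prems(1) Cons.prems(2)[of "[]"] False by auto
    from w' False obtain b u where b: "w' = b # u" by (cases w') auto
    with w' have "b \<in> arcs Q" "b \<noteq> \<alpha>" "v' = tail Q b" by auto
    \<comment> \<open>The endpoints agree in B. Over f_1 the arrow \<open>a\<close> ends at e_{n-1},
      as e_1 is a source, and the lift does not start at e_1, as its first arrow \<open>b\<close> is
      not \<alpha>.\<close>
    with a w'(2) have "head Q a = v'"
      by (cases "head Q a = tail Q \<beta>") (auto simp: star_vertex_def split: if_splits)
    with a w' show ?thesis
      by (intro exI[of _ "tail Q a"] exI[of _ "a # w'"]) auto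
  qed
qed simp

lemma lift_path:
  assumes w: "(v, w) \<in> paths QB" and mid: "\<And>xs ys. w = xs @ \<alpha> # ys \<Longrightarrow> xs = [] \<or> ys = []"
  obtains v' w' where "(v', w') \<in> paths Q" "sv v' = v" "map sa w' = w"
proof (cases w)
  case Nil
  with w show thesis using that[of _ "[]"] by auto
next
  case (Cons a u)
  show thesis
  proof (cases "a = \<alpha> \<and> u \<noteq> []")
    case True
    \<comment> \<open>A leading glued arrow with a continuation must be lifted to \<alpha>. The
      continuation lifts to a path starting at e_2, because no arrow leaves e_n.\<close>
    have "\<exists>v' w'. (v', w') \<in> paths Q \<and> sv v' = head Q \<alpha> \<and> map sa w' = u \<and> \<alpha> \<notin> set w'"
    proof (rule lift_path_no_alpha)
      show "(head Q \<alpha>, u) \<in> paths QB" using w Cons True by auto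
      show "ys = []" if "u = xs @ \<alpha> # ys" for xs ys
        using mid[of "\<alpha> # xs" ys] that Cons True by auto
    qed (use True in auto)
    then obtain v' w' where w': "(v', w') \<in> paths Q" "sv v' = head Q \<alpha>" "map sa w' = u" by blast
    from w' True obtain b u' where "w' = b # u'" by (cases w') auto
    with w' have "b \<in> arcs Q" "v' = tail Q b" by auto
    with w'(2) have "v' = head Q \<alpha>" by auto
    with w' have "(tail Q \<alpha>, \<alpha> # w') \<in> paths Q" by simp
    moreover have "sv (tail Q \<alpha>) = v" using w Cons True by auto
    moreover have "map sa (\<alpha> # w') = w" using w' Cons True by simp
    ultimately show thesis by (rule that)
  next
    case False
    have "\<exists>v' w'. (v', w') \<in> paths Q \<and> sv v' = v \<and> map sa w' = w \<and> \<alpha> \<notin> set w'"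
    proof (rule lift_path_no_alpha[OF w])
      show "ys = []" if "w = xs @ \<alpha> # ys" for xs ys
        using mid[OF that] that Cons False by (cases xs) auto
    qed (use Cons in simp)
    with that show thesis by blast
  qed
qed

section \<open>Relations and path basis of the glued algebra\<close>

lemma new_relations_eq:
  "new_relations Q \<alpha> \<beta> = {(tail Q \<eta>, [\<eta>, \<alpha>, \<xi>]) | \<eta> \<xi>. \<eta> \<in> arcs Q \<and> \<xi> \<in> arcs Q
     \<and> head Q \<eta> = tail Q \<beta> \<and> tail Q \<xi> = head Q \<alpha>}"
proof -
  have word: "star_word Q \<alpha> \<beta> [\<eta>, \<alpha>, \<xi>] = (tail Q \<eta>, [\<eta>, \<alpha>, \<xi>])"
    if "\<eta> \<in> arcs Q" "\<xi> \<in> arcs Q" "head Q \<eta> = tail Q \<beta>" "tail Q \<xi> = head Q \<alpha>" for \<eta> \<xi>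
  proof -
    have "\<eta> \<noteq> \<beta>" "\<xi> \<noteq> \<beta>" using that by auto
    with that show ?thesis by (simp add: star_word_def star_path_def)
  qed
  have "new_relations Q \<alpha> \<beta> = {star_word Q \<alpha> \<beta> [\<eta>, \<alpha>, \<xi>] | \<eta> \<xi>. \<eta> \<in> arcs Q \<and> \<xi> \<in> arcs Q
     \<and> head Q \<eta> = tail Q \<beta> \<and> tail Q \<xi> = head Q \<alpha>}"
  proof -
    let ?N = "{star_word Q \<alpha> \<beta> [\<eta>, \<alpha>, \<xi>] | \<eta> \<xi>. \<eta> \<in> arcs Q \<and> \<xi> \<in> arcs Q
      \<and> head Q \<eta> = tail Q \<beta> \<and> tail Q \<xi> = head Q \<alpha>}"
    \<comment> \<open>Five of the six families of new relations ask for an arrow into the source of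
      \<alpha>, a second arrow into the target of \<alpha> or of \<beta>, or a second arrow out of
      the source of \<alpha>; there is none.\<close>
    have empty: "{w \<eta> l | \<eta> l. \<eta> \<in> arcs Q \<and> l \<in> arcs Q \<and> head Q \<eta> = tail Q \<alpha> \<and> P \<eta> l} = {}"
      "{w \<eta> l | \<eta> l. \<eta> \<in> arcs Q \<and> l \<in> arcs Q \<and> head Q \<eta> = head Q \<alpha> \<and> \<eta> \<noteq> \<alpha> \<and> P \<eta> l} = {}"
      "{w \<eta> l | \<eta> l. \<eta> \<in> arcs Q \<and> l \<in> arcs Q \<and> head Q \<eta> = head Q \<beta> \<and> \<eta> \<noteq> \<beta> \<and> P \<eta> l} = {}"
      "{w \<eta> l | \<eta> l. \<eta> \<in> arcs Q \<and> l \<in> arcs Q \<and> R \<eta> l \<and> tail Q l = tail Q \<alpha> \<and> l \<noteq> \<alpha>} = {}"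
      for w :: "'a \<Rightarrow> 'a \<Rightarrow> ('v, 'a) qpath" and P R
      by auto
    show ?thesis
      unfolding new_relations_def new_relations_half_def by (simp only: empty Un_empty_left)
  qed
  then show ?thesis
    by (simp only:) (intro Collect_cong arg_cong[where f = Ex] ext, auto simp: word)
qed

lemma glue_relations_cases:
  assumes "z \<in> ZB"
  obtains z' where "z' \<in> Z" "z = sp z'" | \<eta> \<xi> where "\<eta> \<in> arcs Q" "\<xi> \<in> arcs Q"
    "head Q \<eta> = tail Q \<beta>" "tail Q \<xi> = head Q \<alpha>" "z = (tail Q \<eta>, [\<eta>, \<alpha>, \<xi>])"
  using assms unfolding glue_relations_def minimal_relations_def new_relations_eq by blast

sublocale B: quiver_relations QB ZB
proof
  have "finite (new_relations Q \<alpha> \<beta>)"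
    by (rule finite_subset[of _ "(\<lambda>(\<eta>, \<xi>). (tail Q \<eta>, [\<eta>, \<alpha>, \<xi>])) ` (arcs Q \<times> arcs Q)"])
      (auto simp: new_relations_eq)
  then show "finite ZB"
    using finite_relations by (auto simp: glue_relations_def minimal_relations_def)
  show "ZB \<subseteq> paths QB"
  proof
    fix z assume "z \<in> ZB"
    then show "z \<in> paths QB"
    proof (cases rule: glue_relations_cases)
      case (1 z')
      then show ?thesis using star_path_in_paths[of z'] relations_in_paths by blast
    next
      case (2 \<eta> \<xi>)
      have "\<eta> \<noteq> \<beta>" "\<xi> \<noteq> \<beta>" using 2 by auto
      then show ?thesis using 2 by (auto intro!: imageI)
    qed
  qed
  show "2 \<le> length (snd z)" if "z \<in> ZB" for z
    using that
  proof (cases rule: glue_relations_cases)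
    case (1 z')
    then show ?thesis using relation_length by (simp add: star_path_def)
  qed simp
qed

text \<open>For the converse, the matching part of \<open>p\<close> and the relation have the same
  image and length at least 2, so they coincide together with their start vertices.\<close>

lemma subpath_star_path_iff:
  assumes z: "z \<in> Z" and p: "p \<in> paths Q"
  shows "subpath QB (sp z) (sp p) \<longleftrightarrow> subpath Q z p"
proof
  assume "subpath Q z p"
  then obtain xs ys where "snd p = xs @ snd z @ ys" "path_end Q (fst p, xs) = fst z"
    by (auto simp: subpath_def)
  then show "subpath QB (sp z) (sp p)"
    unfolding subpath_def star_path_def
    by (intro exI[of _ "map sa xs"] exI[of _ "map sa ys"]) (auto simp: path_end_star)
next
  assume "subpath QB (sp z) (sp p)"
  then obtain xs ys where "map sa (snd p) = xs @ map sa (snd z) @ ys"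
    by (auto simp: subpath_def star_path_def)
  then obtain xs' w ys' where w: "snd p = xs' @ w @ ys'" "map sa w = map sa (snd z)"
    by (metis append_eq_map_conv)
  have "(path_end Q (fst p, xs'), w) \<in> paths Q"
    using p w(1) by (metis paths_append prod.collapse)
  moreover have "(fst z, snd z) \<in> paths Q" using z relations_in_paths by auto
  moreover have "2 \<le> length w"
    using relation_length[OF z] w(2) by (metis length_map)
  ultimately have "path_end Q (fst p, xs') = fst z" "w = snd z"
    using star_path_inj_long w(2) by blast+
  with w show "subpath Q z p" by (auto simp: subpath_def)
qed

text \<open>An inner glued arrow of \<open>sp p\<close> would come from an inner \<alpha> or \<beta>
  of a path of A.\<close>

lemma new_relation_not_subpath:
  assumes "z \<in> new_relations Q \<alpha> \<beta>" "p \<in> paths Q"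
  shows "\<not> subpath QB z (sp p)"
proof
  assume "subpath QB z (sp p)"
  with assms(1) obtain xs \<eta> \<xi> ys where "map sa (snd p) = xs @ [\<eta>, \<alpha>, \<xi>] @ ys"
    by (auto simp: subpath_def star_path_def new_relations_eq)
  then obtain xs' \<eta>' a \<xi>' ys' where "snd p = xs' @ [\<eta>', a, \<xi>'] @ ys'" "sa a = \<alpha>"
    by (fastforce simp: map_eq_append_conv map_eq_Cons_conv simp del: star_arrow_simps)
  then have "snd p = (xs' @ [\<eta>']) @ a # \<xi>' # ys'" "a = \<alpha> \<or> a = \<beta>" by auto
  then have "(fst p, (xs' @ [\<eta>']) @ a # \<xi>' # ys') \<in> paths Q" "a = \<alpha> \<or> a = \<beta>"
    using assms(2) by (metis prod.collapse)+
  then show False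
    using path_alpha_first path_beta_last by blast
qed

text \<open>The images of the old relations survive the passage to minimal relations, by minimality
  in A and because they contain no new relation. So a cocycle of B is tested on every relation of
  A.\<close>

lemma star_relation: "z \<in> Z \<Longrightarrow> sp z \<in> ZB"
  using relations_in_paths minimal subpath_star_path_iff new_relation_not_subpath
  unfolding glue_relations_def minimal_relations_def by blast

lemma glued_basis_eq: "path_basis QB ZB = path_basis QB (sp ` Z \<union> new_relations Q \<alpha> \<beta>)"
  unfolding glue_relations_def by (rule path_basis_minimal_relations)

lemma star_path_basis_iff:
  assumes "p \<in> paths Q"
  shows "sp p \<in> path_basis QB ZB \<longleftrightarrow> p \<in> path_basis Q Z"
proof -
  have "(\<exists>z\<in>sp ` Z \<union> new_relations Q \<alpha> \<beta>. subpath QB z (sp p)) \<longleftrightarrow> (\<exists>z\<in>Z. subpath Q z p)"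
    using assms subpath_star_path_iff new_relation_not_subpath by blast
  then show ?thesis
    using assms star_path_in_paths[OF assms]
    unfolding glued_basis_eq unfolding path_basis_def mem_Collect_eq by blast
qed

text \<open>The neighbours of an inner glued arrow come from arrows ending at e_{n-1} and starting
  at e_2, so the three form a new relation.\<close>

lemma glued_basis_alpha:
  assumes "(v, xs @ \<alpha> # ys) \<in> path_basis QB ZB"
  shows "xs = [] \<or> ys = []"
proof (rule ccontr)
  assume "\<not> ?thesis"
  then obtain us \<eta> \<xi> vs where eq: "xs = us @ [\<eta>]" "ys = \<xi> # vs"
    by (metis neq_Nil_conv rev_exhaust)
  have path: "(v, us @ [\<eta>, \<alpha>, \<xi>] @ vs) \<in> paths QB"
    using assms eq by (simp add: path_basis_def del: B.paths_append B.paths_Cons)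
  then have arcs: "\<eta> \<in> arcs Q" "\<xi> \<in> arcs Q" by auto
  from path arcs have "tail Q \<alpha> = sv (head Q \<eta>)"
    "sv (tail Q \<xi>) = head Q \<alpha>" and "path_end QB (v, us) = tail Q \<eta>"
    by auto
  moreover from this arcs have "head Q \<eta> = tail Q \<beta>" "tail Q \<xi> = head Q \<alpha>"
    using star_vertex_simps(5)[of "head Q \<eta>"] by auto
  ultimately have "(tail Q \<eta>, [\<eta>, \<alpha>, \<xi>]) \<in> new_relations Q \<alpha> \<beta>"
    "subpath QB (tail Q \<eta>, [\<eta>, \<alpha>, \<xi>]) (v, xs @ \<alpha> # ys)"
    unfolding subpath_def new_relations_eq using eq arcs by auto
  with assms show False
    unfolding glued_basis_eq by (auto simp: path_basis_def)
qed

lemma lift_basis: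
  assumes "q \<in> path_basis QB ZB"
  obtains p where "p \<in> path_basis Q Z" "sp p = q"
proof -
  have "(fst q, snd q) \<in> paths QB" using assms by (simp add: path_basis_def)
  then obtain v w where "(v, w) \<in> paths Q" "sv v = fst q" "map sa w = snd q"
    using lift_path glued_basis_alpha assms by (metis prod.collapse)
  then have "(v, w) \<in> paths Q" "sp (v, w) = q" by (simp_all add: star_path_def)
  with that assms star_path_basis_iff show thesis by blast
qed

end

section \<open>Parallel pairs of the two complexes\<close>

lemma (in quiver_relations) basis_proj_arrow:
  "a \<in> arcs Q \<Longrightarrow> basis_proj Q Z x (tail Q a, [a]) = basis_elt x (tail Q a, [a])"
  using arrow_in_basis by (simp add: basis_proj_def)

context source_sink_gluing
begin

lemmas star_vertex_sym [simp] = star_vertex_simps(5)[THEN trans[OF eq_commute]]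
  star_vertex_simps(6)[THEN trans[OF eq_commute]]

abbreviation "gamma \<equiv> (tail Q \<alpha>, [\<alpha>])"
abbreviation "beta_path \<equiv> (tail Q \<beta>, [\<beta>])"

lemma star_path_id:
  assumes "\<beta> \<notin> set (snd p)" "fst p \<noteq> tail Q \<beta>" "fst p \<noteq> head Q \<beta>"
  shows "sp p = p"
proof -
  have "map sa (snd p) = snd p" using assms(1) by (intro map_idI star_arrow_id) blast
  with assms show ?thesis by (simp add: star_path_def)
qed

lemma basis_agree:
  assumes w: "\<alpha> \<notin> set w" "\<beta> \<notin> set w" and v: "v \<noteq> tail Q \<beta>" "v \<noteq> head Q \<beta>"
  shows "(v, w) \<in> path_basis QB ZB \<longleftrightarrow> (v, w) \<in> path_basis Q Z"
proof
  assume "(v, w) \<in> path_basis Q Z"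
  then show "(v, w) \<in> path_basis QB ZB"
    using star_path_basis_iff[of "(v, w)"] star_path_id[of "(v, w)"] w v by (simp add: path_basis_def)
next
  assume B: "(v, w) \<in> path_basis QB ZB"
  then obtain p where p: "p \<in> path_basis Q Z" "sp p = (v, w)" by (rule lift_basis)
  then have sv: "sv (fst p) = v" and "map sa (snd p) = w" by (auto simp: star_path_def)
  then have "\<alpha> \<notin> sa ` set (snd p)" using w(1) by auto
  then have "\<alpha> \<notin> set (snd p)" "\<beta> \<notin> set (snd p)" by (auto simp: image_iff)
  then have snd: "snd p = w" using \<open>map sa (snd p) = w\<close> by (metis map_idI star_arrow_id)
  have path: "(fst p, snd p) \<in> paths Q" using p(1) by (simp add: path_basis_def)
  show "(v, w) \<in> path_basis Q Z"
  proof (cases w)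
    case Nil
    \<comment> \<open>The lift of a trivial path at f_1 or f_2 may sit at e_{n-1} or e_n, so
      \<open>fst p\<close> need not be \<open>v\<close>; only that \<open>v\<close> is a vertex is
      extracted.\<close>
    have "fst p \<in> verts Q" using path Nil snd by simp
    then have "v \<in> verts Q" using sv by (auto simp: star_vertex_def split: if_splits)
    then show ?thesis using Nil trivial_in_basis by simp
  next
    case (Cons a u)
    then have "a \<in> arcs Q" "fst p = tail Q a" "a \<noteq> \<beta>" using path snd w by auto
    then have "fst p = v" using sv by simp
    then show ?thesis using p(1) snd by auto
  qed
qed

text \<open>
  As a path stores its start vertex and its arrows only, and gluing moves the source of no arrow
  but \<open>\<beta>\<close>, these pairs belong literally to the complexes of both algebras.
\<close>

definition unglued_pairs :: "(('v, 'a) qpath \<times> ('v, 'a) qpath) set" where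
  "unglued_pairs = {(x, p) \<in> parallel_pairs Q (arrow_paths Q) (path_basis Q Z).
     x \<noteq> gamma \<and> x \<noteq> beta_path}"

text \<open>A path parallel to another arrow \<open>a\<close> avoids \<alpha>, which would make it
  start at e_1, and \<beta>, which would make it end at e_n. Hence gluing does not change
  it.\<close>

lemma unglued_pairsE:
  assumes "(x, p) \<in> unglued_pairs"
  obtains a where "a \<in> arcs Q" "a \<noteq> \<alpha>" "a \<noteq> \<beta>" "x = (tail Q a, [a])"
    "p \<in> path_basis Q Z" "p \<in> path_basis QB ZB" "fst p = tail Q a"
    "path_end Q p = head Q a" "path_end QB p = sv (head Q a)"
    "\<alpha> \<notin> set (snd p)" "\<beta> \<notin> set (snd p)"
proof -
  from assms obtain a where "a \<in> arcs Q" "x = (tail Q a, [a])"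
    by (auto simp: unglued_pairs_def parallel_pairs_def arrow_paths_def arrow_path_def)
  moreover with assms have "a \<noteq> \<alpha>" "a \<noteq> \<beta>" "p \<in> path_basis Q Z" "fst p = tail Q a"
    "path_end Q p = head Q a"
    by (auto simp: unglued_pairs_def parallel_pairs_def)
  ultimately have a: "a \<in> arcs Q" "a \<noteq> \<alpha>" "a \<noteq> \<beta>" "x = (tail Q a, [a])"
    "p \<in> path_basis Q Z" "fst p = tail Q a" "path_end Q p = head Q a" by simp_all
  have path: "(fst p, snd p) \<in> paths Q" "path_end Q (fst p, snd p) = head Q a"
    using a(5,7) by (simp_all add: path_basis_def)
  have no: "\<alpha> \<notin> set (snd p)" "\<beta> \<notin> set (snd p)"
    using path_alpha_start[OF path(1)] path_beta_end[OF path(1)] path(2) a by auto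
  have "sp p = p" using star_path_id[of p] no a by simp
  moreover have "p \<in> path_basis QB ZB"
    using star_path_basis_iff[of p] \<open>sp p = p\<close> a by (simp add: path_basis_def)
  moreover have "path_end QB p = sv (head Q a)"
    using path_end_star_path[of p] \<open>sp p = p\<close> a by simp
  ultimately show thesis using that a no by blast
qed

text \<open>A path from e_1 to e_2 ends with \<alpha>, the only arrow into e_2, and \<alpha> can
  only be its first arrow; dually for \<beta>.\<close>

lemma parallel_pairs_unglued:
  "parallel_pairs Q (arrow_paths Q) (path_basis Q Z)
     \<subseteq> unglued_pairs \<union> {(gamma, gamma), (beta_path, beta_path)}"
proof (rule subsetI, rule ccontr)
  fix z assume z: "z \<in> parallel_pairs Q (arrow_paths Q) (path_basis Q Z)"
    "z \<notin> unglued_pairs \<union> {(gamma, gamma), (beta_path, beta_path)}"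
  obtain x1 x2 p1 p2 where "z = ((x1, x2), p1, p2)" by (metis prod.collapse)
  with z have xp: "((x1, x2), p1, p2) \<in> parallel_pairs Q (arrow_paths Q) (path_basis Q Z)"
    "((x1, x2), p1, p2) \<noteq> (beta_path, beta_path)" "((x1, x2), p1, p2) \<noteq> (gamma, gamma)"
    "((x1, x2), p1, p2) \<notin> unglued_pairs" by blast+
  then have p: "(p1, p2) \<in> paths Q" "p1 = x1"
    "path_end Q (x1, x2) = path_end Q (p1, p2)"
    by (auto simp: parallel_pairs_def path_basis_def)
  from xp consider "(x1, x2) = gamma" | "(x1, x2) = beta_path" by (auto simp: unglued_pairs_def)
  then show False
  proof cases
    case 1
    with p have "path_end Q (tail Q \<alpha>, p2) = head Q \<alpha>" by auto
    then have "p2 \<noteq> []" by auto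
    then obtain w b where w: "p2 = w @ [b]" by (metis rev_exhaust)
    with p 1 have "b \<in> arcs Q" "head Q b = head Q \<alpha>" by auto
    then have "b = \<alpha>" by simp
    then have "w = []" using p w path_alpha_first[of p1 w "[]"] by simp
    with 1 w p \<open>b = \<alpha>\<close> xp show ?thesis by simp
  next
    case 2
    with p have "path_end Q (tail Q \<beta>, p2) = head Q \<beta>" by auto
    then obtain b w where w: "p2 = b # w" by (cases p2) auto
    with p 2 have "b \<in> arcs Q" "tail Q b = tail Q \<beta>" by auto
    then have "b = \<beta>" by simp
    then have "w = []" using p w path_beta_last[of p1 "[]" w] by simp
    with 2 w p \<open>b = \<beta>\<close> xp show ?thesis by simp
  qed
qed

lemma unglued_in_glued_pairs:
  "unglued_pairs \<subseteq> parallel_pairs QB (arrow_paths QB) (path_basis QB ZB)"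
proof clarify
  fix x1 x2 p1 p2 assume "((x1, x2), p1, p2) \<in> unglued_pairs"
  then show "((x1, x2), p1, p2) \<in> parallel_pairs QB (arrow_paths QB) (path_basis QB ZB)"
    by (elim unglued_pairsE)
      (auto simp: parallel_pairs_def arrow_paths_def arrow_path_def image_iff)
qed

text \<open>For an arrow \<open>a\<close> other than the glued one, the path is lifted to A. The
  work is to show that the lift is parallel to \<open>a\<close> already before the end points are
  identified.\<close>

lemma glued_pairs_cases:
  assumes "(x, p) \<in> parallel_pairs QB (arrow_paths QB) (path_basis QB ZB)"
  obtains "(x, p) \<in> unglued_pairs"
  | "x = gamma" "p \<in> path_basis QB ZB" "fst p = tail Q \<alpha>" "path_end QB p = head Q \<alpha>"
proof -
  from assms obtain a where "a \<in> arcs Q" "a \<noteq> \<beta>" "x = (tail Q a, [a])"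
    by (auto simp: parallel_pairs_def arrow_paths_def arrow_path_glued)
  moreover with assms have "p \<in> path_basis QB ZB" "fst p = tail Q a"
    "path_end QB p = sv (head Q a)"
    by (auto simp: parallel_pairs_def)
  ultimately have a: "a \<in> arcs Q" "a \<noteq> \<beta>" "x = (tail Q a, [a])"
    "p \<in> path_basis QB ZB" "fst p = tail Q a" "path_end QB p = sv (head Q a)" by simp_all
  show thesis
  proof (cases "a = \<alpha>")
    case True
    with a that(2) show thesis by simp
  next
    case False
    from a(4) obtain q where q: "q \<in> path_basis Q Z" "sp q = p" by (rule lift_basis)
    then have path: "(fst q, snd q) \<in> paths Q" by (simp add: path_basis_def)
    have svq: "sv (fst q) = tail Q a" "sv (path_end Q q) = sv (head Q a)"
      using q(2) a path_end_star_path[of q] by (auto simp: star_path_def)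
    have \<alpha>: "\<alpha> \<notin> set (snd q)"
      using path_alpha_start[OF path] svq(1) False a(1) by auto
    have \<beta>: "\<beta> \<notin> set (snd q)"
      using path_beta_end[OF path] svq(2) False a(1,2) by auto
    \<comment> \<open>The only possible discrepancy is a start at the sink e_n. Then
      \<open>q\<close> is trivial, and parallelism in B would make \<open>a\<close> end at e_2 or
      e_n, so \<open>a\<close> would be \<alpha> or \<beta>.\<close>
    have "fst q = tail Q a"
    proof (rule ccontr)
      assume "fst q \<noteq> tail Q a"
      then have "fst q = head Q \<beta> \<or> fst q = tail Q \<beta>"
        using svq(1) by (auto simp: star_vertex_def split: if_splits)
      moreover have "fst q \<noteq> tail Q \<beta>" using svq(1) False a by auto
      ultimately have "fst q = head Q \<beta>" by simp
      then have "snd q = []" using path by (cases "snd q") auto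
      then have "path_end Q q = head Q \<beta>"
        using \<open>fst q = head Q \<beta>\<close> path_end_Nil by (metis prod.collapse)
      with svq(2) False a show False by auto
    qed
    moreover have "sp q = q"
      using star_path_id[OF \<beta>] calculation a by simp
    \<comment> \<open>The only possible discrepancy is that \<open>a\<close> ends at e_{n-1} and
      \<open>q\<close> at the source e_1. Then \<open>q\<close> would be trivial and
      \<open>a\<close> would start at e_1.\<close>
    moreover have "path_end Q q = head Q a"
    proof (rule ccontr)
      assume ne: "path_end Q q \<noteq> head Q a"
      have "head Q a = tail Q \<beta>"
      proof (rule ccontr)
        assume "head Q a \<noteq> tail Q \<beta>"
        then have "sv (head Q a) = head Q a" using a by simp
        with svq(2) have "path_end Q q = head Q a"
          using star_vertex_eq_other[of "path_end Q q" "head Q a"] a False by simp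
        with ne show False by simp
      qed
      with svq(2) ne have "path_end Q q = tail Q \<alpha>" by simp
      moreover have "snd q \<noteq> []"
        using \<open>fst q = tail Q a\<close> \<open>path_end Q q = tail Q \<alpha>\<close> a False path_end_Nil
        by (metis arcs_at_ends(2) prod.collapse)
      then obtain w b where "snd q = w @ [b]" by (metis rev_exhaust)
      then have "path_end Q (fst q, w @ [b]) = tail Q \<alpha>" "(fst q, w @ [b]) \<in> paths Q"
        using \<open>path_end Q q = tail Q \<alpha>\<close> path by (metis prod.collapse)+
      then show False by auto
    qed
    ultimately have "(x, p) \<in> unglued_pairs"
      using q a False
      by (auto simp: unglued_pairs_def parallel_pairs_def arrow_paths_def arrow_path_def)
    then show thesis by (rule that(1))
  qed
qed

text \<open>One map serves both complexes: \<open>gamma\<close> stands for \<alpha> in A and for the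
  glued arrow in B, while \<open>beta_path\<close> labels pairs of A only.\<close>

definition unglued_part :: "('v, 'a, 'k::field) cochain \<Rightarrow> ('v, 'a, 'k) cochain" where
  "unglued_part = linear_extension (\<lambda>(x, p). if x = gamma \<or> x = beta_path then 0 else basis_elt x p)"

lemmas unglued_part_linear = linear_linear_extension[of "\<lambda>(x, p). if x = gamma \<or> x = beta_path then 0
  else basis_elt x p", folded unglued_part_def]

lemma unglued_part_simps:
  "unglued_part (f + g) = unglued_part f + unglued_part g" "unglued_part (f - g) = unglued_part f - unglued_part g"
  "unglued_part (scale_cochain c f) = scale_cochain c (unglued_part f)" "unglued_part 0 = 0"
  "unglued_part (- f) = - unglued_part f"
  "unglued_part (\<Sum>i\<in>I. F i) = (\<Sum>i\<in>I. unglued_part (F i))"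
  by (simp_all add: unglued_part_def linear_extension_add linear_extension_diff linear_extension_scale
      linear_extension_uminus linear_extension_sum)

lemma unglued_part_basis_proj:
  "unglued_part (basis_proj Q' Z' x p) = (if x = gamma \<or> x = beta_path then 0 else basis_proj Q' Z' x p)"
  by (simp add: unglued_part_def basis_proj_def)

lemma unglued_part_id: "Poly_Mapping.keys f \<subseteq> unglued_pairs \<Longrightarrow> unglued_part f = f"
  unfolding unglued_part_def
  by (subst linear_extension_cong[where G = "\<lambda>x. Poly_Mapping.single x 1"])
    (auto simp: unglued_pairs_def linear_extension_id)

lemma keys_unglued_part:
  assumes "f \<in> cochains Q (arrow_paths Q) (path_basis Q Z)
    \<union> cochains QB (arrow_paths QB) (path_basis QB ZB)"
  shows "Poly_Mapping.keys (unglued_part f) \<subseteq> unglued_pairs"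
proof -
  have "(x, p) \<in> unglued_pairs" if "(x, p) \<in> Poly_Mapping.keys f" "x \<noteq> gamma" "x \<noteq> beta_path" for x p
  proof -
    from that assms have "(x, p) \<in> parallel_pairs Q (arrow_paths Q) (path_basis Q Z)
        \<or> (x, p) \<in> parallel_pairs QB (arrow_paths QB) (path_basis QB ZB)"
      by (auto simp: cochains_def)
    then show ?thesis
    proof
      assume "(x, p) \<in> parallel_pairs Q (arrow_paths Q) (path_basis Q Z)"
      with that show ?thesis by (simp add: unglued_pairs_def)
    next
      assume "(x, p) \<in> parallel_pairs QB (arrow_paths QB) (path_basis QB ZB)"
      then show ?thesis by (rule glued_pairs_cases) (use that in auto)
    qed
  qed
  then have "unglued_part f \<in> {h. Poly_Mapping.keys h \<subseteq> unglued_pairs}"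
    unfolding unglued_part_def
    by (intro linear_extension_in_subspace[OF subspace_supported]) (auto split: if_split_asm)
  then show ?thesis by simp
qed

section \<open>Inner derivations at the glued vertices, up to pairs at glued arrows\<close>

lemma unglued_part_inner_cochain_source: "unglued_part (inner_cochain Q Z (tail Q \<alpha>) g) = 0"
proof -
  have arcs: "{a \<in> arcs Q. tail Q a = tail Q \<alpha>} = {\<alpha>}" "{a \<in> arcs Q. head Q a = tail Q \<alpha>} = {}" by auto
  show ?thesis
    unfolding inner_cochain_def arcs by (simp add: unglued_part_simps unglued_part_basis_proj arrow_path_def)
qed

lemma unglued_part_inner_cochain_sink: "unglued_part (inner_cochain Q Z (head Q \<beta>) g) = 0"
proof -
  have arcs: "{a \<in> arcs Q. tail Q a = head Q \<beta>} = {}" "{a \<in> arcs Q. head Q a = head Q \<beta>} = {\<beta>}" by auto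
  show ?thesis
    unfolding inner_cochain_def arcs by (simp add: unglued_part_simps unglued_part_basis_proj arrow_path_def)
qed

lemma inner_cochain_agree:
  assumes g: "(e, g) \<in> paths Q" "path_end Q (e, g) = e"
    and e: "e \<noteq> tail Q \<alpha>" "e \<noteq> head Q \<alpha>" "e \<noteq> tail Q \<beta>" "e \<noteq> head Q \<beta>"
  shows "inner_cochain Q Z e g = inner_cochain QB ZB e g"
proof -
  have no: "\<alpha> \<notin> set g" "\<beta> \<notin> set g"
    using path_alpha_start[OF g(1)] path_beta_end[OF g(1)] g(2) e by auto
  have tl: "{a \<in> arcs QB. tail QB a = e} = {a \<in> arcs Q. tail Q a = e}" using e by auto
  have hd: "{a \<in> arcs QB. head QB a = e} = {a \<in> arcs Q. head Q a = e}"
  proof -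
    have "sv (head Q a) = e \<longleftrightarrow> head Q a = e" for a
      using e star_vertex_eq_other[of "head Q a" e] by auto
    then show ?thesis using e by auto
  qed
  have "(e, g @ [a]) \<in> path_basis Q Z \<longleftrightarrow> (e, g @ [a]) \<in> path_basis QB ZB"
    "arrow_path QB a = arrow_path Q a" if "a \<in> arcs Q" "tail Q a = e" for a
  proof -
    have "a \<noteq> \<alpha>" "a \<noteq> \<beta>" using that e by auto
    then show "(e, g @ [a]) \<in> path_basis Q Z \<longleftrightarrow> (e, g @ [a]) \<in> path_basis QB ZB"
      "arrow_path QB a = arrow_path Q a"
      using that no e basis_agree[of "g @ [a]" e] by (simp_all add: arrow_path_def)
  qed
  moreover have "(tail Q a, a # g) \<in> path_basis Q Z \<longleftrightarrow> (tail QB a, a # g) \<in> path_basis QB ZB"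
    "arrow_path QB a = arrow_path Q a" "tail QB a = tail Q a" if "a \<in> arcs Q" "head Q a = e" for a
  proof -
    have "a \<noteq> \<alpha>" "a \<noteq> \<beta>" using that e by auto
    then show "(tail Q a, a # g) \<in> path_basis Q Z \<longleftrightarrow> (tail QB a, a # g) \<in> path_basis QB ZB"
      "arrow_path QB a = arrow_path Q a" "tail QB a = tail Q a"
      using that no e basis_agree[of "a # g" "tail Q a"] by (simp_all add: arrow_path_def)
  qed
  ultimately show ?thesis
    unfolding inner_cochain_def tl hd
    by (intro arg_cong2[of _ _ _ _ "(-)"] sum.cong refl) (auto simp: basis_proj_def)
qed

text \<open>The vertex f_2 inherits its outgoing arrows from e_2 alone, and the single incoming
  arrow is projected away on both sides. Dually, f_1 corresponds to e_{n-1}.\<close>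

lemma unglued_part_inner_cochain_f2:
  "unglued_part (inner_cochain Q Z (head Q \<alpha>) []) = unglued_part (inner_cochain QB ZB (head Q \<alpha>) [])"
proof -
  have arcs: "{a \<in> arcs Q. head Q a = head Q \<alpha>} = {\<alpha>}"
    "{a \<in> arcs QB. tail QB a = head Q \<alpha>} = {a \<in> arcs Q. tail Q a = head Q \<alpha>}"
    "{a \<in> arcs QB. head QB a = head Q \<alpha>} = {\<alpha>}" by auto
  have "(head Q \<alpha>, [a]) \<in> path_basis QB ZB \<longleftrightarrow> (head Q \<alpha>, [a]) \<in> path_basis Q Z"
    "arrow_path QB a = arrow_path Q a" "a \<noteq> \<alpha>" "a \<noteq> \<beta>"
    if "a \<in> arcs Q" "tail Q a = head Q \<alpha>" for a
  proof -
    have "a \<noteq> \<alpha>" "a \<noteq> \<beta>" using that by auto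
    then show "(head Q \<alpha>, [a]) \<in> path_basis QB ZB \<longleftrightarrow> (head Q \<alpha>, [a]) \<in> path_basis Q Z"
      "arrow_path QB a = arrow_path Q a" "a \<noteq> \<alpha>" "a \<noteq> \<beta>"
      using that basis_agree[of "[a]" "tail Q a"] by (simp_all add: arrow_path_def)
  qed
  then have "(\<Sum>a | a \<in> arcs Q \<and> tail Q a = head Q \<alpha>. basis_proj Q Z (arrow_path Q a) (head Q \<alpha>, [a]))
    = (\<Sum>a | a \<in> arcs Q \<and> tail Q a = head Q \<alpha>.
        basis_proj QB ZB (arrow_path QB a) (head Q \<alpha>, [a]) :: ('v, 'a, 'b) cochain)"
    by (intro sum.cong refl) (auto simp: basis_proj_def)
  then show ?thesis
    unfolding inner_cochain_def arcs by (simp add: unglued_part_simps(1-5) unglued_part_basis_proj arrow_path_def)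
qed

lemma unglued_part_inner_cochain_f1:
  "unglued_part (inner_cochain Q Z (tail Q \<beta>) []) = unglued_part (inner_cochain QB ZB (tail Q \<alpha>) [])"
proof -
  have arcs: "{a \<in> arcs Q. tail Q a = tail Q \<beta>} = {\<beta>}"
    "{a \<in> arcs QB. head QB a = tail Q \<alpha>} = {a \<in> arcs Q. head Q a = tail Q \<beta>}"
    "{a \<in> arcs QB. tail QB a = tail Q \<alpha>} = {\<alpha>}" by auto
  have "(tail Q a, [a]) \<in> path_basis QB ZB \<longleftrightarrow> (tail Q a, [a]) \<in> path_basis Q Z"
    "arrow_path QB a = arrow_path Q a" "tail QB a = tail Q a"
    if "a \<in> arcs Q" "head Q a = tail Q \<beta>" for a
  proof -
    have "a \<noteq> \<alpha>" "a \<noteq> \<beta>" using that by auto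
    then show "(tail Q a, [a]) \<in> path_basis QB ZB \<longleftrightarrow> (tail Q a, [a]) \<in> path_basis Q Z"
      "arrow_path QB a = arrow_path Q a" "tail QB a = tail Q a"
      using that basis_agree[of "[a]" "tail Q a"] by (simp_all add: arrow_path_def)
  qed
  then have "(\<Sum>a | a \<in> arcs Q \<and> head Q a = tail Q \<beta>. basis_proj Q Z (arrow_path Q a) (tail Q a, [a]))
    = (\<Sum>a | a \<in> arcs Q \<and> head Q a = tail Q \<beta>.
        basis_proj QB ZB (arrow_path QB a) (tail QB a, [a]) :: ('v, 'a, 'b) cochain)"
    by (intro sum.cong refl) (auto simp: basis_proj_def)
  then show ?thesis
    unfolding inner_cochain_def arcs by (simp add: unglued_part_simps unglued_part_basis_proj arrow_path_def)
qed

text \<open>A nontrivial cycle at f_1 starts with the glued arrow, so an arrow in front of it would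
  make that arrow inner. Only the product with the glued arrow at the end remains.\<close>

lemma inner_cochain_f1_nontrivial:
  assumes "(tail Q \<alpha>, g) \<in> paths QB" "path_end QB (tail Q \<alpha>, g) = tail Q \<alpha>" "g \<noteq> []"
  shows "inner_cochain QB ZB (tail Q \<alpha>) g = basis_proj QB ZB gamma (tail Q \<alpha>, g @ [\<alpha>])"
proof -
  obtain b u where b: "g = b # u" using assms(3) by (cases g) auto
  with assms(1) have "b \<in> arcs Q" "b \<noteq> \<beta>" "sv (tail Q b) = tail Q \<alpha>" by auto
  then have "b = \<alpha>" by simp
  moreover have "u \<noteq> []" using assms(2) b \<open>b = \<alpha>\<close> by auto
  ultimately have "(v, a # g) \<notin> path_basis QB ZB" for v a
    using glued_basis_alpha[of v "[a]" u] b by auto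
  moreover have "{a \<in> arcs QB. tail QB a = tail Q \<alpha>} = {\<alpha>}" by auto
  ultimately show ?thesis by (simp add: inner_cochain_def basis_proj_def arrow_path_def)
qed

lemma unglued_part_inner_cochain_f1_nontrivial:
  assumes "(tail Q \<alpha>, g) \<in> paths QB" "path_end QB (tail Q \<alpha>, g) = tail Q \<alpha>" "g \<noteq> []"
  shows "unglued_part (inner_cochain QB ZB (tail Q \<alpha>) g) = 0"
  by (simp add: inner_cochain_f1_nontrivial[OF assms] unglued_part_basis_proj)

lemma unglued_part_inner_cochain_f2_nontrivial:
  assumes "(head Q \<alpha>, g) \<in> paths QB" "path_end QB (head Q \<alpha>, g) = head Q \<alpha>" "g \<noteq> []"
  shows "unglued_part (inner_cochain QB ZB (head Q \<alpha>) g) = 0"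
proof -
  obtain b u where b: "g = u @ [b]" using assms(3) by (metis rev_exhaust)
  with assms have "b \<in> arcs Q" "b \<noteq> \<beta>" "sv (head Q b) = head Q \<alpha>" by auto
  then have "b = \<alpha>" by auto
  moreover have "u \<noteq> []" using assms(1) b \<open>b = \<alpha>\<close> by auto
  ultimately have "(v, g @ [a]) \<notin> path_basis QB ZB" for v a
    using glued_basis_alpha[of v u "[a]"] b by auto
  then have "basis_proj QB ZB x (v, g @ [a]) = (0 :: ('v, 'a, 'b) cochain)" for x v a
    by (simp add: basis_proj_def)
  moreover have "{a \<in> arcs QB. head QB a = head Q \<alpha>} = {\<alpha>}" by auto
  ultimately show ?thesis
    by (simp add: inner_cochain_def unglued_part_simps unglued_part_basis_proj arrow_path_def)
qed

text \<open>A cycle at e_2 would have to enter through \<alpha>, hence start at e_1; a cycle at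
  e_{n-1} would have to leave through \<beta>, hence end at e_n.\<close>

lemma trivial_cycle_A:
  assumes "(e, g) \<in> paths Q" "path_end Q (e, g) = e" "e = head Q \<alpha> \<or> e = tail Q \<beta>"
  shows "g = []"
proof (rule ccontr)
  assume "g \<noteq> []"
  show False
  proof (cases "e = head Q \<alpha>")
    case True
    obtain w b where w: "g = w @ [b]" using \<open>g \<noteq> []\<close> by (metis rev_exhaust)
    with assms True have "b \<in> arcs Q" "head Q b = head Q \<alpha>" by auto
    then have "b = \<alpha>" by simp
    with w assms(1) path_alpha_start[of e g] True show False by auto
  next
    case False
    obtain b w where w: "g = b # w" using \<open>g \<noteq> []\<close> by (cases g) auto
    with assms False have "b \<in> arcs Q" "tail Q b = tail Q \<beta>" by auto
    then have "b = \<beta>" by simp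
    with w assms path_beta_end[of e g] False show False by auto
  qed
qed

text \<open>A path from f_1 to f_2 ends with the glued arrow. Without that last arrow it is a cycle
  at f_1, nontrivial unless \<open>p\<close> is \<open>gamma\<close>, and
  \<open>inner_cochain_f1_nontrivial\<close> applies to it.\<close>

lemma gamma_coboundary:
  assumes p: "p \<in> path_basis QB ZB" "fst p = tail Q \<alpha>" "path_end QB p = head Q \<alpha>" "p \<noteq> gamma"
  shows "basis_elt gamma p \<in> coboundaries1 QB ZB"
proof -
  obtain w where w: "p = (tail Q \<alpha>, w)" using p(2) by (metis prod.collapse)
  with p(3) have "w \<noteq> []" by auto
  then obtain g b where g: "w = g @ [b]" by (metis rev_exhaust)
  have path: "(tail Q \<alpha>, g @ [b]) \<in> paths QB" using p(1) w g by (simp add: path_basis_def)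
  with p(3) w g have "b \<in> arcs Q" "b \<noteq> \<beta>" "sv (head Q b) = head Q \<alpha>" by auto
  then have b: "b = \<alpha>" by auto
  with path have "(tail Q \<alpha>, g) \<in> paths QB" "path_end QB (tail Q \<alpha>, g) = tail Q \<alpha>" by auto
  moreover have "g \<noteq> []" using p(4) w g b by auto
  ultimately have "basis_proj QB ZB gamma p \<in> coboundaries1 QB ZB"
    using inner_cochain_f1_nontrivial B.inner_cochain_in_coboundaries1 w g b by metis
  then show ?thesis using p(1) by (simp add: basis_proj_def)
qed

text \<open>The preimage, in the cochains, of the line spanned by the class of the glued
  arrow.\<close>

definition gamma_span :: "('v, 'a, 'k::field) cochain set" where
  "gamma_span = {f. \<exists>u. f - scale_cochain u (basis_elt gamma gamma) \<in> coboundaries1 QB ZB}"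

lemma subspace_gamma_span: "cochain.subspace (gamma_span :: ('v, 'a, 'k::field) cochain set)"
proof -
  let ?s = "\<lambda>u. scale_cochain u (basis_elt gamma gamma) :: ('v, 'a, 'k) cochain"
  note sub = B.subspace_coboundaries1[where 'b = 'k]
  have "f + g \<in> gamma_span" if "f - ?s u \<in> coboundaries1 QB ZB" "g - ?s v \<in> coboundaries1 QB ZB" for f g u v
    using cochain.subspace_add[OF sub that]
    by (auto simp: gamma_span_def cochain.scale_left_distrib algebra_simps intro!: exI[of _ "u + v"])
  moreover have "scale_cochain c f \<in> gamma_span" if "f - ?s u \<in> coboundaries1 QB ZB" for f u c
    using cochain.subspace_scale[OF sub that, of c]
    by (auto simp: gamma_span_def cochain.scale_right_diff_distrib intro!: exI[of _ "c * u"])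
  moreover have "0 \<in> (gamma_span :: ('v, 'a, 'k) cochain set)"
    using cochain.subspace_0[OF sub] by (auto simp: gamma_span_def intro!: exI[of _ 0])
  ultimately show ?thesis
    unfolding cochain.subspace_def by (auto simp: gamma_span_def[where 'k = 'k])
qed

lemma coboundaries1_subset_gamma_span: "coboundaries1 QB ZB \<subseteq> gamma_span"
  by (auto simp: gamma_span_def intro!: exI[of _ 0])

lemma gamma_in_gamma_span: "basis_elt gamma gamma \<in> gamma_span"
  using cochain.subspace_0[OF B.subspace_coboundaries1]
  by (auto simp: gamma_span_def intro!: exI[of _ 1])

lemma diff_unglued_part: "f - unglued_part f = linear_extension (\<lambda>(x, p). if x = gamma \<or> x = beta_path
    then basis_elt x p else 0) f"
proof -
  have "f = linear_extension (\<lambda>z. Poly_Mapping.single z 1) f" by (simp add: linear_extension_id)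
  then have "f - unglued_part f = linear_extension (\<lambda>z. Poly_Mapping.single z 1) f - unglued_part f" by simp
  also have "\<dots> = linear_extension (\<lambda>(x, p). if x = gamma \<or> x = beta_path
    then basis_elt x p else 0) f"
    unfolding unglued_part_def linear_extension_fun_diff[symmetric]
    by (rule linear_extension_cong) auto
  finally show ?thesis .
qed

lemma diff_unglued_part_glued:
  assumes "f \<in> cochains QB (arrow_paths QB) (path_basis QB ZB)"
  shows "f - unglued_part f \<in> gamma_span"
  unfolding diff_unglued_part
proof (rule linear_extension_in_subspace[OF subspace_gamma_span])
  fix z assume z: "z \<in> Poly_Mapping.keys f"
  obtain x p where xp: "z = (x, p)" by (cases z)
  with z assms have "(x, p) \<in> parallel_pairs QB (arrow_paths QB) (path_basis QB ZB)"
    by (auto simp: cochains_def)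
  then have "(if x = gamma \<or> x = beta_path then basis_elt x p else 0) \<in> gamma_span"
  proof (cases rule: glued_pairs_cases)
    case 1
    then show ?thesis using cochain.subspace_0[OF subspace_gamma_span] by (auto simp: unglued_pairs_def)
  next
    case 2
    then show ?thesis
      using gamma_coboundary[OF 2(2-4)] coboundaries1_subset_gamma_span gamma_in_gamma_span
      by (cases "p = gamma") auto
  qed
  then show "(case z of (x, p) \<Rightarrow> if x = gamma \<or> x = beta_path then basis_elt x p else 0) \<in> gamma_span"
    by (simp add: xp)
qed

text \<open>The dropped pairs are coboundaries: \<alpha>||\<alpha> is the inner derivation of the
  trivial path at e_1, and \<beta>||\<beta> is minus that of the trivial path at e_n.\<close>

lemma diff_keys_unglued_part:
  fixes f :: "('v, 'a, 'k::field) cochain"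
  assumes "f \<in> cochains Q (arrow_paths Q) (path_basis Q Z)"
  shows "f - unglued_part f \<in> coboundaries1 Q Z"
  unfolding diff_unglued_part
proof (rule linear_extension_in_subspace[OF subspace_coboundaries1])
  fix z assume z: "z \<in> Poly_Mapping.keys f"
  obtain x p where xp: "z = (x, p)" by (cases z)
  have arcs: "{a \<in> arcs Q. tail Q a = tail Q \<alpha>} = {\<alpha>}" "{a \<in> arcs Q. head Q a = tail Q \<alpha>} = {}"
     "{a \<in> arcs Q. tail Q a = head Q \<beta>} = {}" "{a \<in> arcs Q. head Q a = head Q \<beta>} = {\<beta>}" by auto
  have "inner_cochain Q Z (tail Q \<alpha>) [] = (basis_elt gamma gamma :: ('v, 'a, 'k) cochain)"
    unfolding inner_cochain_def arcs by (simp add: arrow_path_def basis_proj_arrow)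
  then have \<alpha>: "(basis_elt gamma gamma :: ('v, 'a, 'k) cochain) \<in> coboundaries1 Q Z"
    using inner_cochain_in_coboundaries1[of "tail Q \<alpha>" "[]", where 'b = 'k] by (simp add: tail_in_verts)
  have "inner_cochain Q Z (head Q \<beta>) [] = (- basis_elt beta_path beta_path :: ('v, 'a, 'k) cochain)"
    unfolding inner_cochain_def arcs by (simp add: arrow_path_def basis_proj_arrow)
  then have \<beta>: "(basis_elt beta_path beta_path :: ('v, 'a, 'k) cochain) \<in> coboundaries1 Q Z"
    using inner_cochain_in_coboundaries1[of "head Q \<beta>" "[]", where 'b = 'k]
      cochain.subspace_neg[OF subspace_coboundaries1, of "- basis_elt beta_path beta_path :: ('v, 'a, 'k) cochain"]
    by (simp add: head_in_verts)
  have "z \<in> unglued_pairs \<union> {(gamma, gamma), (beta_path, beta_path)}"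
    using z assms parallel_pairs_unglued by (auto simp: cochains_def)
  then show "(case z of (x, p) \<Rightarrow> if x = gamma \<or> x = beta_path
      then basis_elt x p :: ('v, 'a, 'k) cochain else 0) \<in> coboundaries1 Q Z"
    using \<alpha> \<beta> cochain.subspace_0[OF subspace_coboundaries1[where 'b = 'k]]
    by (auto simp: unglued_pairs_def split: if_splits)
qed

end

lemma replace_at_same: "i < path_length r \<Longrightarrow> replace_at r i (v, [snd r ! i]) = r"
  by (simp add: replace_at_def path_length_def prod_eq_iff flip: id_take_nth_drop)

text \<open>Each substitution in a relation returns the relation itself, which is zero in the
  algebra.\<close>

lemma (in quiver_relations) diagonal_cocycle:
  assumes a: "a \<in> arcs Q"
  shows "basis_elt (tail Q a, [a]) (tail Q a, [a]) \<in> cocycles1 Q Z"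
proof -
  have "path_deriv Q Z (basis_elt (tail Q a, [a]) (tail Q a, [a])) r r = 0" if "r \<in> Z" for r
  proof -
    have "replace_at r i (tail Q a, [a]) = r" if "i < path_length r" "snd r ! i = a" for i
      using that replace_at_same by metis
    moreover have "r \<notin> path_basis Q Z"
      using not_basis_infix[OF \<open>r \<in> Z\<close>, of "fst r" "[]" "[]"] by simp
    ultimately show ?thesis by (auto simp: path_deriv_eq basis_proj_def intro!: sum.neutral)
  qed
  then show ?thesis
    using a arrow_in_basis[OF a]
    by (auto simp: cocycles1_iff cochains_def parallel_pairs_def arrow_paths_def arrow_path_def)
qed

section \<open>Comparison of the coboundaries of A and B\<close>

context source_sink_gluing
begin

lemma unglued_cycle:
  assumes g: "(e, g) \<in> path_basis Q Z" "path_end Q (e, g) = e"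
    and e: "e \<noteq> tail Q \<alpha>" "e \<noteq> head Q \<alpha>" "e \<noteq> tail Q \<beta>" "e \<noteq> head Q \<beta>"
  shows "(e, g) \<in> paths QB" "path_end QB (e, g) = e"
proof -
  have path: "(e, g) \<in> paths Q" using g(1) by (simp add: path_basis_def)
  have "\<beta> \<notin> set g" using path_beta_end[OF path] g(2) e by auto
  then have "sp (e, g) = (e, g)" using e by (intro star_path_id) simp_all
  then show "(e, g) \<in> paths QB" "path_end QB (e, g) = e"
    using star_path_in_paths[OF path] path_end_star_path[of "(e, g)"] g(2) e by auto
qed

lemma glued_cycle_cases:
  assumes g: "(e, g) \<in> path_basis QB ZB" "path_end QB (e, g) = e"
    and e: "e \<noteq> tail Q \<alpha>" "e \<noteq> head Q \<alpha>"
  shows "(e, g) \<in> paths Q" "path_end Q (e, g) = e" "e \<noteq> tail Q \<beta>" "e \<noteq> head Q \<beta>"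
proof -
  have "(e, g) \<in> paths QB" using g(1) by (simp add: path_basis_def)
  then have "e \<in> sv ` verts Q" using B.path_start_in_verts by auto
  then show e': "e \<noteq> tail Q \<beta>" "e \<noteq> head Q \<beta>" by (auto simp: star_vertex_def split: if_splits)
  obtain p where p: "p \<in> path_basis Q Z" "sp p = (e, g)" using g(1) by (rule lift_basis)
  have path: "(fst p, snd p) \<in> paths Q" using p(1) by (simp add: path_basis_def)
  have v: "fst p = e" "path_end Q p = e"
  proof -
    have "sv (fst p) = e" "sv (path_end Q p) = e"
      using p(2) g(2) path_end_star_path[of p] by (auto simp: star_path_def)
    then show "fst p = e" "path_end Q p = e" using e star_vertex_eq_other by blast+
  qed
  have "\<beta> \<notin> set (snd p)" using path_beta_end[OF path] v e' by auto
  then have "sp p = p" using v e' by (intro star_path_id) simp_all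
  then have "p = (e, g)" using p(2) by simp
  then show "(e, g) \<in> paths Q" "path_end Q (e, g) = e" using path v by auto
qed

lemma glued_ends_trivial_paths: "(tail Q \<alpha>, []) \<in> paths QB" "(head Q \<alpha>, []) \<in> paths QB"
proof -
  have "sv (tail Q \<alpha>) \<in> verts QB" "sv (head Q \<alpha>) \<in> verts QB"
    unfolding glue_quiver_simps by (intro imageI; simp)+
  then show "(tail Q \<alpha>, []) \<in> paths QB" "(head Q \<alpha>, []) \<in> paths QB" by simp_all
qed

text \<open>Generators are matched up to the projection: cycles at e_1 and e_n in A and nontrivial
  cycles at f_1 and f_2 in B go to 0, the trivial cycles at e_{n-1} and e_2 correspond to those at
  f_1 and f_2, and all other cycles are common to both.\<close>

lemma unglued_part_coboundaries1_eq:
  "unglued_part ` coboundaries1 Q Z = (unglued_part ` coboundaries1 QB ZB :: ('v, 'a, 'k::field) cochain set)"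
proof (intro equalityI image_subsetI)
  let ?r = "unglued_part :: ('v, 'a, 'k) cochain \<Rightarrow> _"
  have mh: "module_hom scale_cochain scale_cochain ?r"
    by (rule Vector_Spaces.linear.axioms(3)[OF unglued_part_linear])
  have sub: "cochain.subspace (?r -` (?r ` S))" if "cochain.subspace S" for S
    using that module_hom.subspace_image[OF mh] module_hom.subspace_vimage[OF mh] by blast
  have 0: "0 \<in> ?r ` coboundaries1 Q Z" "0 \<in> ?r ` coboundaries1 QB ZB"
    using cochain.subspace_0[OF subspace_coboundaries1[where 'b = 'k]]
      cochain.subspace_0[OF B.subspace_coboundaries1[where 'b = 'k]]
    by (auto simp: unglued_part_simps intro!: image_eqI[of _ _ 0])
  have "coboundaries1 Q Z \<subseteq> ?r -` (?r ` coboundaries1 QB ZB)"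
  proof (rule coboundaries1_subset[OF sub[OF B.subspace_coboundaries1]])
    fix e g assume g: "(e, g) \<in> path_basis Q Z" "path_end Q (e, g) = e"
    have path: "(e, g) \<in> paths Q" using g(1) by (simp add: path_basis_def)
    consider "e = tail Q \<alpha>" | "e = head Q \<beta>" | "e = head Q \<alpha>" | "e = tail Q \<beta>"
      | "e \<noteq> tail Q \<alpha>" "e \<noteq> head Q \<alpha>" "e \<noteq> tail Q \<beta>" "e \<noteq> head Q \<beta>" by blast
    then have "?r (inner_cochain Q Z e g) \<in> ?r ` coboundaries1 QB ZB"
    proof cases
      case 1
      then show ?thesis using 0 by (simp add: unglued_part_inner_cochain_source)
    next
      case 2
      then show ?thesis using 0 by (simp add: unglued_part_inner_cochain_sink)
    next
      case 3
      then have "g = []" using trivial_cycle_A[OF path g(2)] by simp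
      with 3 show ?thesis
        using glued_ends_trivial_paths(2)
        by (auto simp: unglued_part_inner_cochain_f2 intro!: imageI B.inner_cochain_in_coboundaries1
          simp del: B.paths_Nil)
    next
      case 4
      then have "g = []" using trivial_cycle_A[OF path g(2)] by simp
      with 4 show ?thesis
        using glued_ends_trivial_paths(1)
        by (auto simp: unglued_part_inner_cochain_f1 intro!: imageI B.inner_cochain_in_coboundaries1
          simp del: B.paths_Nil)
    next
      case 5
      then show ?thesis
        using unglued_cycle[OF g]
        by (auto simp: inner_cochain_agree[OF path g(2)]
          intro!: imageI B.inner_cochain_in_coboundaries1)
    qed
    then show "inner_cochain Q Z e g \<in> ?r -` (?r ` coboundaries1 QB ZB)" by simp
  qed
  then show "?r f \<in> ?r ` coboundaries1 QB ZB" if "f \<in> coboundaries1 Q Z" for f using that by auto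
  have "coboundaries1 QB ZB \<subseteq> ?r -` (?r ` coboundaries1 Q Z)"
  proof (rule B.coboundaries1_subset[OF sub[OF subspace_coboundaries1]])
    fix e g assume g: "(e, g) \<in> path_basis QB ZB" "path_end QB (e, g) = e"
    have path: "(e, g) \<in> paths QB" using g(1) by (simp add: path_basis_def)
    consider "e = tail Q \<alpha>" "g = []" | "e = tail Q \<alpha>" "g \<noteq> []" | "e = head Q \<alpha>" "g = []"
      | "e = head Q \<alpha>" "g \<noteq> []" | "e \<noteq> tail Q \<alpha>" "e \<noteq> head Q \<alpha>" by blast
    then have "?r (inner_cochain QB ZB e g) \<in> ?r ` coboundaries1 Q Z"
    proof cases
      case 1
      then show ?thesis
        by (auto simp: unglued_part_inner_cochain_f1[symmetric] intro!: imageI inner_cochain_in_coboundaries1)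
    next
      case 2
      then show ?thesis using 0 path g(2) unglued_part_inner_cochain_f1_nontrivial by metis
    next
      case 3
      then show ?thesis
        by (auto simp: unglued_part_inner_cochain_f2[symmetric] intro!: imageI inner_cochain_in_coboundaries1)
    next
      case 4
      then show ?thesis using 0 path g(2) unglued_part_inner_cochain_f2_nontrivial by metis
    next
      case 5
      note c = glued_cycle_cases[OF g 5]
      show ?thesis
        using inner_cochain_in_coboundaries1[OF c(1,2)]
        by (auto simp: inner_cochain_agree[OF c(1,2) 5 c(3,4), symmetric])
    qed
    then show "inner_cochain QB ZB e g \<in> ?r -` (?r ` coboundaries1 Q Z)" by simp
  qed
  then show "?r f \<in> ?r ` coboundaries1 Q Z" if "f \<in> coboundaries1 QB ZB" for f using that by auto
qed

lemma coboundaries1_cochains: "coboundaries1 Q Z \<subseteq> cochains Q (arrow_paths Q) (path_basis Q Z)"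
  "coboundaries1 QB ZB \<subseteq> cochains QB (arrow_paths QB) (path_basis QB ZB)"
  using coboundaries1_subset_cocycles1 B.coboundaries1_subset_cocycles1
  by (auto simp: cocycles1_iff B.cocycles1_iff)

lemma unglued_part_coboundary:
  fixes j :: "('v, 'a, 'k::field) cochain"
  assumes "j \<in> coboundaries1 QB ZB"
  shows "unglued_part j \<in> coboundaries1 Q Z"
proof -
  from assms obtain i where i: "i \<in> coboundaries1 Q Z" "unglued_part j = unglued_part i"
    using unglued_part_coboundaries1_eq[where 'k = 'k] by blast
  then have "i - unglued_part i \<in> coboundaries1 Q Z"
    using coboundaries1_cochains(1) diff_keys_unglued_part by blast
  from cochain.subspace_diff[OF subspace_coboundaries1 i(1) this] show ?thesis
    by (simp add: i(2))
qed

text \<open>This identifies the kernel of the projection in cohomology. Some coboundary of B has the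
  same unglued part as \<open>f\<close>, and subtracting it leaves only pairs at the glued
  arrow.\<close>

lemma gamma_span_if_unglued_part:
  fixes f :: "('v, 'a, 'k::field) cochain"
  assumes f: "f \<in> cochains QB (arrow_paths QB) (path_basis QB ZB)"
    and r: "unglued_part f \<in> coboundaries1 Q Z"
  shows "f \<in> gamma_span"
proof -
  have "unglued_part (unglued_part f) \<in> unglued_part ` coboundaries1 Q Z" using r by blast
  then obtain j where j: "j \<in> coboundaries1 QB ZB" "unglued_part (unglued_part f) = unglued_part j"
    using unglued_part_coboundaries1_eq[where 'k = 'k] by auto
  have "unglued_part f = unglued_part j"
    using j(2) unglued_part_id[OF keys_unglued_part[of f]] f by simp
  then have "f = (f - unglued_part f) - (j - unglued_part j) + j" by simp
  moreover have "f - unglued_part f \<in> gamma_span" "j - unglued_part j \<in> gamma_span" "j \<in> gamma_span"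
    using f j coboundaries1_cochains(2) diff_unglued_part_glued coboundaries1_subset_gamma_span by blast+
  ultimately show ?thesis
    using cochain.subspace_add[OF subspace_gamma_span] cochain.subspace_diff[OF subspace_gamma_span]
    by metis
qed

lemma gamma_cocycle: "basis_elt gamma gamma \<in> cocycles1 QB ZB"
  using B.diagonal_cocycle[of \<alpha>] by simp

lemma gamma_span_cocycles1: "gamma_span \<subseteq> cocycles1 QB ZB"
proof
  fix f :: "('v, 'a, 'b) cochain" assume "f \<in> gamma_span"
  then obtain u where "f - scale_cochain u (basis_elt gamma gamma) \<in> cocycles1 QB ZB"
    using B.coboundaries1_subset_cocycles1 by (auto simp: gamma_span_def)
  then have "f - scale_cochain u (basis_elt gamma gamma) + scale_cochain u (basis_elt gamma gamma)
      \<in> cocycles1 QB ZB"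
    using gamma_cocycle cochain.subspace_add[OF B.subspace_cocycles1]
      cochain.subspace_scale[OF B.subspace_cocycles1] by blast
  then show "f \<in> cocycles1 QB ZB" by simp
qed

section \<open>Comparison of the cocycles of A and B\<close>

lemma replace_at_star_path:
  assumes "\<beta> \<notin> set (snd \<gamma>)"
  shows "replace_at (sp z) i \<gamma> = sp (replace_at z i \<gamma>)"
proof -
  have "map sa (snd \<gamma>) = snd \<gamma>" using assms by (intro map_idI star_arrow_id) blast
  then show ?thesis by (simp add: replace_at_def star_path_def take_map drop_map)
qed

text \<open>An unglued pair replaces an arrow fixed by \<open>sa\<close> by a path fixed by
  \<open>sa\<close>, so substitution and gluing commute position by position.\<close>

lemma path_deriv_star_path:
  fixes f :: "('v, 'a, 'k::field) cochain"
  assumes f: "Poly_Mapping.keys f \<subseteq> unglued_pairs" and z: "z \<in> paths Q"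
  shows "path_deriv QB ZB f (sp z) (sp z)
    = linear_extension (\<lambda>(x, p). basis_elt (sp x) (sp p)) (path_deriv Q Z f z z)"
  unfolding path_deriv_eq linear_extension_linear_extension
proof (rule linear_extension_cong)
  fix k assume k: "k \<in> Poly_Mapping.keys f"
  obtain y \<gamma> where y: "k = (y, \<gamma>)" by (cases k)
  have "(y, \<gamma>) \<in> unglued_pairs" using k y f by auto
  then obtain a where a: "a \<in> arcs Q" "a \<noteq> \<alpha>" "a \<noteq> \<beta>" "y = (tail Q a, [a])"
    "\<gamma> \<in> paths Q" "fst \<gamma> = tail Q a" "path_end Q \<gamma> = head Q a" "\<beta> \<notin> set (snd \<gamma>)"
    by (auto simp: path_basis_def elim: unglued_pairsE)
  have "{i. i < path_length (sp z) \<and> snd (sp z) ! i = hd (snd y)}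
      = {i. i < path_length z \<and> snd z ! i = hd (snd y)}"
    using a by (auto simp: star_path_def path_length_def star_arrow_def)
  moreover have "basis_proj QB ZB (sp z) (replace_at (sp z) i \<gamma>)
      = (linear_extension (\<lambda>(x, p). basis_elt (sp x) (sp p)) (basis_proj Q Z z (replace_at z i \<gamma>))
        :: ('v, 'a, 'k) cochain)"
    if "i < path_length z" "snd z ! i = hd (snd y)" for i
    using replace_at_parallel(1)[OF z that(1), of \<gamma>] that a
      star_path_basis_iff[of "replace_at z i \<gamma>"]
    by (simp add: basis_proj_def replace_at_star_path)
  ultimately show "(case k of (y, \<gamma>) \<Rightarrow>
        (\<Sum>i | i < path_length (sp z) \<and> snd (sp z) ! i = hd (snd y).
          basis_proj QB ZB (sp z) (replace_at (sp z) i \<gamma>) :: ('v, 'a, 'k) cochain))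
    = linear_extension (\<lambda>(x, p). basis_elt (sp x) (sp p))
        (case k of (y, \<gamma>) \<Rightarrow> \<Sum>i | i < path_length z \<and> snd z ! i = hd (snd y).
          basis_proj Q Z z (replace_at z i \<gamma>))"
    by (simp add: y linear_extension_sum)
qed

lemma path_deriv_star_path_eq_0_iff:
  fixes f :: "('v, 'a, 'k::field) cochain"
  assumes f: "Poly_Mapping.keys f \<subseteq> unglued_pairs" and z: "z \<in> paths Q"
  shows "path_deriv QB ZB f (sp z) (sp z) = 0 \<longleftrightarrow> path_deriv Q Z f z z = 0"
proof
  let ?F = "\<lambda>(x, p). (sp x, sp p)"
  assume "path_deriv QB ZB f (sp z) (sp z) = 0"
  then have "linear_extension (\<lambda>k. Poly_Mapping.single (?F k) 1) (path_deriv Q Z f z z) = 0"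
    by (simp add: path_deriv_star_path[OF f z] case_prod_unfold)
  \<comment> \<open>All paths in this support start where \<open>z\<close> does, which is what
    \<open>star_path_inj\<close> requires.\<close>
  moreover have "inj_on ?F (Poly_Mapping.keys (path_deriv Q Z f z z))"
  proof (rule inj_onI)
    fix k l assume k: "k \<in> Poly_Mapping.keys (path_deriv Q Z f z z)"
      "l \<in> Poly_Mapping.keys (path_deriv Q Z f z z)" "?F k = ?F l"
    have "f \<in> cochains Q (arrow_paths Q) (path_basis Q Z)"
      using f by (auto simp: cochains_def unglued_pairs_def)
    from keys_path_deriv_parallel[OF this z, of z] k
    obtain p q where pq: "k = (z, p)" "l = (z, q)" "p \<in> path_basis Q Z" "q \<in> path_basis Q Z"
      "fst p = fst z" "fst q = fst z" by blast
    then have "(fst z, snd p) \<in> paths Q" "(fst z, snd q) \<in> paths Q"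
      by (auto simp: path_basis_def) (metis prod.collapse)+
    moreover have "map sa (snd p) = map sa (snd q)" using k(3) pq by (simp add: star_path_def)
    ultimately have "snd p = snd q" by (rule star_path_inj)
    with pq show "k = l" by (simp add: prod_eq_iff)
  qed
  ultimately show "path_deriv Q Z f z z = 0" using linear_extension_inj_eq_0 by blast
qed (simp add: path_deriv_star_path[OF f z])

text \<open>A nonempty replacement of \<eta> or \<xi> leaves the glued arrow inside the path, so the
  result is zero. An empty replacement would need \<eta> to be a loop at e_{n-1} or \<xi> a loop at
  e_2, but \<beta> is the only arrow leaving e_{n-1} and \<alpha> the only one entering e_2.\<close>

lemma path_deriv_new_relation:
  assumes f: "Poly_Mapping.keys f \<subseteq> unglued_pairs"
    and \<eta>: "\<eta> \<in> arcs Q" "\<xi> \<in> arcs Q" "head Q \<eta> = tail Q \<beta>" "tail Q \<xi> = head Q \<alpha>"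
  shows "path_deriv QB ZB f x (v, [\<eta>, \<alpha>, \<xi>]) = 0"
proof -
  have "path_deriv QB ZB f x (v, [\<eta>, \<alpha>, \<xi>]) = linear_extension (\<lambda>_. 0) f"
    unfolding path_deriv_eq
  proof (rule linear_extension_cong)
    fix k assume k: "k \<in> Poly_Mapping.keys f"
    obtain y \<gamma> where y: "k = (y, \<gamma>)" by (cases k)
    have "(y, \<gamma>) \<in> unglued_pairs" using k y f by auto
    then obtain a where a: "a \<in> arcs Q" "a \<noteq> \<alpha>" "a \<noteq> \<beta>" "y = (tail Q a, [a])"
      "fst \<gamma> = tail Q a" "path_end Q \<gamma> = head Q a"
      by (auto elim: unglued_pairsE)
    have "replace_at (v, [\<eta>, \<alpha>, \<xi>]) i \<gamma> \<notin> path_basis QB ZB"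
      if i: "i < path_length (v, [\<eta>, \<alpha>, \<xi>])" "[\<eta>, \<alpha>, \<xi>] ! i = a" for i
    proof
      assume B: "replace_at (v, [\<eta>, \<alpha>, \<xi>]) i \<gamma> \<in> path_basis QB ZB"
      consider "i = 0" "a = \<eta>" | "i = 2" "a = \<xi>"
        using i a by (auto simp: path_length_def less_Suc_eq)
      then have "snd \<gamma> = []"
        using B glued_basis_alpha[of v "snd \<gamma>" "[\<xi>]"] glued_basis_alpha[of v "[\<eta>]" "snd \<gamma>"]
        by cases (auto simp: replace_at_def)
      then have loop: "tail Q a = head Q a" using a path_end_Nil by (metis prod.collapse)
      from i a consider "a = \<eta>" | "a = \<xi>" by (auto simp: path_length_def less_Suc_eq)
      then show False using loop \<eta> a by cases auto
    qed
    then show "(case k of (y, \<gamma>) \<Rightarrow> \<Sum>i | i < path_length (v, [\<eta>, \<alpha>, \<xi>]) \<and> snd (v, [\<eta>, \<alpha>, \<xi>]) ! i = hd (snd y).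
        basis_proj QB ZB x (replace_at (v, [\<eta>, \<alpha>, \<xi>]) i \<gamma>)) = 0"
      using a by (auto simp: y basis_proj_def intro!: sum.neutral)
  qed
  then show ?thesis by simp
qed

lemma unglued_cochains:
  assumes "Poly_Mapping.keys f \<subseteq> unglued_pairs"
  shows "f \<in> cochains Q (arrow_paths Q) (path_basis Q Z)"
    "f \<in> cochains QB (arrow_paths QB) (path_basis QB ZB)"
  using assms unglued_in_glued_pairs by (auto simp: cochains_def unglued_pairs_def)

lemma unglued_cocycle_iff:
  fixes f :: "('v, 'a, 'k::field) cochain"
  assumes f: "Poly_Mapping.keys f \<subseteq> unglued_pairs"
  shows "f \<in> cocycles1 Q Z \<longleftrightarrow> f \<in> cocycles1 QB ZB"
proof -
  have "(\<forall>r\<in>Z. path_deriv Q Z f r r = 0) \<longleftrightarrow> (\<forall>r\<in>ZB. path_deriv QB ZB f r r = 0)"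
  proof
    assume *: "\<forall>r\<in>Z. path_deriv Q Z f r r = 0"
    show "\<forall>r\<in>ZB. path_deriv QB ZB f r r = 0"
    proof
      fix r assume "r \<in> ZB"
      then show "path_deriv QB ZB f r r = 0"
      proof (cases rule: glue_relations_cases)
        case (1 z)
        then show ?thesis using * path_deriv_star_path_eq_0_iff[OF f, of z] relations_in_paths by auto
      next
        case 2
        then show ?thesis using path_deriv_new_relation[OF f] by simp
      qed
    qed
  next
    assume *: "\<forall>r\<in>ZB. path_deriv QB ZB f r r = 0"
    show "\<forall>r\<in>Z. path_deriv Q Z f r r = 0"
    proof
      fix z assume "z \<in> Z"
      then show "path_deriv Q Z f z z = 0"
        using * star_relation path_deriv_star_path_eq_0_iff[OF f, of z] relations_in_paths by auto
    qed
  qed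
  then show ?thesis
    using unglued_cochains[OF f] by (simp add: cocycles1_iff B.cocycles1_iff)
qed

lemma unglued_part_cocycle_iff:
  fixes f :: "('v, 'a, 'k::field) cochain"
  assumes f: "f \<in> cochains QB (arrow_paths QB) (path_basis QB ZB)"
  shows "unglued_part f \<in> cocycles1 Q Z \<longleftrightarrow> f \<in> cocycles1 QB ZB"
proof -
  have keys: "Poly_Mapping.keys (unglued_part f) \<subseteq> unglued_pairs" using keys_unglued_part f by blast
  have d: "f - unglued_part f \<in> cocycles1 QB ZB" using diff_unglued_part_glued[OF f] gamma_span_cocycles1 by blast
  have "unglued_part f \<in> cocycles1 QB ZB \<longleftrightarrow> f \<in> cocycles1 QB ZB"
  proof
    assume "unglued_part f \<in> cocycles1 QB ZB"
    from cochain.subspace_add[OF B.subspace_cocycles1 d this] show "f \<in> cocycles1 QB ZB" by simp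
  next
    assume "f \<in> cocycles1 QB ZB"
    from cochain.subspace_diff[OF B.subspace_cocycles1 this d] show "unglued_part f \<in> cocycles1 QB ZB" by simp
  qed
  then show ?thesis using unglued_cocycle_iff[OF keys] by simp
qed

section \<open>Brackets under the projection, and centrality of the glued arrow\<close>

lemma unglued_part_subst_sum:
  "unglued_part (subst_sum Q' Z' x r a \<gamma>) = (if x = gamma \<or> x = beta_path then 0 else subst_sum Q' Z' x r a \<gamma>)"
  by (auto simp: subst_sum_eq unglued_part_simps unglued_part_basis_proj)

lemma subst_sum_agree:
  assumes "(y, \<epsilon>) \<in> unglued_pairs" "(x, \<gamma>) \<in> unglued_pairs"
  shows "subst_sum QB ZB y \<epsilon> a \<gamma> = subst_sum Q Z y \<epsilon> a \<gamma>"
proof -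
  have \<epsilon>: "\<alpha> \<notin> set (snd \<epsilon>)" "\<beta> \<notin> set (snd \<epsilon>)" "fst \<epsilon> \<noteq> tail Q \<beta>" "fst \<epsilon> \<noteq> head Q \<beta>"
    using assms(1) by (auto elim!: unglued_pairsE)
  have \<gamma>: "\<alpha> \<notin> set (snd \<gamma>)" "\<beta> \<notin> set (snd \<gamma>)"
    using assms(2) by (auto elim!: unglued_pairsE)
  have "replace_at \<epsilon> i \<gamma> \<in> path_basis QB ZB \<longleftrightarrow> replace_at \<epsilon> i \<gamma> \<in> path_basis Q Z" for i
    unfolding replace_at_def
    by (rule basis_agree) (use \<epsilon> \<gamma> in \<open>auto dest: in_set_takeD in_set_dropD\<close>)
  then show ?thesis by (simp add: subst_sum_def)
qed

text \<open>Pairs at the glued arrow leave no trace: substituting for this arrow does nothing in the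
  path of an unglued pair, which avoids it, and whatever is substituted into their own paths keeps
  the label that is dropped. On two unglued pairs both brackets agree.\<close>

lemma unglued_part_cochain_bracket:
  fixes f g :: "('v, 'a, 'k::field) cochain"
  assumes f: "f \<in> cochains QB (arrow_paths QB) (path_basis QB ZB)"
    and g: "g \<in> cochains QB (arrow_paths QB) (path_basis QB ZB)"
  shows "unglued_part (cochain_bracket QB ZB f g) = cochain_bracket Q Z (unglued_part f) (unglued_part g)"
proof -
  let ?r = "\<lambda>(x, p). if x = gamma \<or> x = beta_path then 0 else basis_elt x p :: ('v, 'a, 'k) cochain"
  let ?t = "\<lambda>Q Z (x, \<gamma>) (y, \<epsilon>). subst_sum Q Z y \<epsilon> (hd (snd x)) \<gamma> - subst_sum Q Z x \<gamma> (hd (snd y)) \<epsilon>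
    :: ('v, 'a, 'k) cochain"
  have A: "cochain_bracket Q' Z' f' g' = linear_extension (\<lambda>z. linear_extension (?t Q' Z' z) g') f'"
    for Q' Z' f' g'
    unfolding cochain_bracket_def by (simp add: case_prod_unfold)
  have "unglued_part (cochain_bracket QB ZB f g)
      = linear_extension (\<lambda>z. linear_extension (\<lambda>z'. unglued_part (?t QB ZB z z')) g) f"
    unfolding A unglued_part_def linear_extension_linear_extension ..
  also have "\<dots> = linear_extension (\<lambda>z. linear_extension (\<lambda>z'.
      linear_extension (\<lambda>z. linear_extension (?t Q Z z) (?r z')) (?r z)) g) f"
  proof (intro linear_extension_cong)
    fix z z' assume "z \<in> Poly_Mapping.keys f" "z' \<in> Poly_Mapping.keys g"
    moreover obtain x \<gamma> y \<epsilon> where z: "z = (x, \<gamma>)" "z' = (y, \<epsilon>)" by (cases z; cases z')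
    ultimately have pairs: "(x, \<gamma>) \<in> parallel_pairs QB (arrow_paths QB) (path_basis QB ZB)"
      "(y, \<epsilon>) \<in> parallel_pairs QB (arrow_paths QB) (path_basis QB ZB)"
      using f g by (auto simp: cochains_def)
    have alpha_free: "subst_sum QB ZB y' \<epsilon>' \<alpha> \<gamma>' = (0 :: ('v, 'a, 'k) cochain)"
      if "(y', \<epsilon>') \<in> unglued_pairs" for y' \<epsilon>' \<gamma>'
    proof -
      have "\<alpha> \<notin> set (snd \<epsilon>')" using that by (auto elim: unglued_pairsE)
      then have "{i. i < path_length \<epsilon>' \<and> snd \<epsilon>' ! i = \<alpha>} = {}" by (auto simp: path_length_def)
      then show ?thesis unfolding subst_sum_eq by (simp only: sum.empty)
    qed
    have neq: "x' \<noteq> gamma" "x' \<noteq> beta_path" if "(x', \<gamma>') \<in> unglued_pairs" for x' \<gamma>'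
      using that by (auto simp: unglued_pairs_def)
    have "unglued_part (?t QB ZB (x, \<gamma>) (y, \<epsilon>))
      = linear_extension (\<lambda>z. linear_extension (?t Q Z z) (?r (y, \<epsilon>))) (?r (x, \<gamma>))"
      using pairs(1)
    proof (cases rule: glued_pairs_cases)
      case 1
      note x = this
      show ?thesis
        using pairs(2)
      proof (cases rule: glued_pairs_cases)
        case 1
        show ?thesis
          using neq[OF 1] neq[OF x]
          by (simp add: unglued_part_simps unglued_part_subst_sum subst_sum_agree[OF 1 x] subst_sum_agree[OF x 1])
      next
        case 2
        then show ?thesis
          using alpha_free[OF x] by (simp add: unglued_part_simps unglued_part_subst_sum)
      qed
    next
      case 2
      note x = this
      show ?thesis
        using pairs(2)
      proof (cases rule: glued_pairs_cases)
        case 1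
        then show ?thesis
          using x alpha_free[OF 1] by (simp add: unglued_part_simps unglued_part_subst_sum)
      next
        case 2
        then show ?thesis
          using x by (simp add: unglued_part_simps unglued_part_subst_sum)
      qed
    qed
    then show "unglued_part (?t QB ZB z z')
      = linear_extension (\<lambda>z. linear_extension (?t Q Z z) (?r z')) (?r z)"
      unfolding z .
  qed
  also have "\<dots> = linear_extension (\<lambda>z. linear_extension (\<lambda>z''.
      linear_extension (?t Q Z z'') (unglued_part g)) (?r z)) f"
    unfolding unglued_part_def linear_extension_linear_extension
    by (subst linear_extension_swap) (rule refl)
  also have "\<dots> = cochain_bracket Q Z (unglued_part f) (unglued_part g)"
    unfolding A unglued_part_def linear_extension_linear_extension ..
  finally show ?thesis .
qed

text \<open>The element counts occurrences of the glued arrow: it annihilates unglued pairs and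
  multiplies the other basis pairs by an integer. This integer is 0 at \<open>gamma\<close>, and all
  remaining pairs are coboundaries by \<open>gamma_coboundary\<close>.\<close>

lemma gamma_central:
  fixes h :: "('v, 'a, 'k::field) cochain"
  assumes h: "h \<in> cochains QB (arrow_paths QB) (path_basis QB ZB)"
  shows "cochain_bracket QB ZB (basis_elt gamma gamma) h \<in> coboundaries1 QB ZB"
proof -
  note sub = B.subspace_coboundaries1[where 'b = 'k]
  have eq: "cochain_bracket QB ZB (basis_elt gamma gamma) h = linear_extension
      (\<lambda>(y, \<epsilon>). subst_sum QB ZB y \<epsilon> \<alpha> gamma - subst_sum QB ZB gamma gamma (hd (snd y)) \<epsilon>) h"
    by (simp add: cochain_bracket_def)
  show ?thesis
    unfolding eq
  proof (rule linear_extension_in_subspace[OF sub])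
    fix z assume z: "z \<in> Poly_Mapping.keys h"
    obtain y \<epsilon> where y: "z = (y, \<epsilon>)" by (cases z)
    with z h have "(y, \<epsilon>) \<in> parallel_pairs QB (arrow_paths QB) (path_basis QB ZB)"
      by (auto simp: cochains_def)
    then have "(subst_sum QB ZB y \<epsilon> \<alpha> gamma - subst_sum QB ZB gamma gamma (hd (snd y)) \<epsilon>
        :: ('v, 'a, 'k) cochain) \<in> coboundaries1 QB ZB"
    proof (cases rule: glued_pairs_cases)
      case 1
      then obtain a where a: "y = (tail Q a, [a])" "a \<noteq> \<alpha>" "\<alpha> \<notin> set (snd \<epsilon>)"
        by (auto elim: unglued_pairsE)
      then have "{i. i < path_length \<epsilon> \<and> snd \<epsilon> ! i = \<alpha>} = {}"
        "{i. i < path_length gamma \<and> snd gamma ! i = hd (snd y)} = {}"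
        by (auto simp: path_length_def)
      then show ?thesis
        unfolding subst_sum_eq using cochain.subspace_0[OF sub] by (simp only: sum.empty diff_self)
    next
      case 2
      show ?thesis
      proof (cases "\<epsilon> = gamma")
        case True
        with 2 show ?thesis using cochain.subspace_0[OF sub] by simp
      next
        case False
        then have mem: "(basis_proj QB ZB gamma \<epsilon> :: ('v, 'a, 'k) cochain) \<in> coboundaries1 QB ZB"
          using gamma_coboundary[OF 2(2-4)] 2(2) by (simp add: basis_proj_def)
        have "replace_at \<epsilon> i gamma = \<epsilon>" if "i < path_length \<epsilon>" "snd \<epsilon> ! i = \<alpha>" for i
          using that replace_at_same by metis
        moreover have "replace_at gamma i \<epsilon> = \<epsilon>" if "i < path_length gamma" for i
          using that 2 by (simp add: replace_at_def path_length_def prod_eq_iff)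
        ultimately show ?thesis
          unfolding subst_sum_eq 2(1) using mem
          by (intro cochain.subspace_diff[OF sub] cochain.subspace_sum[OF sub]) auto
      qed
    qed
    then show "(case z of (y, \<epsilon>) \<Rightarrow> (subst_sum QB ZB y \<epsilon> \<alpha> gamma
        - subst_sum QB ZB gamma gamma (hd (snd y)) \<epsilon> :: ('v, 'a, 'k) cochain))
          \<in> coboundaries1 QB ZB"
      by (simp add: y)
  qed
qed

end

lemma of_nat_neq_0_if_CHAR_0: "CHAR('k::field) = 0 \<Longrightarrow> 0 < n \<Longrightarrow> (of_nat n :: 'k) \<noteq> 0"
  by (simp add: of_nat_eq_0_iff_char_dvd)

section \<open>Characters of the first Hochschild cohomology\<close>

text \<open>
  A loop \<open>b\<close> has a power \<open>b\<^sup>m\<close> among the relations; substituting the trivial path for \<open>b\<close> in it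
  gives \<open>m\<close> times the basis element \<open>b\<^bsup>m-1\<^esup>\<close>.
\<close>

lemma (in monomial_algebra) cocycle_target_nontrivial:
  fixes f :: "('v, 'a, 'k::field) cochain"
  assumes char: "CHAR('k) = 0" and f: "f \<in> cocycles1 Q Z"
    and key: "(x, p) \<in> Poly_Mapping.keys f"
  shows "snd p \<noteq> []"
proof
  assume "snd p = []"
  have C: "f \<in> cochains Q (arrow_paths Q) (path_basis Q Z)" using f by (simp add: cocycles1_iff)
  from C key obtain b where b: "b \<in> arcs Q" "x = (tail Q b, [b])" "fst p = tail Q b"
    "path_end Q p = head Q b"
    by (rule keys_cochains1)
  define e where "e = tail Q b"
  have p: "p = (e, [])" using b \<open>snd p = []\<close> by (simp add: e_def prod_eq_iff)
  with b have loop: "head Q b = e" by simp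
  have end_rep: "path_end Q (e, replicate n b) = e" for n by (induction n) (simp_all add: loop)
  have path_rep: "(e, replicate n b) \<in> paths Q" for n
    using b by (induction n) (simp_all add: loop, simp_all add: e_def)
  obtain N where N: "\<forall>p\<in>paths Q. N \<le> path_length p \<longrightarrow> (\<exists>z\<in>Z. subpath Q z p)"
    using admissible by blast
  then obtain z where z: "z \<in> Z" "subpath Q z (e, replicate N b)"
    using path_rep[of N] by (auto simp: path_length_def)
  then obtain xs ys where xy: "replicate N b = xs @ snd z @ ys" "path_end Q (e, xs) = fst z"
    by (auto simp: subpath_def)
  define m where "m = length (snd z)"
  have "set (xs @ snd z @ ys) \<subseteq> {b}" unfolding xy(1)[symmetric] by auto
  then have "set xs \<subseteq> {b}" "set (snd z) \<subseteq> {b}" by auto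
  then have "xs = replicate (length xs) b" and sndz: "snd z = replicate m b"
    unfolding m_def by (auto intro!: replicate_length_same[symmetric])
  then have fstz: "fst z = e" using xy(2) end_rep by metis
  have m: "2 \<le> m" using relation_length[OF z(1)] by (simp add: m_def)
  \<comment> \<open>The coefficient of z||t isolates the pair b||e: replacing an arrow of
    \<open>z\<close> by a nonempty path gives length at least \<open>m\<close>, so \<open>t\<close>
    arises only from a trivial replacement, once for each of the \<open>m\<close> positions.\<close>
  define t where "t = (e, replicate (m - 1) b)"
  have tz: "subpath Q t z"
    unfolding subpath_def t_def
    by (intro exI[of _ "[]"] exI[of _ "[b]"])
      (use m in \<open>simp add: sndz fstz replicate_append_same flip: replicate_Suc\<close>)
  have t: "t \<in> path_basis Q Z"
  proof (rule ccontr)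
    assume "t \<notin> path_basis Q Z"
    then obtain z' where z': "z' \<in> Z" "subpath Q z' t" using path_rep by (auto simp: path_basis_def t_def)
    then have "z' = z" using minimal z(1) subpath_trans tz by blast
    with z'(2) obtain us vs where "replicate (m - 1) b = us @ snd z @ vs"
      by (auto simp: subpath_def t_def)
    then have "length (replicate (m - 1) b) = length us + m + length vs" by (simp add: m_def)
    with m show False by simp
  qed
  have repl: "replace_at z i \<gamma> = t \<longleftrightarrow> snd \<gamma> = []" if "i < m" for i \<gamma>
  proof
    assume "replace_at z i \<gamma> = t"
    then have "length (snd (replace_at z i \<gamma>)) = m - 1" by (simp add: t_def)
    then have "length (snd \<gamma>) + m - 1 = m - 1" using that sndz by (simp add: replace_at_def)
    then have "length (snd \<gamma>) = 0" using m by linarith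
    then show "snd \<gamma> = []" by simp
  next
    assume "snd \<gamma> = []"
    then show "replace_at z i \<gamma> = t"
      using that by (simp add: replace_at_def sndz fstz t_def flip: replicate_add)
  qed
  have coeff: "Poly_Mapping.lookup (\<Sum>i | i < path_length z \<and> snd z ! i = hd (snd y).
      basis_proj Q Z z (replace_at z i \<gamma>)) (z, t) = (if y = x \<and> \<gamma> = p then of_nat m else (0 :: 'k))"
    if k: "(y, \<gamma>) \<in> Poly_Mapping.keys f" for y \<gamma>
  proof -
    from C k obtain a where a: "a \<in> arcs Q" "y = (tail Q a, [a])" "fst \<gamma> = tail Q a"
      by (rule keys_cochains1)
    have "Poly_Mapping.lookup (basis_proj Q Z z (replace_at z i \<gamma>)) (z, t)
        = (if snd \<gamma> = [] then 1 else (0 :: 'k))" if "i < m" for i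
      using repl[OF that, of \<gamma>] t by (auto simp: basis_proj_def lookup_single when_def)
    then have "Poly_Mapping.lookup (\<Sum>i | i < path_length z \<and> snd z ! i = hd (snd y).
        basis_proj Q Z z (replace_at z i \<gamma>)) (z, t)
      = (\<Sum>i | i < m \<and> snd z ! i = a. if snd \<gamma> = [] then 1 else (0 :: 'k))"
      by (simp add: lookup_sum path_length_def a m_def)
    also have "\<dots> = (if a = b \<and> snd \<gamma> = [] then of_nat m else 0)"
    proof (cases "a = b")
      case True
      have "{i. i < m \<and> snd z ! i = a} = {..<m}" using True by (auto simp: sndz)
      then show ?thesis using True by simp
    next
      case False
      have empty: "{i. i < m \<and> snd z ! i = a} = {}" using False by (auto simp: sndz)
      show ?thesis unfolding empty using False by simp
    qed
    also have "a = b \<and> snd \<gamma> = [] \<longleftrightarrow> y = x \<and> \<gamma> = p"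
      using a b(2) p by (auto simp: e_def prod_eq_iff)
    finally show ?thesis .
  qed
  have "0 = Poly_Mapping.lookup (path_deriv Q Z f z z) (z, t)"
    using f z(1) by (simp add: cocycles1_iff)
  also have "\<dots> = (\<Sum>k\<in>Poly_Mapping.keys f. if k = (x, p) then Poly_Mapping.lookup f k * of_nat m else 0)"
    unfolding path_deriv_eq lookup_linear_extension
  proof (rule sum.cong[OF refl])
    fix k assume k: "k \<in> Poly_Mapping.keys f"
    obtain y \<gamma> where y: "k = (y, \<gamma>)" by (cases k)
    show "Poly_Mapping.lookup f k * Poly_Mapping.lookup (case k of (y, \<gamma>) \<Rightarrow>
        \<Sum>i | i < path_length z \<and> snd z ! i = hd (snd y). basis_proj Q Z z (replace_at z i \<gamma>)) (z, t)
      = (if k = (x, p) then Poly_Mapping.lookup f k * of_nat m else 0)"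
      using coeff[of y \<gamma>] k unfolding y prod.case by simp
  qed
  also have "\<dots> = Poly_Mapping.lookup f (x, p) * of_nat m"
    using key by (simp add: sum.delta)
  finally show False
    using key of_nat_neq_0_if_CHAR_0[OF char, of m] m by (simp add: in_keys_iff)
qed

definition diagonal_weight ::
  "('v, 'a) quiver \<Rightarrow> ('a \<Rightarrow> 'k::field) \<Rightarrow> ('v, 'a, 'k) cochain \<Rightarrow> 'k" where
  "diagonal_weight Q w f
     = (\<Sum>a\<in>arcs Q. w a * Poly_Mapping.lookup f ((tail Q a, [a]), (tail Q a, [a])))"

lemma diagonal_weight_simps:
  "diagonal_weight Q w (f + g) = diagonal_weight Q w f + diagonal_weight Q w g"
  "diagonal_weight Q w (f - g) = diagonal_weight Q w f - diagonal_weight Q w g"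
  "diagonal_weight Q w (scale_cochain c f) = c * diagonal_weight Q w f"
  "diagonal_weight Q w 0 = 0"
  by (simp_all add: diagonal_weight_def lookup_add lookup_minus algebra_simps sum.distrib
      sum_subtractf sum_distrib_left)

lemma diagonal_weight_sum:
  "diagonal_weight Q w (\<Sum>i\<in>I. F i) = (\<Sum>i\<in>I. diagonal_weight Q w (F i))"
  by (induction I rule: infinite_finite_induct) (simp_all add: diagonal_weight_simps)

lemma diagonal_weight_linear_extension:
  "diagonal_weight Q w (linear_extension F f)
     = (\<Sum>x\<in>Poly_Mapping.keys f. Poly_Mapping.lookup f x * diagonal_weight Q w (F x))"
  by (simp add: linear_extension_def diagonal_weight_sum diagonal_weight_simps)

context quiver_relations
begin

lemma diagonal_weight_basis_proj:
  assumes "a \<in> arcs Q"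
  shows "diagonal_weight Q w (basis_proj Q Z (tail Q a, [a]) p) = (if p = (tail Q a, [a]) then w a else 0)"
proof (cases "p = (tail Q a, [a])")
  case True
  have "diagonal_weight Q w (basis_elt (tail Q a, [a]) p) = (\<Sum>b\<in>arcs Q. if b = a then w b else 0)"
    unfolding diagonal_weight_def True by (rule sum.cong) (auto simp: lookup_single when_def)
  also have "\<dots> = w a" using assms by simp
  finally show ?thesis using True by (simp add: basis_proj_arrow[OF assms])
next
  case False
  then have "diagonal_weight Q w (basis_proj Q Z (tail Q a, [a]) p) = 0"
    unfolding diagonal_weight_def by (intro sum.neutral) (auto simp: basis_proj_def lookup_single when_def)
  with False show ?thesis by simp
qed

text \<open>Nontrivial cycles contribute nothing to the diagonal, and the trivial cycle at
  \<open>e\<close> contributes the outflow minus the inflow of \<open>w\<close> at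
  \<open>e\<close>.\<close>

lemma diagonal_weight_coboundary:
  fixes w :: "'a \<Rightarrow> 'k::field"
  assumes circulation: "\<And>v. (\<Sum>a | a \<in> arcs Q \<and> tail Q a = v. w a) = (\<Sum>a | a \<in> arcs Q \<and> head Q a = v. w a)"
    and j: "j \<in> coboundaries1 Q Z"
  shows "diagonal_weight Q w j = 0"
proof -
  have sub: "cochain.subspace {j. diagonal_weight Q w j = 0}"
    by (auto simp: cochain.subspace_def diagonal_weight_simps)
  have "diagonal_weight Q w (inner_cochain Q Z e g) = 0" for e g
  proof -
    have "diagonal_weight Q w (inner_cochain Q Z e g)
      = (\<Sum>a | a \<in> arcs Q \<and> tail Q a = e. if g = [] then w a else 0)
      - (\<Sum>a | a \<in> arcs Q \<and> head Q a = e. if g = [] then w a else 0)"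
      unfolding inner_cochain_def diagonal_weight_simps diagonal_weight_sum arrow_path_def
      by (intro arg_cong2[of _ _ _ _ "(-)"] sum.cong refl) (auto simp: diagonal_weight_basis_proj)
    then show ?thesis using circulation[of e] by (cases "g = []") simp_all
  qed
  then have "coboundaries1 Q Z \<subseteq> {j. diagonal_weight Q w j = 0}"
    by (intro coboundaries1_subset[OF sub]) auto
  with j show ?thesis by auto
qed

text \<open>If the result is the single arrow \<open>b\<close>, the lengths of \<epsilon> and
  \<gamma> add up to 2. Since \<gamma> is nonempty and \<epsilon> contains the replaced arrow, both
  have length 1.\<close>

lemma diagonal_weight_subst_sum:
  assumes b: "b \<in> arcs Q" "fst \<epsilon> = tail Q b" and \<gamma>: "snd \<gamma> \<noteq> []"
  shows "diagonal_weight Q w (subst_sum Q Z (tail Q b, [b]) \<epsilon> a \<gamma>)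
    = (if snd \<epsilon> = [a] \<and> snd \<gamma> = [b] then w b else 0)"
proof -
  have eq: "diagonal_weight Q w (subst_sum Q Z (tail Q b, [b]) \<epsilon> a \<gamma>)
    = (\<Sum>i | i < path_length \<epsilon> \<and> snd \<epsilon> ! i = a. if snd (replace_at \<epsilon> i \<gamma>) = [b] then w b else 0)"
    unfolding subst_sum_eq diagonal_weight_sum
    by (rule sum.cong) (use b in \<open>auto simp: diagonal_weight_basis_proj prod_eq_iff replace_at_def\<close>)
  show ?thesis
  proof (cases "snd \<epsilon> = [a]")
    case True
    then have "{i. i < path_length \<epsilon> \<and> snd \<epsilon> ! i = a} = {0}" by (auto simp: path_length_def)
    then show ?thesis unfolding eq using True by (simp add: replace_at_def)
  next
    case False
    have "snd (replace_at \<epsilon> i \<gamma>) \<noteq> [b]" if i: "i < path_length \<epsilon>" "snd \<epsilon> ! i = a" for i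
    proof
      assume "snd (replace_at \<epsilon> i \<gamma>) = [b]"
      then have "length (snd (replace_at \<epsilon> i \<gamma>)) = 1" by simp
      then have "length (snd \<gamma>) + length (snd \<epsilon>) = 2"
        using i \<gamma> by (simp add: replace_at_def path_length_def)
      moreover have "0 < length (snd \<gamma>)" "0 < length (snd \<epsilon>)"
        using \<gamma> i by (auto simp: path_length_def)
      ultimately have "length (snd \<epsilon>) = 1" by linarith
      then show False using i False by (auto simp: length_Suc_conv path_length_def)
    qed
    then show ?thesis unfolding eq using False by (simp add: sum.neutral)
  qed
qed

text \<open>Only pairs a||b and b||a contribute, with weight w_b - w_a; then a and b are parallel.
  Nonempty targets exclude contributions of loops such as [a||e, a||aa].\<close>

lemma diagonal_weight_cochain_bracket:
  fixes f g :: "('v, 'a, 'k::field) cochain"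
  assumes f: "f \<in> cochains Q (arrow_paths Q) (path_basis Q Z)"
    and g: "g \<in> cochains Q (arrow_paths Q) (path_basis Q Z)"
    and nontrivial: "\<And>x p. (x, p) \<in> Poly_Mapping.keys f \<union> Poly_Mapping.keys g \<Longrightarrow> snd p \<noteq> []"
    and parallel: "\<And>a b. a \<in> arcs Q \<Longrightarrow> b \<in> arcs Q \<Longrightarrow> tail Q a = tail Q b \<Longrightarrow> head Q a = head Q b
      \<Longrightarrow> w a = w b"
  shows "diagonal_weight Q w (cochain_bracket Q Z f g) = 0"
proof -
  have "diagonal_weight Q w (subst_sum Q Z y \<epsilon> (hd (snd x)) \<gamma> - subst_sum Q Z x \<gamma> (hd (snd y)) \<epsilon>) = 0"
    if k: "(x, \<gamma>) \<in> Poly_Mapping.keys f" "(y, \<epsilon>) \<in> Poly_Mapping.keys g" for x \<gamma> y \<epsilon>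
  proof -
    from f k(1) obtain a where a: "a \<in> arcs Q" "x = (tail Q a, [a])" "\<gamma> \<in> path_basis Q Z"
      "fst \<gamma> = tail Q a" "path_end Q \<gamma> = head Q a" by (rule keys_cochains1)
    from g k(2) obtain b where b: "b \<in> arcs Q" "y = (tail Q b, [b])" "fst \<epsilon> = tail Q b"
      by (rule keys_cochains1)
    have "snd \<gamma> \<noteq> []" "snd \<epsilon> \<noteq> []" using k nontrivial by blast+
    moreover have "w a = w b" if "snd \<gamma> = [b]"
    proof (rule parallel[OF a(1) b(1)])
      have "\<gamma> = (fst \<gamma>, [b])" using that by (metis prod.collapse)
      moreover have "\<gamma> \<in> paths Q" using a(3) by (simp add: path_basis_def)
      ultimately have "(fst \<gamma>, [b]) \<in> paths Q" "path_end Q (fst \<gamma>, [b]) = head Q a"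
        using a(5) by simp_all
      then show "tail Q a = tail Q b" "head Q a = head Q b" using a(4) by simp_all
    qed
    ultimately show ?thesis
      using a(1,2,4) b by (simp add: diagonal_weight_simps diagonal_weight_subst_sum)
  qed
  then show ?thesis
    unfolding cochain_bracket_def diagonal_weight_linear_extension
    by (intro sum.neutral ballI) (auto simp: diagonal_weight_linear_extension intro!: sum.neutral)
qed

end

text \<open>The flow along a walk is spread evenly over parallel arrows, whence the assumption on \<open>'k\<close>.\<close>

lemma (in fin_digraph) symmetric_flow:
  assumes char: "CHAR('k::field) = 0" and reach: "s \<rightarrow>\<^sup>*\<^bsub>with_proj (mk_symmetric G)\<^esub> u"
  shows "\<exists>w :: 'b \<Rightarrow> 'k. (\<forall>a\<in>arcs G. \<forall>b\<in>arcs G. tail G a = tail G b \<longrightarrow> head G a = head G b \<longrightarrow> w a = w b)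
    \<and> (\<forall>v. (\<Sum>a | a \<in> arcs G \<and> head G a = v. w a) - (\<Sum>a | a \<in> arcs G \<and> tail G a = v. w a)
        = of_bool (v = u) - of_bool (v = s))"
proof -
  have "(s, u) \<in> rtrancl_on (pverts (mk_symmetric G)) (parcs (mk_symmetric G))"
    using reach unfolding reachable_def by simp
  then show ?thesis
  proof (induction rule: rtrancl_on_induct)
    case base
    show ?case by (intro exI[of _ "\<lambda>_. 0"]) simp
  next
    case (step u u')
    obtain w :: "'b \<Rightarrow> 'k"
      where w: "\<And>a b. a \<in> arcs G \<Longrightarrow> b \<in> arcs G \<Longrightarrow> tail G a = tail G b \<Longrightarrow> head G a = head G b \<Longrightarrow> w a = w b"
        "\<And>v. (\<Sum>a | a \<in> arcs G \<and> head G a = v. w a) - (\<Sum>a | a \<in> arcs G \<and> tail G a = v. w a)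
          = of_bool (v = u) - of_bool (v = s)"
      using step.IH by blast
    \<comment> \<open>The sign \<epsilon> is 1 or -1 according to whether the edge is traversed
      along the arrow or against it.\<close>
    from step(2) obtain a \<epsilon> where a: "a \<in> arcs G"
      "of_bool (v = u') - of_bool (v = u) = \<epsilon> * (of_bool (v = head G a) - of_bool (v = tail G a) :: 'k)" for v
    proof -
      from step(2) obtain a where "a \<in> arcs G"
        "u = tail G a \<and> u' = head G a \<or> u = head G a \<and> u' = tail G a"
        by (auto simp: parcs_mk_symmetric)
      then show thesis using that[of a 1] that[of a "-1"] by auto
    qed
    define P where "P = {b \<in> arcs G. tail G b = tail G a \<and> head G b = head G a}"
    have P: "finite P" "P \<subseteq> arcs G" "a \<in> P" using a(1) by (auto simp: P_def)
    then have "0 < card P" by (auto simp: card_gt_0_iff)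
    then have card: "of_nat (card P) \<noteq> (0 :: 'k)" by (rule of_nat_neq_0_if_CHAR_0[OF char])
    define d where "d b = (if b \<in> P then \<epsilon> / of_nat (card P) else 0)" for b
    have sum_P: "(\<Sum>b\<in>P. d b) = \<epsilon>" using card by (simp add: d_def)
    have hd: "(\<Sum>b | b \<in> arcs G \<and> head G b = v. d b) = \<epsilon> * of_bool (v = head G a)" for v
    proof -
      have "(\<Sum>b | b \<in> arcs G \<and> head G b = v. d b) = (\<Sum>b\<in>P. if v = head G a then d b else 0)"
        by (rule sum.mono_neutral_cong) (auto simp: P_def d_def)
      then show ?thesis by (simp add: sum_P)
    qed
    have tl: "(\<Sum>b | b \<in> arcs G \<and> tail G b = v. d b) = \<epsilon> * of_bool (v = tail G a)" for v
    proof -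
      have "(\<Sum>b | b \<in> arcs G \<and> tail G b = v. d b) = (\<Sum>b\<in>P. if v = tail G a then d b else 0)"
        by (rule sum.mono_neutral_cong) (auto simp: P_def d_def)
      then show ?thesis by (simp add: sum_P)
    qed
    have "(\<Sum>b | b \<in> arcs G \<and> head G b = v. w b + d b) - (\<Sum>b | b \<in> arcs G \<and> tail G b = v. w b + d b)
        = of_bool (v = u') - of_bool (v = s)" for v
    proof -
      have "(\<Sum>b | b \<in> arcs G \<and> head G b = v. w b + d b) - (\<Sum>b | b \<in> arcs G \<and> tail G b = v. w b + d b)
        = ((\<Sum>a | a \<in> arcs G \<and> head G a = v. w a) - (\<Sum>a | a \<in> arcs G \<and> tail G a = v. w a))
          + (\<epsilon> * of_bool (v = head G a) - \<epsilon> * of_bool (v = tail G a))"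
        unfolding sum.distrib hd tl by simp
      also have "\<dots> = of_bool (v = u) - of_bool (v = s) + (of_bool (v = u') - of_bool (v = u))"
        unfolding w(2) a(2) by (simp add: algebra_simps)
      finally show ?thesis by simp
    qed
    moreover have "w b + d b = w c + d c"
      if "b \<in> arcs G" "c \<in> arcs G" "tail G b = tail G c" "head G b = head G c" for b c
      using w(1)[OF that] that by (simp add: d_def P_def)
    ultimately show ?case by (intro exI[of _ "\<lambda>b. w b + d b"]) blast
  qed
qed

section \<open>The circulation on the glued quiver\<close>

context source_sink_gluing
begin

text \<open>Gluing creates no new parallel arrows, so a function averaged over parallel arrows of A
  is also constant on parallel arrows of B. The reason is that f_1 and f_2 each get incoming arrows
  of B from essentially one side: none enters e_1, and only the glued arrow enters f_2.\<close>

lemma glued_parallel: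
  assumes ab: "a \<in> arcs QB" "b \<in> arcs QB" "tail QB a = tail QB b" "head QB a = head QB b"
  shows "tail Q a = tail Q b" "head Q a = head Q b"
proof -
  have arcs: "a \<in> arcs Q" "b \<in> arcs Q" "a \<noteq> \<beta>" "b \<noteq> \<beta>" using ab by simp_all
  show tl: "tail Q a = tail Q b"
    using ab(3) arcs by simp
  show "head Q a = head Q b"
  proof (cases "a = \<alpha> \<or> b = \<alpha>")
    case True
    then show ?thesis using tl arcs by auto
  next
    case False
    then have "head Q a \<noteq> head Q \<beta>" "head Q b \<noteq> head Q \<beta>" using arcs by simp_all
    then show ?thesis
      using ab(4) arcs by (auto simp: star_vertex_def split: if_splits)
  qed
qed

text \<open>
  Since \<open>\<alpha>\<close> is the only arrow at its source, a unit flow from there to the source of \<open>\<beta>\<close> takes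
  the value 1 on \<open>\<alpha>\<close> and 0 on \<open>\<beta>\<close>; after gluing it closes up to a circulation.
\<close>

lemma glued_circulation:
  assumes char: "CHAR('k::field) = 0" and block: "same_block Q \<alpha> \<beta>"
  obtains w :: "'a \<Rightarrow> 'k::field" where "w \<alpha> = 1"
    "\<And>v. (\<Sum>a | a \<in> arcs QB \<and> tail QB a = v. w a) = (\<Sum>a | a \<in> arcs QB \<and> head QB a = v. w a)"
    "\<And>a b. a \<in> arcs QB \<Longrightarrow> b \<in> arcs QB \<Longrightarrow> tail QB a = tail QB b \<Longrightarrow> head QB a = head QB b
      \<Longrightarrow> w a = w b"
proof -
  obtain w :: "'a \<Rightarrow> 'k" where
    par: "\<And>a b. a \<in> arcs Q \<Longrightarrow> b \<in> arcs Q \<Longrightarrow> tail Q a = tail Q b \<Longrightarrow> head Q a = head Q b \<Longrightarrow> w a = w b"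
    and flow: "\<And>v. (\<Sum>a | a \<in> arcs Q \<and> head Q a = v. w a) - (\<Sum>a | a \<in> arcs Q \<and> tail Q a = v. w a)
        = of_bool (v = tail Q \<beta>) - of_bool (v = tail Q \<alpha>)"
    using symmetric_flow[OF char block[unfolded same_block_def]] by blast
  have sets: "{a \<in> arcs Q. head Q a = tail Q \<alpha>} = {}" "{a \<in> arcs Q. tail Q a = tail Q \<alpha>} = {\<alpha>}"
    "{a \<in> arcs Q. head Q a = head Q \<alpha>} = {\<alpha>}" "{a \<in> arcs Q. tail Q a = tail Q \<beta>} = {\<beta>}"
    "{a \<in> arcs Q. tail Q a = head Q \<beta>} = {}" "{a \<in> arcs Q. head Q a = head Q \<beta>} = {\<beta>}"
    by auto
  have w: "w \<alpha> = 1" "w \<beta> = 0"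
    using flow[of "tail Q \<alpha>"] flow[of "head Q \<beta>"] unfolding sets by simp_all
  have "(\<Sum>a | a \<in> arcs QB \<and> tail QB a = v. w a) = (\<Sum>a | a \<in> arcs QB \<and> head QB a = v. w a)" for v
  proof -
    consider "v = tail Q \<alpha>" | "v = head Q \<alpha>" | "v = tail Q \<beta> \<or> v = head Q \<beta>"
      | "v \<noteq> tail Q \<alpha>" "v \<noteq> head Q \<alpha>" "v \<noteq> tail Q \<beta>" "v \<noteq> head Q \<beta>" by blast
    then show ?thesis
    proof cases
      case 1
      \<comment> \<open>At f_1 the outflow is \<open>w \<alpha>\<close> = 1. The inflow is that of
        e_{n-1} in A, which exceeds the outflow \<open>w \<beta>\<close> = 0 by the unit delivered
        there.\<close>
      have "{a \<in> arcs QB. tail QB a = v} = {\<alpha>}"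
        "{a \<in> arcs QB. head QB a = v} = {a \<in> arcs Q. head Q a = tail Q \<beta>}" using 1 by auto
      then show ?thesis using flow[of "tail Q \<beta>"] unfolding sets by (simp add: w)
    next
      case 2
      have "{a \<in> arcs QB. tail QB a = v} = {a \<in> arcs Q. tail Q a = head Q \<alpha>}"
        "{a \<in> arcs QB. head QB a = v} = {\<alpha>}" using 2 by auto
      then show ?thesis using flow[of "head Q \<alpha>"] unfolding sets by (simp add: w)
    next
      case 3
      then have "sv u \<noteq> v" for u by (auto simp: star_vertex_def)
      then show ?thesis by simp
    next
      case 4
      then have sv: "sv u = v \<longleftrightarrow> u = v" for u using star_vertex_eq_other[of u v] by auto
      have "{a \<in> arcs QB. tail QB a = v} = {a \<in> arcs Q. tail Q a = v}"
        "{a \<in> arcs QB. head QB a = v} = {a \<in> arcs Q. head Q a = v}" using 4 sv by auto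
      then show ?thesis using flow[of v] 4 by simp
    qed
  qed
  moreover have "w a = w b"
    if "a \<in> arcs QB" "b \<in> arcs QB" "tail QB a = tail QB b" "head QB a = head QB b" for a b
    using glued_parallel[OF that] that by (intro par) auto
  ultimately show thesis using that w(1) by blast
qed

text \<open>Transferred from A: a coefficient at an unglued pair is also one of
  \<open>unglued_part f\<close>, a cocycle of A. The other pairs run between the distinct vertices
  f_1 and f_2, so their paths are nontrivial.\<close>

lemma glued_cocycle_target_nontrivial:
  fixes f :: "('v, 'a, 'k::field) cochain"
  assumes char: "CHAR('k) = 0" and f: "f \<in> cocycles1 QB ZB"
    and key: "(x, p) \<in> Poly_Mapping.keys f"
  shows "snd p \<noteq> []"
proof -
  have C: "f \<in> cochains QB (arrow_paths QB) (path_basis QB ZB)"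
    using f by (simp add: B.cocycles1_iff)
  with key have "(x, p) \<in> parallel_pairs QB (arrow_paths QB) (path_basis QB ZB)"
    by (auto simp: cochains_def)
  then show ?thesis
  proof (cases rule: glued_pairs_cases)
    case 1
    have "f - unglued_part f \<in> {h. Poly_Mapping.keys h \<subseteq> {gamma, beta_path} \<times> UNIV}"
      unfolding diff_unglued_part
      by (rule linear_extension_in_subspace[OF subspace_supported]) (auto split: if_split_asm)
    moreover have "x \<notin> {gamma, beta_path}" using 1 by (auto simp: unglued_pairs_def)
    ultimately have "(x, p) \<notin> Poly_Mapping.keys (f - unglued_part f)" by auto
    then have "Poly_Mapping.lookup (unglued_part f) (x, p) = Poly_Mapping.lookup f (x, p)"
      by (simp add: in_keys_iff lookup_minus)
    then have "(x, p) \<in> Poly_Mapping.keys (unglued_part f)" using key by (simp add: in_keys_iff)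
    moreover have "unglued_part f \<in> cocycles1 Q Z" using f unglued_part_cocycle_iff[OF C] by simp
    ultimately show ?thesis using cocycle_target_nontrivial[OF char] by blast
  next
    case 2
    then show ?thesis using path_end_Nil[of QB "fst p"] by (metis ends(1) prod.collapse)
  qed
qed

section \<open>The splitting isomorphism\<close>

definition HH1_split ::
  "('a \<Rightarrow> 'k::field) \<Rightarrow> ('v, 'a, 'k) cochain set \<Rightarrow> ('v, 'a, 'k) cochain set \<times> 'k" where
  "HH1_split w X = (let f = SOME f. f \<in> X in (HH1_class Q Z (unglued_part f), diagonal_weight QB w f))"

context
  fixes w :: "'a \<Rightarrow> 'k::field"
  assumes char: "CHAR('k) = 0" and w_\<alpha>: "w \<alpha> = 1"
    and circulation: "\<And>v. (\<Sum>a | a \<in> arcs QB \<and> tail QB a = v. w a)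
      = (\<Sum>a | a \<in> arcs QB \<and> head QB a = v. w a)"
    and parallel: "\<And>a b. a \<in> arcs QB \<Longrightarrow> b \<in> arcs QB \<Longrightarrow> tail QB a = tail QB b
      \<Longrightarrow> head QB a = head QB b \<Longrightarrow> w a = w b"
begin

lemma weight_gamma: "diagonal_weight QB w (basis_elt gamma gamma) = 1"
  using B.diagonal_weight_basis_proj[of \<alpha> w gamma] B.basis_proj_arrow[of \<alpha>, where 'b = 'k]
  by (simp add: w_\<alpha>)

lemma gamma_not_coboundary: "basis_elt gamma gamma \<notin> (coboundaries1 QB ZB :: ('v, 'a, 'k) cochain set)"
  using weight_gamma B.diagonal_weight_coboundary[OF circulation] by (metis zero_neq_one)

text \<open>This is the injectivity of the splitting. Vanishing of the first component puts
  \<open>f\<close> in the line of the glued arrow, and the weight, which is 1 on that arrow and 0 on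
  coboundaries, reads off the coefficient.\<close>

lemma coboundary_if_unglued_part:
  fixes f :: "('v, 'a, 'k) cochain"
  assumes f: "f \<in> cocycles1 QB ZB" and r: "unglued_part f \<in> coboundaries1 Q Z"
    and 0: "diagonal_weight QB w f = 0"
  shows "f \<in> coboundaries1 QB ZB"
proof -
  have "f \<in> cochains QB (arrow_paths QB) (path_basis QB ZB)"
    using f by (simp add: B.cocycles1_iff)
  then have "f \<in> gamma_span" using r by (rule gamma_span_if_unglued_part)
  then obtain u where u: "f - scale_cochain u (basis_elt gamma gamma) \<in> coboundaries1 QB ZB"
    by (auto simp: gamma_span_def)
  from B.diagonal_weight_coboundary[OF circulation this] have "u = 0"
    using 0 by (simp add: diagonal_weight_simps weight_gamma)
  with u show ?thesis by simp
qed

text \<open>Both components take coboundaries of B to zero classes, so the representative chosen in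
  \<open>HH1_split\<close> is immaterial.\<close>

lemma HH1_split_class:
  fixes f :: "('v, 'a, 'k) cochain"
  shows "HH1_split w (HH1_class QB ZB f) = (HH1_class Q Z (unglued_part f), diagonal_weight QB w f)"
proof -
  define f' where "f' = (SOME f'. f' \<in> HH1_class QB ZB f)"
  have "f' \<in> HH1_class QB ZB f"
    unfolding f'_def using self_in_coset[OF B.subspace_coboundaries1] by (rule someI)
  then have j: "f' - f \<in> coboundaries1 QB ZB" by (simp add: mem_coset_iff)
  have "unglued_part f' - unglued_part f \<in> coboundaries1 Q Z"
    using unglued_part_coboundary[OF j] by (simp add: unglued_part_simps)
  moreover have "diagonal_weight QB w f' = diagonal_weight QB w f"
    using B.diagonal_weight_coboundary[OF circulation j] by (simp add: diagonal_weight_simps)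
  ultimately show ?thesis
    by (simp add: HH1_split_def f'_def[symmetric] coset_eq_iff[OF subspace_coboundaries1])
qed

lemma HH1_split_bij:
  "bij_betw (HH1_split w) (HH1_class QB ZB ` cocycles1 QB ZB)
     ((HH1_class Q Z ` cocycles1 Q Z) \<times> UNIV)"
  unfolding bij_betw_def
proof
  show "inj_on (HH1_split w) (HH1_class QB ZB ` cocycles1 QB ZB)"
  proof (rule inj_onI, clarify)
    fix f g :: "('v, 'a, 'k) cochain" assume fg: "f \<in> cocycles1 QB ZB" "g \<in> cocycles1 QB ZB"
      "HH1_split w (HH1_class QB ZB f) = HH1_split w (HH1_class QB ZB g)"
    have "f - g \<in> coboundaries1 QB ZB"
      using fg cochain.subspace_diff[OF B.subspace_cocycles1 fg(1,2)]
      by (intro coboundary_if_unglued_part)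
        (auto simp: HH1_split_class coset_eq_iff[OF subspace_coboundaries1] unglued_part_simps
          diagonal_weight_simps)
    then show "HH1_class QB ZB f = HH1_class QB ZB g"
      by (simp add: coset_eq_iff[OF B.subspace_coboundaries1])
  qed
  show "HH1_split w ` HH1_class QB ZB ` cocycles1 QB ZB = (HH1_class Q Z ` cocycles1 Q Z) \<times> UNIV"
  proof (intro equalityI subsetI)
    fix X assume "X \<in> HH1_split w ` HH1_class QB ZB ` cocycles1 QB ZB"
    then obtain f :: "('v, 'a, 'k) cochain"
      where "f \<in> cocycles1 QB ZB" "X = HH1_split w (HH1_class QB ZB f)" by blast
    then show "X \<in> (HH1_class Q Z ` cocycles1 Q Z) \<times> UNIV"
      using unglued_part_cocycle_iff[of f] by (auto simp: HH1_split_class B.cocycles1_iff)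
  next
    fix X assume "X \<in> ((HH1_class Q Z ` cocycles1 Q Z) \<times> UNIV :: (('v, 'a, 'k) cochain set \<times> 'k) set)"
    then obtain f c where f: "f \<in> cocycles1 Q Z" and X: "X = (HH1_class Q Z f, c)" by blast
    have C: "f \<in> cochains Q (arrow_paths Q) (path_basis Q Z)" using f by (simp add: cocycles1_iff)
    have keys: "Poly_Mapping.keys (unglued_part f) \<subseteq> unglued_pairs" using C keys_unglued_part by blast
    have d: "f - unglued_part f \<in> coboundaries1 Q Z" by (rule diff_keys_unglued_part[OF C])
    have "f - unglued_part f \<in> cocycles1 Q Z" using d coboundaries1_subset_cocycles1 by blast
    from cochain.subspace_diff[OF subspace_cocycles1 f this]
    have r: "unglued_part f \<in> cocycles1 QB ZB" using unglued_cocycle_iff[OF keys] by simp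
    \<comment> \<open>A multiple of the glued arrow's class adjusts the weight to the prescribed
      \<open>c\<close> and is invisible to the projection.\<close>
    define h where "h = unglued_part f + scale_cochain (c - diagonal_weight QB w (unglued_part f)) (basis_elt gamma gamma)"
    have h: "h \<in> cocycles1 QB ZB"
      unfolding h_def
      by (intro cochain.subspace_add[OF B.subspace_cocycles1 r]
          cochain.subspace_scale[OF B.subspace_cocycles1] gamma_cocycle)
    have "unglued_part (basis_elt gamma gamma :: ('v, 'a, 'k) cochain) = 0" by (simp add: unglued_part_def)
    then have "unglued_part h = unglued_part f" by (simp add: h_def unglued_part_simps unglued_part_id[OF keys])
    moreover have "diagonal_weight QB w h = c"
      by (simp add: h_def diagonal_weight_simps weight_gamma)
    moreover have "HH1_class Q Z (unglued_part f) = HH1_class Q Z f"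
      using cochain.subspace_neg[OF subspace_coboundaries1 d]
      by (simp add: coset_eq_iff[OF subspace_coboundaries1])
    ultimately have "X = HH1_split w (HH1_class QB ZB h)" by (simp add: HH1_split_class X)
    with h show "X \<in> HH1_split w ` HH1_class QB ZB ` cocycles1 QB ZB" by blast
  qed
qed

lemma HH1_split_lie_iso: "lie_iso (HH1_split w) (HH1 QB ZB) (HH1 Q Z \<times>\<^sub>L lie_field)"
proof -
  have carrier: "lcarrier (HH1 QB ZB) = HH1_class QB ZB ` cocycles1 QB ZB"
    "lcarrier (HH1 Q Z \<times>\<^sub>L lie_field) = (HH1_class Q Z ` cocycles1 Q Z) \<times> UNIV"
    by (simp_all add: HH1_def lie_prod_def lie_field_def)
  have ops: "ladd (HH1 Q Z \<times>\<^sub>L lie_field) (X, c) (Y, d) = (ladd (HH1 Q Z) X Y, c + d)"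
    "lscale (HH1 Q Z \<times>\<^sub>L lie_field) c (X, d) = (lscale (HH1 Q Z) c X, c * d)"
    "lbracket (HH1 Q Z \<times>\<^sub>L lie_field) (X, c) (Y, d) = (lbracket (HH1 Q Z) X Y, 0)"
    for X Y :: "('v, 'a, 'k) cochain set" and c d
    by (simp_all add: lie_prod_def lie_field_def)
  have bracket: "HH1_split w (lbracket (HH1 QB ZB) (HH1_class QB ZB f) (HH1_class QB ZB g))
      = lbracket (HH1 Q Z \<times>\<^sub>L lie_field) (HH1_split w (HH1_class QB ZB f)) (HH1_split w (HH1_class QB ZB g))"
    if fg: "f \<in> cocycles1 QB ZB" "g \<in> cocycles1 QB ZB" for f g :: "('v, 'a, 'k) cochain"
  proof -
    have C: "f \<in> cochains QB (arrow_paths QB) (path_basis QB ZB)"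
      "g \<in> cochains QB (arrow_paths QB) (path_basis QB ZB)"
      using fg by (simp_all add: B.cocycles1_iff)
    then have r: "unglued_part f \<in> cocycles1 Q Z" "unglued_part g \<in> cocycles1 Q Z"
      using fg unglued_part_cocycle_iff by blast+
    have "diagonal_weight QB w (cochain_bracket QB ZB f g) = 0"
      using glued_cocycle_target_nontrivial[OF char] fg parallel
      by (intro B.diagonal_weight_cochain_bracket[OF C]) blast+
    then show ?thesis
      using fg r C by (simp add: B.HH1_lbracket HH1_lbracket HH1_split_class ops unglued_part_cochain_bracket)
  qed
  show ?thesis
    unfolding lie_iso_def carrier
    using HH1_split_bij bracket
    by (auto simp: B.HH1_ladd HH1_ladd B.HH1_lscale HH1_lscale HH1_split_class ops unglued_part_simps
        diagonal_weight_simps)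
qed

end

text \<open>Both orders of the bracket are recorded: the ideal property uses the first and the
  centre the second.\<close>

lemma gamma_line:
  fixes f :: "('v, 'a, 'k::field) cochain"
  assumes f: "f \<in> cocycles1 QB ZB"
  shows "lbracket (HH1 QB ZB) (HH1_class QB ZB f) (HH1_class QB ZB (scale_cochain u (basis_elt gamma gamma)))
      = coboundaries1 QB ZB"
    "lbracket (HH1 QB ZB) (HH1_class QB ZB (scale_cochain u (basis_elt gamma gamma))) (HH1_class QB ZB f)
      = coboundaries1 QB ZB"
proof -
  let ?g = "scale_cochain u (basis_elt gamma gamma) :: ('v, 'a, 'k) cochain"
  note sub = B.subspace_coboundaries1[where 'b = 'k]
  have g: "?g \<in> cocycles1 QB ZB"
    by (intro cochain.subspace_scale[OF B.subspace_cocycles1] gamma_cocycle)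
  have C: "f \<in> cochains QB (arrow_paths QB) (path_basis QB ZB)"
    using f by (simp add: B.cocycles1_iff)
  have 1: "cochain_bracket QB ZB ?g f \<in> coboundaries1 QB ZB"
    using cochain.subspace_scale[OF sub gamma_central[OF C]] by (simp add: cochain_bracket_scale_left)
  then have 2: "cochain_bracket QB ZB f ?g \<in> coboundaries1 QB ZB"
    using cochain.subspace_neg[OF sub] cochain_bracket_swap by metis
  have "HH1_class QB ZB h = coboundaries1 QB ZB" if "h \<in> coboundaries1 QB ZB" for h :: "('v, 'a, 'k) cochain"
    using coset_eq_iff[OF sub, of h 0] that by (simp add: coset_0)
  with 1 2 show "lbracket (HH1 QB ZB) (HH1_class QB ZB f) (HH1_class QB ZB ?g) = coboundaries1 QB ZB"
    "lbracket (HH1 QB ZB) (HH1_class QB ZB ?g) (HH1_class QB ZB f) = coboundaries1 QB ZB"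
    using f g by (simp_all add: B.HH1_lbracket)
qed

end

theorem corollary3p22:
  fixes QA QB :: "('v, 'a) quiver" and ZA ZB :: "('v, 'a) qpath set"
    and \<alpha> \<beta> :: 'a
    and HA HB :: "('k::field, ('v, 'a, 'k) cochain set) lie_struct"
    and \<gamma> :: "('v, 'a) qpath" and c :: "('v, 'a, 'k) cochain set"
    and I :: "('v, 'a, 'k) cochain set set"
  assumes "monomial_algebra QA ZA"
    and "source_arrow QA \<alpha>" and "sink_arrow QA \<beta>"
    and "distinct [tail QA \<alpha>, head QA \<alpha>, tail QA \<beta>, head QA \<beta>]"
    and "same_block QA \<alpha> \<beta>"
    and "QB = glue_quiver QA \<alpha> \<beta>" and "ZB = glue_relations QA ZA \<alpha> \<beta>"
    and "HA = HH1 QA ZA" and "HB = HH1 QB ZB"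
    and "\<gamma> = arrow_path QB (star_arrow \<alpha> \<beta> \<alpha>)"
    and "c = HH1_class QB ZB (basis_elt \<gamma> \<gamma>)"
    and "I = lie_line HB c"
    and "CHAR('k) = 0"
  shows "c \<in> lcarrier HB \<and> c \<noteq> lzero HB \<and> lie_ideal HB I
    \<and> I \<subseteq> lie_center HB
    \<and> HB \<simeq>\<^sub>L HA \<times>\<^sub>L lie_field"
proof -
  interpret source_sink_gluing QA ZA \<alpha> \<beta>
    using assms(1-4) by (simp add: source_sink_gluing_def source_sink_gluing_axioms_def)
  obtain w :: "'a \<Rightarrow> 'k" where w: "w \<alpha> = 1"
    "\<And>v. (\<Sum>a | a \<in> arcs (glue_quiver QA \<alpha> \<beta>) \<and> tail (glue_quiver QA \<alpha> \<beta>) a = v. w a)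
      = (\<Sum>a | a \<in> arcs (glue_quiver QA \<alpha> \<beta>) \<and> head (glue_quiver QA \<alpha> \<beta>) a = v. w a)"
    "\<And>a b. a \<in> arcs (glue_quiver QA \<alpha> \<beta>) \<Longrightarrow> b \<in> arcs (glue_quiver QA \<alpha> \<beta>)
      \<Longrightarrow> tail (glue_quiver QA \<alpha> \<beta>) a = tail (glue_quiver QA \<alpha> \<beta>) b
      \<Longrightarrow> head (glue_quiver QA \<alpha> \<beta>) a = head (glue_quiver QA \<alpha> \<beta>) b \<Longrightarrow> w a = w b"
    by (rule glued_circulation[OF assms(13,5)], rule that)
  let ?g = "basis_elt gamma gamma :: ('v, 'a, 'k) cochain"
  have gamma: "\<gamma> = gamma" by (simp add: assms(6,10) arrow_path_def)
  then have c: "c = HH1_class QB ZB ?g" by (simp add: assms(11))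
  have I: "I = range (\<lambda>u. HH1_class QB ZB (scale_cochain u ?g))"
    unfolding assms(12) lie_line_def c assms(6,7,9) by (simp add: B.HH1_lscale)
  have carrier: "lcarrier HB = HH1_class QB ZB ` cocycles1 QB ZB" and zero: "lzero HB = coboundaries1 QB ZB"
    by (simp_all add: assms(9) HH1_def)
  have g: "scale_cochain u ?g \<in> cocycles1 QB ZB" for u
    unfolding assms(6,7) by (intro cochain.subspace_scale[OF B.subspace_cocycles1] gamma_cocycle)
  have I_carrier: "I \<subseteq> lcarrier HB" using g by (auto simp: I carrier)
  have zero_I: "lzero HB \<in> I"
    unfolding I zero by (rule image_eqI[of _ _ 0]) (simp_all add: coset_0)
  have bracket: "lbracket HB x y = lzero HB" "lbracket HB y x = lzero HB"
    if xy: "x \<in> lcarrier HB" "y \<in> I" for x y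
  proof -
    obtain f u where "f \<in> cocycles1 QB ZB" "x = HH1_class QB ZB f"
      "y = HH1_class QB ZB (scale_cochain u ?g)"
      using xy unfolding carrier I by blast
    then show "lbracket HB x y = lzero HB" "lbracket HB y x = lzero HB"
      unfolding zero unfolding assms(9) unfolding assms(6,7) by (simp_all only: gamma_line)
  qed
  have "c \<in> lcarrier HB" using g[of 1] by (simp add: c carrier)
  moreover have "c \<noteq> lzero HB"
    using gamma_not_coboundary[OF assms(13) w] coset_eq_iff[OF B.subspace_coboundaries1, of ?g 0]
    by (simp add: c zero coset_0 assms(6,7))
  moreover have "lie_ideal HB I"
    unfolding lie_ideal_def
  proof (intro conjI I_carrier zero_I ballI allI)
    fix x y assume "x \<in> I" "y \<in> I"
    then show "ladd HB x y \<in> I"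
      by (auto simp: I assms(6,7,9) B.HH1_ladd simp flip: cochain.scale_left_distrib)
  next
    fix u x assume "x \<in> I"
    then show "lscale HB u x \<in> I" by (auto simp: I assms(6,7,9) B.HH1_lscale)
  next
    fix x y assume "x \<in> lcarrier HB" "y \<in> I"
    then show "lbracket HB x y \<in> I" using bracket(1) zero_I by simp
  qed
  moreover have "I \<subseteq> lie_center HB"
    using bracket(2) I_carrier by (auto simp: lie_center_def)
  moreover have "HB \<simeq>\<^sub>L HA \<times>\<^sub>L lie_field"
    unfolding lie_isomorphic_def assms(6-9) using HH1_split_lie_iso[OF assms(13) w] by blast
  ultimately show ?thesis by blast
qed

end
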